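(* Let $K$ be a small field of positive characteristic and let $\sigma:K\to K$ be a definable field morphism. If the set $\{x\in K:\sigma(x)=x\}$ of points fixed by $\sigma$ is infinite, then $\sigma$ is the identity of $K$.
   Context: Fields may carry extra first-order structure beyond the field language. A structure is small if its theory is small, i.e. has only countably many complete $n$-types without parameters for every natural number $n$ (equivalently, over any fixed finite parameter set). Definable means definable with parameters in the structure. *)

theory Defs
  imports "HOL-Computational_Algebra.Computational_Algebra" "HOL-Library.Countable_Set"
begin

section \<open>First-order logic\<close>

(* A symbol is a name together with an arity, so a language is a set of such pairs. Languages may
   be empty, infinite or uncountable. Formulas use named variables; since bound variables may be
   renamed at will, "formula in the variables x_0, ..., x_(n-1)" only constrains the free ones. *)

datatype 'f trm = Var nat | Fun 'f "'f trm list"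

datatype ('f, 'r) fm =
    Eq "'f trm" "'f trm"
  | Rel 'r "'f trm list"
  | Neg "('f, 'r) fm"
  | And "('f, 'r) fm" "('f, 'r) fm"
  | Ex nat "('f, 'r) fm"

record ('f, 'r) language =
  fun_syms :: "('f \<times> nat) set"
  rel_syms :: "('r \<times> nat) set"

fun wf_trm :: "('f, 'r) language \<Rightarrow> 'f trm \<Rightarrow> bool" where
  "wf_trm L (Var i) \<longleftrightarrow> True"
| "wf_trm L (Fun f ts) \<longleftrightarrow> (f, length ts) \<in> fun_syms L \<and> (\<forall>t\<in>set ts. wf_trm L t)"

fun wf_fm :: "('f, 'r) language \<Rightarrow> ('f, 'r) fm \<Rightarrow> bool" where
  "wf_fm L (Eq s t) \<longleftrightarrow> wf_trm L s \<and> wf_trm L t"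
| "wf_fm L (Rel r ts) \<longleftrightarrow> (r, length ts) \<in> rel_syms L \<and> (\<forall>t\<in>set ts. wf_trm L t)"
| "wf_fm L (Neg \<phi>) \<longleftrightarrow> wf_fm L \<phi>"
| "wf_fm L (And \<phi> \<psi>) \<longleftrightarrow> wf_fm L \<phi> \<and> wf_fm L \<psi>"
| "wf_fm L (Ex i \<phi>) \<longleftrightarrow> wf_fm L \<phi>"

fun vars_trm :: "'f trm \<Rightarrow> nat set" where
  "vars_trm (Var i) = {i}"
| "vars_trm (Fun f ts) = (\<Union>t\<in>set ts. vars_trm t)"

fun free_vars :: "('f, 'r) fm \<Rightarrow> nat set" where
  "free_vars (Eq s t) = vars_trm s \<union> vars_trm t"
| "free_vars (Rel r ts) = (\<Union>t\<in>set ts. vars_trm t)"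
| "free_vars (Neg \<phi>) = free_vars \<phi>"
| "free_vars (And \<phi> \<psi>) = free_vars \<phi> \<union> free_vars \<psi>"
| "free_vars (Ex i \<phi>) = free_vars \<phi> - {i}"

(* The universe of a structure is the whole type 'a. The values of the interpretation at symbols
   outside the language under consideration are irrelevant. *)

record ('a, 'f, 'r) struc =
  fun_interp :: "'f \<Rightarrow> 'a list \<Rightarrow> 'a"
  rel_interp :: "'r \<Rightarrow> 'a list \<Rightarrow> bool"

fun eval_trm :: "('a, 'f, 'r) struc \<Rightarrow> (nat \<Rightarrow> 'a) \<Rightarrow> 'f trm \<Rightarrow> 'a" where
  "eval_trm M e (Var i) = e i"
| "eval_trm M e (Fun f ts) = fun_interp M f (map (eval_trm M e) ts)"

fun sat :: "('a, 'f, 'r) struc \<Rightarrow> (nat \<Rightarrow> 'a) \<Rightarrow> ('f, 'r) fm \<Rightarrow> bool" where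
  "sat M e (Eq s t) \<longleftrightarrow> eval_trm M e s = eval_trm M e t"
| "sat M e (Rel r ts) \<longleftrightarrow> rel_interp M r (map (eval_trm M e) ts)"
| "sat M e (Neg \<phi>) \<longleftrightarrow> \<not> sat M e \<phi>"
| "sat M e (And \<phi> \<psi>) \<longleftrightarrow> sat M e \<phi> \<and> sat M e \<psi>"
| "sat M e (Ex i \<phi>) \<longleftrightarrow> (\<exists>a. sat M (e(i := a)) \<phi>)"

section \<open>Types, small structures, definable sets\<close>

definition formulas :: "('f, 'r) language \<Rightarrow> nat \<Rightarrow> ('f, 'r) fm set" where
  "formulas L n = {\<phi>. wf_fm L \<phi> \<and> free_vars \<phi> \<subseteq> {..<n}}"

definition theory_of :: "('f, 'r) language \<Rightarrow> ('a, 'f, 'r) struc \<Rightarrow> ('f, 'r) fm set" where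
  "theory_of L M = {\<phi> \<in> formulas L 0. \<forall>e. sat M e \<phi>}"

definition finitely_satisfiable ::
    "('f, 'r) language \<Rightarrow> ('a, 'f, 'r) struc \<Rightarrow> nat \<Rightarrow> ('f, 'r) fm set \<Rightarrow> bool" where
  "finitely_satisfiable L M n p \<longleftrightarrow>
     p \<subseteq> formulas L n \<and> (\<forall>\<Delta>. \<Delta> \<subseteq> p \<and> finite \<Delta> \<longrightarrow> (\<exists>e. \<forall>\<phi>\<in>\<Delta>. sat M e \<phi>))"

(* A complete n-type without parameters is a maximal finitely satisfiable set of formulas in
   x_0, ..., x_(n-1). It need not be realised in M itself. Since the theory of M is complete, these
   are the maximal sets of such formulas consistent with it; they depend only on that theory
   (lemma complete_types_cong below). *)

definition complete_types ::
    "('f, 'r) language \<Rightarrow> ('a, 'f, 'r) struc \<Rightarrow> nat \<Rightarrow> ('f, 'r) fm set set" where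
  "complete_types L M n =
     {p. finitely_satisfiable L M n p \<and>
         (\<forall>q. finitely_satisfiable L M n q \<and> p \<subseteq> q \<longrightarrow> q = p)}"

definition small :: "('f, 'r) language \<Rightarrow> ('a, 'f, 'r) struc \<Rightarrow> bool" where
  "small L M \<longleftrightarrow> (\<forall>n. countable (complete_types L M n))"

(* The variables x_0, ..., x_(n-1) range over the set being defined; the finitely many other free
   variables of the formula take the values c 0, c 1, ..., which are the parameters. *)

definition definable_set ::
    "('f, 'r) language \<Rightarrow> ('a, 'f, 'r) struc \<Rightarrow> nat \<Rightarrow> 'a list set \<Rightarrow> bool" where
  "definable_set L M n X \<longleftrightarrow>
     (\<exists>\<phi> c. wf_fm L \<phi> \<and>
        X = {xs. length xs = n \<and> sat M (\<lambda>i. if i < n then xs ! i else c (i - n)) \<phi>})"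

definition definable_fun ::
    "('f, 'r) language \<Rightarrow> ('a, 'f, 'r) struc \<Rightarrow> ('a \<Rightarrow> 'a) \<Rightarrow> bool" where
  "definable_fun L M g \<longleftrightarrow> definable_set L M 2 {[x, g x] | x. True}"

section \<open>Fields with extra structure\<close>

datatype 'f field_sym = Zero | One | Plus | Minus | Times | Extra 'f

definition expands_field ::
    "('f field_sym, 'r) language \<Rightarrow> ('a::field, 'f field_sym, 'r) struc \<Rightarrow> bool" where
  "expands_field L M \<longleftrightarrow>
     {(Zero, 0), (One, 0), (Plus, 2), (Minus, 1), (Times, 2)} \<subseteq> fun_syms L \<and>
     fun_interp M Zero [] = 0 \<and>
     fun_interp M One [] = 1 \<and>
     (\<forall>x y. fun_interp M Plus [x, y] = x + y) \<and>
     (\<forall>x. fun_interp M Minus [x] = - x) \<and>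
     (\<forall>x y. fun_interp M Times [x, y] = x * y)"

definition field_morphism :: "('a::field \<Rightarrow> 'b::field) \<Rightarrow> bool" where
  "field_morphism g \<longleftrightarrow>
     g 0 = 0 \<and> g 1 = 1 \<and> (\<forall>x y. g (x + y) = g x + g y) \<and> (\<forall>x y. g (x * y) = g x * g y)"

section \<open>Smallness is a property of the theory\<close>

lemma eval_trm_cong:
  "(\<And>i. i \<in> vars_trm t \<Longrightarrow> e i = e' i) \<Longrightarrow> eval_trm M e t = eval_trm M e' t"
proof (induction t)
  case (Fun f ts)
  then have "map (eval_trm M e) ts = map (eval_trm M e') ts" by auto
  then show ?case by (simp only: eval_trm.simps sat.simps)
qed simp

lemma sat_cong:
  "(\<And>i. i \<in> free_vars \<phi> \<Longrightarrow> e i = e' i) \<Longrightarrow> sat M e \<phi> = sat M e' \<phi>"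
proof (induction \<phi> arbitrary: e e')
  case (Eq s t)
  then have "eval_trm M e s = eval_trm M e' s" "eval_trm M e t = eval_trm M e' t"
    by (auto intro!: eval_trm_cong)
  then show ?case by simp
next
  case (Rel r ts)
  then have "map (eval_trm M e) ts = map (eval_trm M e') ts"
    by (auto intro!: eval_trm_cong)
  then show ?case by (simp only: eval_trm.simps sat.simps)
next
  case (Neg \<phi>)
  have "sat M e \<phi> = sat M e' \<phi>" by (rule Neg.IH) (simp add: Neg.prems)
  then show ?case by simp
next
  case (And \<phi> \<psi>)
  have "sat M e \<phi> = sat M e' \<phi>" by (rule And.IH(1)) (simp add: And.prems)
  moreover have "sat M e \<psi> = sat M e' \<psi>" by (rule And.IH(2)) (simp add: And.prems)
  ultimately show ?case by simp
next
  case (Ex i \<phi>)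
  have "sat M (e(i := a)) \<phi> = sat M (e'(i := a)) \<phi>" for a
    by (rule Ex.IH) (simp add: Ex.prems)
  then show ?case by simp
qed

primrec conj_fm :: "('f, 'r) fm list \<Rightarrow> ('f, 'r) fm" where
  "conj_fm [] = Ex 0 (Eq (Var 0) (Var 0))"
| "conj_fm (\<phi> # \<phi>s) = And \<phi> (conj_fm \<phi>s)"

primrec ex_close :: "nat \<Rightarrow> ('f, 'r) fm \<Rightarrow> ('f, 'r) fm" where
  "ex_close 0 \<phi> = \<phi>"
| "ex_close (Suc n) \<phi> = ex_close n (Ex n \<phi>)"

lemma sat_conj_fm: "sat M e (conj_fm \<phi>s) \<longleftrightarrow> (\<forall>\<phi>\<in>set \<phi>s. sat M e \<phi>)"
  by (induction \<phi>s) auto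

lemma conj_fm_formulas: "set \<phi>s \<subseteq> formulas L n \<Longrightarrow> conj_fm \<phi>s \<in> formulas L n"
  by (induction \<phi>s) (auto simp: formulas_def)

lemma ex_close_formulas: "\<phi> \<in> formulas L n \<Longrightarrow> ex_close n \<phi> \<in> formulas L 0"
proof (induction n arbitrary: \<phi>)
  case (Suc n)
  have "Ex n \<phi> \<in> formulas L n"
    using Suc.prems by (auto simp: formulas_def less_Suc_eq)
  then show ?case using Suc.IH by simp
qed simp

lemma sat_ex_close:
  "\<phi> \<in> formulas L n \<Longrightarrow> sat M e (ex_close n \<phi>) \<longleftrightarrow> (\<exists>e'. sat M e' \<phi>)"
proof (induction n arbitrary: \<phi>)
  case 0
  then have "sat M e \<phi> = sat M e' \<phi>" for e'
    by (intro sat_cong) (auto simp: formulas_def)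
  then show ?case by auto
next
  case (Suc n)
  have "Ex n \<phi> \<in> formulas L n"
    using Suc.prems by (auto simp: formulas_def less_Suc_eq)
  then have "sat M e (ex_close n (Ex n \<phi>)) \<longleftrightarrow> (\<exists>e'. sat M e' (Ex n \<phi>))"
    by (rule Suc.IH)
  also have "\<dots> \<longleftrightarrow> (\<exists>e'. sat M e' \<phi>)"
  proof
    assume "\<exists>e'. sat M e' \<phi>"
    then obtain e' where "sat M e' \<phi>" ..
    then have "sat M (e'(n := e' n)) \<phi>" by simp
    then have "\<exists>a. sat M (e'(n := a)) \<phi>" by (rule exI[of _ "e' n"])
    then have "sat M e' (Ex n \<phi>)" by (simp only: sat.simps)
    then show "\<exists>e'. sat M e' (Ex n \<phi>)" by (rule exI[of _ e'])
  next
    assume "\<exists>e'. sat M e' (Ex n \<phi>)"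
    then obtain e' a where "sat M (e'(n := a)) \<phi>" unfolding sat.simps by blast
    then show "\<exists>e'. sat M e' \<phi>" by (rule exI[of _ "e'(n := a)"])
  qed
  finally show ?case by simp
qed

lemma finitely_satisfiable_iff_theory:
  "finitely_satisfiable L M n p \<longleftrightarrow>
     p \<subseteq> formulas L n \<and> (\<forall>\<phi>s. set \<phi>s \<subseteq> p \<longrightarrow> ex_close n (conj_fm \<phi>s) \<in> theory_of L M)"
proof -
  have *: "(\<exists>e. \<forall>\<phi>\<in>set \<phi>s. sat M e \<phi>) \<longleftrightarrow> ex_close n (conj_fm \<phi>s) \<in> theory_of L M"
    if "set \<phi>s \<subseteq> formulas L n" for \<phi>s
    using conj_fm_formulas[OF that] ex_close_formulas[OF conj_fm_formulas[OF that]]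
    by (simp add: theory_of_def sat_ex_close[where L = L] sat_conj_fm)
  have "(\<forall>\<Delta>. \<Delta> \<subseteq> p \<and> finite \<Delta> \<longrightarrow> P \<Delta>) \<longleftrightarrow> (\<forall>\<phi>s. set \<phi>s \<subseteq> p \<longrightarrow> P (set \<phi>s))" for P
  proof (intro iffI allI impI)
    fix \<Delta> assume P: "\<forall>\<phi>s. set \<phi>s \<subseteq> p \<longrightarrow> P (set \<phi>s)" and D: "\<Delta> \<subseteq> p \<and> finite \<Delta>"
    then obtain \<phi>s where "set \<phi>s = \<Delta>" using finite_list by blast
    then show "P \<Delta>" using P D by blast
  qed simp
  then have "finitely_satisfiable L M n p \<longleftrightarrow>
      p \<subseteq> formulas L n \<and> (\<forall>\<phi>s. set \<phi>s \<subseteq> p \<longrightarrow> (\<exists>e. \<forall>\<phi>\<in>set \<phi>s. sat M e \<phi>))"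
    unfolding finitely_satisfiable_def by simp
  also have "\<dots> \<longleftrightarrow>
      p \<subseteq> formulas L n \<and> (\<forall>\<phi>s. set \<phi>s \<subseteq> p \<longrightarrow> ex_close n (conj_fm \<phi>s) \<in> theory_of L M)"
  proof (rule conj_cong[OF refl], rule all_cong)
    fix \<phi>s assume "p \<subseteq> formulas L n" "set \<phi>s \<subseteq> p"
    then have "set \<phi>s \<subseteq> formulas L n" by blast
    then show "(\<exists>e. \<forall>\<phi>\<in>set \<phi>s. sat M e \<phi>) \<longleftrightarrow> ex_close n (conj_fm \<phi>s) \<in> theory_of L M"
      by (rule *)
  qed
  finally show ?thesis .
qed

lemma complete_types_cong:
  fixes M :: "('a, 'f, 'r) struc" and N :: "('b, 'f, 'r) struc"
  assumes "theory_of L M = theory_of L N"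
  shows "complete_types L M n = complete_types L N n"
  using assms by (simp add: complete_types_def finitely_satisfiable_iff_theory)

end

theory Submission
  imports Defs "HOL-Number_Theory.Residues"
begin

text \<open>
  Write \<open>F\<close> for the fixed field of \<open>\<sigma>\<close>, \<open>\<delta> = \<sigma> - id\<close>, \<open>W\<close> for the image of \<open>\<delta>\<close>, and \<open>p\<close> for the
  characteristic. Fix finitely many parameters, and let \<open>k\<close> be the field of points definable from
  them.

  Smallness enters only through a tree argument (\<open>small_no_perfect_tree\<close>): a family of nonempty
  definable sets over the fixed parameters, each containing two disjoint members of the family,
  would yield uncountably many types. Two consequences carry the proof. The first is a descending
  chain condition (\<open>trace_descending_chain\<close>): the traces on \<open>k\<close> of a descending sequence of definable
  additive groups cannot decrease strictly at every step, since the cosets of the groups would form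
  such a tree. The second is a notion of generic type of a definable field \<open>E\<close> for which
  \<open>E \<inter> k\<close> is infinite (\<open>invariant_ideal_with_finitely_many_atoms\<close>): there is a proper ideal of
  definable subsets of \<open>E\<close>, closed under preimages of finite-to-one definable maps, modulo which \<open>E\<close>
  is a finite union of atoms. By pigeonhole some nonzero element of \<open>E \<inter> k\<close> translates each atom to
  itself modulo the ideal, and rescaling shows that all of them do. So a definable additive subgroup outside the
  ideal contains \<open>E \<inter> k\<close>. A definable multiplicative subgroup \<open>X\<close> outside the ideal contains every
  nonzero \<open>c\<close> in \<open>E \<inter> k\<close>: some \<open>z\<close> satisfies \<open>z \<in> c X\<close>, \<open>z + 1 \<in> c X\<close> and \<open>1/z + 1 \<in> X/c\<close>, and
  \<open>1/z + 1 = (z + 1)/z\<close> lies in \<open>X\<close>. Hence \<open>x \<mapsto> x^p - x\<close> and \<open>x \<mapsto> x^n\<close> map \<open>E\<close> onto \<open>E\<close>. By counting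
  in finite fields, such an \<open>E\<close> contains all roots of unity of prime order different from \<open>p\<close>
  (\<open>primitive_root_of_unity\<close>).

  Apply this to \<open>F\<close>. If \<open>\<sigma> x = x + 1\<close>, then \<open>x^p - x\<close> lies in \<open>F\<close>, hence equals \<open>b^p - b\<close> for some \<open>b\<close>
  in \<open>F\<close>; then \<open>x - b\<close> lies in the prime field and \<open>x\<close> in \<open>F\<close>, which is absurd. So \<open>F \<inter> W = 0\<close>,
  \<open>\<delta>\<close> is injective on \<open>W\<close>, and the chain condition for the images of the powers of \<open>\<delta>\<close> gives
  \<open>K = F \<oplus> W\<close>. Let \<open>\<pi>\<close> be the projection to \<open>F\<close>. For a point \<open>a\<close>, the chain condition applied to the
  groups \<open>{x. \<pi>(a^j x) = 0 for all j < n}\<close> makes some functional \<open>x \<mapsto> \<pi>(a^n x)\<close> a combination of the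
  earlier ones, and since \<open>(x, y) \<mapsto> \<pi>(x y)\<close> is nondegenerate, \<open>a\<close> is algebraic over \<open>F\<close>. So \<open>a\<close> has
  a finite orbit. If the orbit is not a point, a power \<open>\<tau>\<close> of \<open>\<sigma>\<close> moves \<open>a\<close> with prime period \<open>r\<close>. The
  case \<open>r = p\<close> contradicts \<open>\<delta>^p = \<tau>^p - 1\<close> and the injectivity just found, now for \<open>\<tau>\<close>; in the case
  \<open>r \<noteq> p\<close> the Lagrange resolvents of \<open>a\<close> are radicals of elements of the fixed field of \<open>\<tau>\<close>, so they
  and \<open>a\<close> lie in that field.

  All this needs \<open>F \<inter> k\<close> to be infinite for some choice of the parameters, which may fail when \<open>F\<close>
  is algebraic over the prime field. Passing to an ultrapower of \<open>K\<close>, which has the same theory and is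
  therefore small, provides a fixed point of infinite multiplicative order.
\<close>

section \<open>Renaming variables and extending types\<close>

lemma finite_vars_trm: "finite (vars_trm t)"
  by (induction t) auto

lemma finite_free_vars: "finite (free_vars \<phi>)"
  by (induction \<phi>) (auto simp: finite_vars_trm)

fun rename_trm :: "(nat \<Rightarrow> nat) \<Rightarrow> 'f trm \<Rightarrow> 'f trm" where
  "rename_trm f (Var i) = Var (f i)"
| "rename_trm f (Fun g ts) = Fun g (map (rename_trm f) ts)"

lemma eval_rename_trm: "eval_trm M e (rename_trm f t) = eval_trm M (\<lambda>i. e (f i)) t"
proof (induction t)
  case (Fun g ts)
  have "map (eval_trm M e) (map (rename_trm f) ts) = map (eval_trm M (\<lambda>i. e (f i))) ts"
    unfolding map_map by (rule map_cong[OF refl]) (simp only: o_apply Fun.IH)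
  then have "fun_interp M g (map (eval_trm M e) (map (rename_trm f) ts)) =
      fun_interp M g (map (eval_trm M (\<lambda>i. e (f i))) ts)" by (rule arg_cong)
  then show ?case by (simp only: eval_trm.simps rename_trm.simps)
next
  case (Var i)
  show ?case by (simp only: eval_trm.simps rename_trm.simps)
qed

lemma wf_rename_trm: "wf_trm L (rename_trm f t) \<longleftrightarrow> wf_trm L t"
  by (induction t) auto

lemma vars_rename_trm: "vars_trm (rename_trm f t) = f ` vars_trm t"
  by (induction t) auto

text \<open>
  The renaming \<open>f\<close> need not be injective and may hit bound variables. The induction replaces each
  bound variable by one outside the image under \<open>f\<close> of the free variables in its scope, which
  avoids capture.
\<close>

lemma rename_fm:
  assumes "wf_fm L \<phi>"
  shows "\<exists>\<psi>. wf_fm L \<psi> \<and> free_vars \<psi> \<subseteq> f ` free_vars \<phi> \<and>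
           (\<forall>e. sat M e \<psi> \<longleftrightarrow> sat M (\<lambda>i. e (f i)) \<phi>)"
  using assms
proof (induction \<phi> arbitrary: f)
  case (Eq s t)
  then show ?case
    by (intro exI[of _ "Eq (rename_trm f s) (rename_trm f t)"])
      (auto simp: wf_rename_trm vars_rename_trm eval_rename_trm image_Un)
next
  case (Rel r ts)
  have "map (eval_trm M e) (map (rename_trm f) ts) = map (eval_trm M (\<lambda>i. e (f i))) ts" for e
    by (simp add: eval_rename_trm)
  then have "sat M e (Rel r (map (rename_trm f) ts)) \<longleftrightarrow> sat M (\<lambda>i. e (f i)) (Rel r ts)" for e
    by (simp only: sat.simps)
  with Rel show ?case
    by (intro exI[of _ "Rel r (map (rename_trm f) ts)"])
      (auto simp: wf_rename_trm vars_rename_trm simp del: sat.simps)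
next
  case (Neg \<phi>)
  from Neg.IH[of f] Neg.prems obtain \<psi> where
    "wf_fm L \<psi>" "free_vars \<psi> \<subseteq> f ` free_vars \<phi>" "\<forall>e. sat M e \<psi> \<longleftrightarrow> sat M (\<lambda>i. e (f i)) \<phi>"
    by auto
  then show ?case by (intro exI[of _ "Neg \<psi>"]) auto
next
  case (And \<phi>1 \<phi>2)
  from And.IH(1)[of f] And.prems obtain \<psi>1 where
    "wf_fm L \<psi>1" "free_vars \<psi>1 \<subseteq> f ` free_vars \<phi>1" "\<forall>e. sat M e \<psi>1 \<longleftrightarrow> sat M (\<lambda>i. e (f i)) \<phi>1"
    by auto
  moreover from And.IH(2)[of f] And.prems obtain \<psi>2 where
    "wf_fm L \<psi>2" "free_vars \<psi>2 \<subseteq> f ` free_vars \<phi>2" "\<forall>e. sat M e \<psi>2 \<longleftrightarrow> sat M (\<lambda>i. e (f i)) \<phi>2"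
    by auto
  ultimately show ?case by (intro exI[of _ "And \<psi>1 \<psi>2"]) auto
next
  case (Ex i \<phi>)
  obtain j where j: "j \<notin> f ` free_vars \<phi>"
    using ex_new_if_finite[OF infinite_UNIV_nat finite_imageI[OF finite_free_vars]] by blast
  from Ex.IH[of "f(i := j)"] Ex.prems obtain \<psi> where \<psi>:
    "wf_fm L \<psi>" "free_vars \<psi> \<subseteq> f(i := j) ` free_vars \<phi>"
    "\<forall>e. sat M e \<psi> \<longleftrightarrow> sat M (\<lambda>k. e ((f(i := j)) k)) \<phi>"
    by auto
  have "sat M (\<lambda>k. (e(j := a)) ((f(i := j)) k)) \<phi> \<longleftrightarrow> sat M ((\<lambda>i. e (f i))(i := a)) \<phi>" for e a
    using j by (intro sat_cong) auto
  then have "sat M e (Ex j \<psi>) \<longleftrightarrow> sat M (\<lambda>i. e (f i)) (Ex i \<phi>)" for e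
    using \<psi>(3) by (simp del: fun_upd_apply)
  with \<psi>(1,2) show ?case by (intro exI[of _ "Ex j \<psi>"]) (auto simp del: sat.simps)
qed

text \<open>
  Tukey's lemma for the property that all finite subsets satisfy \<open>Q\<close>. It yields both complete types
  and ultrafilters.
\<close>

lemma finite_character_maximal:
  assumes "X \<subseteq> A" and "\<forall>\<Delta>. \<Delta> \<subseteq> X \<and> finite \<Delta> \<longrightarrow> Q \<Delta>"
  shows "\<exists>p. X \<subseteq> p \<and> p \<subseteq> A \<and> (\<forall>\<Delta>. \<Delta> \<subseteq> p \<and> finite \<Delta> \<longrightarrow> Q \<Delta>) \<and>
    (\<forall>q. p \<subseteq> q \<and> q \<subseteq> A \<and> (\<forall>\<Delta>. \<Delta> \<subseteq> q \<and> finite \<Delta> \<longrightarrow> Q \<Delta>) \<longrightarrow> q = p)"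
proof -
  define good where "good p \<longleftrightarrow> (\<forall>\<Delta>. \<Delta> \<subseteq> p \<and> finite \<Delta> \<longrightarrow> Q \<Delta>)" for p
  let ?P = "{p. X \<subseteq> p \<and> p \<subseteq> A \<and> good p}"
  have "\<exists>M\<in>?P. \<forall>Y\<in>?P. M \<subseteq> Y \<longrightarrow> Y = M"
  proof (rule subset_Zorn)
    fix C assume C: "subset.chain ?P C"
    show "\<exists>U\<in>?P. \<forall>Y\<in>C. Y \<subseteq> U"
    proof (cases "C = {}")
      case True
      then show ?thesis using assms by (intro bexI[of _ X]) (auto simp: good_def)
    next
      case False
      have sub: "C \<subseteq> ?P" and tot: "\<And>Y Z. Y \<in> C \<Longrightarrow> Z \<in> C \<Longrightarrow> Y \<subseteq> Z \<or> Z \<subseteq> Y"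
        using C unfolding subset_chain_def by blast+
      have "Q \<Delta>" if "\<Delta> \<subseteq> \<Union>C" "finite \<Delta>" for \<Delta>
      proof -
        have "\<exists>Y\<in>C. \<Delta> \<subseteq> Y" using that(2,1)
        proof (induction \<Delta>)
          case empty
          then show ?case using False by auto
        next
          case (insert x \<Delta>)
          then obtain Y Z where "Y \<in> C" "\<Delta> \<subseteq> Y" "Z \<in> C" "x \<in> Z" by auto
          then show ?case using tot[of Y Z] by blast
        qed
        then obtain Y where "Y \<in> C" "\<Delta> \<subseteq> Y" by blast
        moreover from this sub have "good Y" by blast
        ultimately show ?thesis using that(2) unfolding good_def by blast
      qed
      then have "good (\<Union>C)" unfolding good_def by blast
      then have "\<Union>C \<in> ?P" using sub False by blast
      then show ?thesis by (rule rev_bexI) blast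
    qed
  qed
  then obtain p where p: "p \<in> ?P" and max: "\<forall>q\<in>?P. p \<subseteq> q \<longrightarrow> q = p"
    by (rule bexE)
  have "q = p" if "p \<subseteq> q" "q \<subseteq> A" "good q" for q
    using p that by (intro max[rule_format]) auto
  with p have "X \<subseteq> p \<and> p \<subseteq> A \<and> good p \<and> (\<forall>q. p \<subseteq> q \<and> q \<subseteq> A \<and> good q \<longrightarrow> q = p)"
    by simp
  then have "\<exists>p. X \<subseteq> p \<and> p \<subseteq> A \<and> good p \<and> (\<forall>q. p \<subseteq> q \<and> q \<subseteq> A \<and> good q \<longrightarrow> q = p)"
    by (rule exI)
  then show ?thesis unfolding good_def .
qed

lemma extend_to_complete_type:
  assumes "finitely_satisfiable L M n X"
  shows "\<exists>p\<in>complete_types L M n. X \<subseteq> p"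
proof -
  have "\<exists>p. X \<subseteq> p \<and> finitely_satisfiable L M n p \<and>
      (\<forall>q. p \<subseteq> q \<and> finitely_satisfiable L M n q \<longrightarrow> q = p)"
    unfolding finitely_satisfiable_def conj_assoc
    by (rule finite_character_maximal)
      (rule assms[unfolded finitely_satisfiable_def, THEN conjunct1],
       rule assms[unfolded finitely_satisfiable_def, THEN conjunct2])
  then show ?thesis unfolding complete_types_def by blast
qed

section \<open>Sets and maps definable over finitely many parameters\<close>

text \<open>
  The parameters occupy the first variables. A formula defining a set of points over \<open>ps\<close> is then,
  after its remaining variables have been identified with the next one, a formula in
  \<open>length ps + 1\<close> variables without parameters, and smallness says that there are only countably
  many complete types in these variables.
\<close>

definition with_params :: "'a list \<Rightarrow> (nat \<Rightarrow> 'a) \<Rightarrow> nat \<Rightarrow> 'a" where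
  "with_params ps e i = (if i < length ps then ps ! i else e (i - length ps))"

locale parametrised_field =
  fixes L :: "('f field_sym, 'r) language"
    and K :: "('a::field, 'f field_sym, 'r) struc"
    and ps :: "'a list"
  assumes expands: "expands_field L K"
begin

text \<open>
  Relations are predicates on assignments, so that definability can be handled through its closure
  under logical operations and renaming; no formula has to be written down except for the field
  operations.
\<close>

definition defin :: "((nat \<Rightarrow> 'a) \<Rightarrow> bool) \<Rightarrow> bool" where
  "defin R \<longleftrightarrow> (\<exists>\<phi>. wf_fm L \<phi> \<and> (\<forall>e. sat K (with_params ps e) \<phi> \<longleftrightarrow> R e))"

definition dset :: "'a set \<Rightarrow> bool" where
  "dset X \<longleftrightarrow> defin (\<lambda>e. e 0 \<in> X)"

definition dmap :: "('a \<Rightarrow> 'a) \<Rightarrow> bool" where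
  "dmap h \<longleftrightarrow> defin (\<lambda>e. e (Suc 0) = h (e 0))"

text \<open>
The definable closure of the parameters.
\<close>

definition dpt :: "'a set" where
  "dpt = {b. dset {b}}"

lemma defin_not: "defin R \<Longrightarrow> defin (\<lambda>e. \<not> R e)"
proof -
  assume "defin R"
  then obtain \<phi> where "wf_fm L \<phi>" "\<forall>e. sat K (with_params ps e) \<phi> \<longleftrightarrow> R e"
    unfolding defin_def by blast
  then show ?thesis unfolding defin_def by (intro exI[of _ "Neg \<phi>"]) simp
qed

lemma defin_conj: "defin R \<Longrightarrow> defin S \<Longrightarrow> defin (\<lambda>e. R e \<and> S e)"
proof -
  assume "defin R" "defin S"
  then obtain \<phi> \<psi> where "wf_fm L \<phi>" "\<forall>e. sat K (with_params ps e) \<phi> \<longleftrightarrow> R e"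
    "wf_fm L \<psi>" "\<forall>e. sat K (with_params ps e) \<psi> \<longleftrightarrow> S e"
    unfolding defin_def by blast
  then show ?thesis unfolding defin_def by (intro exI[of _ "And \<phi> \<psi>"]) simp
qed

lemma defin_disj: "defin R \<Longrightarrow> defin S \<Longrightarrow> defin (\<lambda>e. R e \<or> S e)"
  using defin_not[OF defin_conj[OF defin_not defin_not], of R S] by simp

lemma defin_ex:
  assumes "defin R"
  shows "defin (\<lambda>e. \<exists>a. R (e(j := a)))"
proof -
  from assms obtain \<phi> where \<phi>: "wf_fm L \<phi>" "\<forall>e. sat K (with_params ps e) \<phi> \<longleftrightarrow> R e"
    unfolding defin_def by blast
  have "(with_params ps e)(length ps + j := a) = with_params ps (e(j := a))" for e a
    by (auto simp: with_params_def fun_eq_iff)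
  with \<phi> show ?thesis
    unfolding defin_def by (intro exI[of _ "Ex (length ps + j) \<phi>"]) simp
qed

lemma defin_rename:
  assumes "defin R"
  shows "defin (\<lambda>e. R (\<lambda>i. e (f i)))"
proof -
  let ?g = "\<lambda>i. if i < length ps then i else length ps + f (i - length ps)"
  from assms obtain \<phi> where \<phi>: "wf_fm L \<phi>" "\<forall>e. sat K (with_params ps e) \<phi> \<longleftrightarrow> R e"
    unfolding defin_def by blast
  from rename_fm[OF \<phi>(1), of ?g K] obtain \<psi> where
    \<psi>: "wf_fm L \<psi>" "\<forall>e. sat K e \<psi> \<longleftrightarrow> sat K (\<lambda>i. e (?g i)) \<phi>" by blast
  have "(\<lambda>i. with_params ps e (?g i)) = with_params ps (\<lambda>i. e (f i))" for e
    by (auto simp: with_params_def fun_eq_iff)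
  with \<phi> \<psi> show ?thesis unfolding defin_def by (intro exI[of _ \<psi>]) simp
qed

lemma defin_mem: "dset X \<Longrightarrow> defin (\<lambda>e. e i \<in> X)"
  using defin_rename[of "\<lambda>e. e 0 \<in> X" "\<lambda>_. i"] by (simp add: dset_def)

lemma defin_app: "dmap h \<Longrightarrow> defin (\<lambda>e. e j = h (e i))"
  using defin_rename[of "\<lambda>e. e (Suc 0) = h (e 0)" "\<lambda>n. if n = 0 then i else j"]
  by (simp add: dmap_def)

lemma defin_eq: "defin (\<lambda>e. e i = e j)"
  unfolding defin_def
  by (intro exI[of _ "Eq (Var (length ps + i)) (Var (length ps + j))"])
    (auto simp: with_params_def)

lemma defin_zero: "defin (\<lambda>e. e i = 0)"
  unfolding defin_def
  by (intro exI[of _ "Eq (Var (length ps + i)) (Fun Zero [])"])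
    (use expands in \<open>auto simp: with_params_def expands_field_def numeral_2_eq_2\<close>)

lemma defin_one: "defin (\<lambda>e. e i = 1)"
  unfolding defin_def
  by (intro exI[of _ "Eq (Var (length ps + i)) (Fun One [])"])
    (use expands in \<open>auto simp: with_params_def expands_field_def numeral_2_eq_2\<close>)

lemma defin_add: "defin (\<lambda>e. e i = e j + e k)"
  unfolding defin_def
  by (intro exI[of _ "Eq (Var (length ps + i))
        (Fun Plus [Var (length ps + j), Var (length ps + k)])"])
    (use expands in \<open>auto simp: with_params_def expands_field_def numeral_2_eq_2\<close>)

lemma defin_mult: "defin (\<lambda>e. e i = e j * e k)"
  unfolding defin_def
  by (intro exI[of _ "Eq (Var (length ps + i))
        (Fun Times [Var (length ps + j), Var (length ps + k)])"])
    (use expands in \<open>auto simp: with_params_def expands_field_def numeral_2_eq_2\<close>)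

lemma dset_UNIV: "dset UNIV"
  using defin_eq[of 0 0] by (simp add: dset_def)

lemma dset_Compl: "dset X \<Longrightarrow> dset (- X)"
  using defin_not[of "\<lambda>e. e 0 \<in> X"] by (simp add: dset_def)

lemma dset_Int: "dset X \<Longrightarrow> dset Y \<Longrightarrow> dset (X \<inter> Y)"
  using defin_conj[of "\<lambda>e. e 0 \<in> X" "\<lambda>e. e 0 \<in> Y"] by (simp add: dset_def)

lemma dset_Un: "dset X \<Longrightarrow> dset Y \<Longrightarrow> dset (X \<union> Y)"
  using defin_disj[of "\<lambda>e. e 0 \<in> X" "\<lambda>e. e 0 \<in> Y"] by (simp add: dset_def)

lemma dset_Diff: "dset X \<Longrightarrow> dset Y \<Longrightarrow> dset (X - Y)"
  using dset_Int[OF _ dset_Compl, of X Y] by (simp add: Diff_eq)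

lemma dset_empty: "dset {}"
  using dset_Compl[OF dset_UNIV] by simp

lemma dmap_id: "dmap (\<lambda>x. x)"
  unfolding dmap_def by (rule defin_eq)

lemma dmap_const: "b \<in> dpt \<Longrightarrow> dmap (\<lambda>_. b)"
  using defin_mem[of "{b}" 1] by (simp add: dpt_def dmap_def)

lemma dmap_comp:
  assumes "dmap g" "dmap h"
  shows "dmap (\<lambda>x. g (h x))"
  using defin_ex[OF defin_conj[OF defin_app[OF assms(2), of 2 0] defin_app[OF assms(1), of 1 2]], of 2]
  by (simp add: dmap_def)

lemma dmap_add:
  assumes "dmap g" "dmap h"
  shows "dmap (\<lambda>x. g x + h x)"
  using defin_ex[OF defin_ex[OF defin_conj[OF defin_conj[OF
     defin_app[OF assms(1), of 2 0] defin_app[OF assms(2), of 3 0]] defin_add[of 1 2 3]], of 3], of 2]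
  by (simp add: dmap_def)

lemma dmap_mult:
  assumes "dmap g" "dmap h"
  shows "dmap (\<lambda>x. g x * h x)"
  using defin_ex[OF defin_ex[OF defin_conj[OF defin_conj[OF
     defin_app[OF assms(1), of 2 0] defin_app[OF assms(2), of 3 0]] defin_mult[of 1 2 3]], of 3], of 2]
  by (simp add: dmap_def)

lemma dpt_image:
  assumes "dmap h" "b \<in> dpt"
  shows "h b \<in> dpt"
proof -
  have "defin (\<lambda>e. \<exists>a. a \<in> {b} \<and> e 0 = h a)"
    using defin_ex[OF defin_conj[OF defin_mem[of "{b}" 1] defin_app[OF assms(1), of 0 1]], of 1]
      assms(2) by (simp add: dpt_def)
  then show ?thesis by (simp add: dpt_def dset_def)
qed

lemma dpt_0: "0 \<in> dpt"
  using defin_zero[of 0] by (simp add: dpt_def dset_def)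

lemma dpt_1: "1 \<in> dpt"
  using defin_one[of 0] by (simp add: dpt_def dset_def)

lemma dpt_param: "b \<in> set ps \<Longrightarrow> b \<in> dpt"
proof -
  assume "b \<in> set ps"
  then obtain i where "i < length ps" "ps ! i = b" by (auto simp: in_set_conv_nth)
  then show ?thesis unfolding dpt_def mem_Collect_eq dset_def defin_def
    by (intro exI[of _ "Eq (Var (length ps)) (Var i)"]) (auto simp: with_params_def)
qed

lemma dpt_add: "a \<in> dpt \<Longrightarrow> b \<in> dpt \<Longrightarrow> a + b \<in> dpt"
  using dpt_image[OF dmap_add[OF dmap_id dmap_const[of b]], of a] by simp

lemma dpt_mult: "a \<in> dpt \<Longrightarrow> b \<in> dpt \<Longrightarrow> a * b \<in> dpt"
  using dpt_image[OF dmap_mult[OF dmap_id dmap_const[of b]], of a] by simp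

lemma dmap_uminus: "dmap (\<lambda>x. - x)"
proof -
  have "defin (\<lambda>e. \<exists>a. a = 0 \<and> a = e 0 + e 1)"
    using defin_ex[OF defin_conj[OF defin_zero[of 2] defin_add[of 2 0 1]], of 2] by simp
  moreover have "(\<exists>a. a = 0 \<and> a = x + y) \<longleftrightarrow> y = - x" for x y :: 'a
    by (auto simp: eq_neg_iff_add_eq_0 add.commute)
  ultimately show ?thesis by (simp add: dmap_def)
qed

lemma dmap_inverse: "dmap inverse"
proof -
  have "defin (\<lambda>e. (e 0 = 0 \<and> e 1 = 0) \<or> (\<exists>a. a = 1 \<and> a = e 0 * e 1))"
    using defin_disj[OF defin_conj[OF defin_zero[of 0] defin_zero[of 1]]
       defin_ex[OF defin_conj[OF defin_one[of 2] defin_mult[of 2 0 1]], of 2]] by simp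
  moreover have "(x = 0 \<and> y = 0) \<or> (\<exists>a. a = 1 \<and> a = x * y) \<longleftrightarrow> y = inverse x" for x y :: 'a
    by (cases "x = 0") (auto simp: inverse_unique)
  ultimately show ?thesis by (simp add: dmap_def)
qed

lemma dmap_diff: "dmap g \<Longrightarrow> dmap h \<Longrightarrow> dmap (\<lambda>x. g x - h x)"
  by (simp only: diff_conv_add_uminus) (intro dmap_add[of g "\<lambda>x. - h x"] dmap_comp[of uminus h] dmap_uminus)

lemma dmap_power: "dmap (\<lambda>x. x ^ n)"
proof (induction n)
  case 0
  then show ?case using dmap_const[OF dpt_1] by simp
next
  case (Suc n)
  then show ?case using dmap_mult[OF dmap_id Suc] by simp
qed

lemma dmap_funpow: "dmap h \<Longrightarrow> dmap (h ^^ n)"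
proof (induction n)
  case 0
  then show ?case using dmap_id by simp
next
  case (Suc n)
  then show ?case using dmap_comp[of h "h ^^ n"] by simp
qed

lemma dpt_uminus: "a \<in> dpt \<Longrightarrow> - a \<in> dpt"
  by (rule dpt_image[OF dmap_uminus])

lemma dpt_inverse: "a \<in> dpt \<Longrightarrow> inverse a \<in> dpt"
  by (rule dpt_image[OF dmap_inverse])

lemma dpt_diff: "a \<in> dpt \<Longrightarrow> b \<in> dpt \<Longrightarrow> a - b \<in> dpt"
  using dpt_add[OF _ dpt_uminus, of a b] by simp

lemma dpt_power: "a \<in> dpt \<Longrightarrow> a ^ n \<in> dpt"
  by (rule dpt_image[OF dmap_power])

lemma dset_image: "dmap h \<Longrightarrow> dset X \<Longrightarrow> dset (h ` X)"
  using defin_ex[OF defin_conj[OF defin_mem[of X 1] defin_app[of h 0 1]], of 1]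
  by (simp add: dset_def image_iff Bex_def)

lemma dset_vimage: "dmap h \<Longrightarrow> dset X \<Longrightarrow> dset (h -` X)"
  using defin_ex[OF defin_conj[OF defin_mem[of X 1] defin_app[of h 1 0]], of 1]
  by (simp add: dset_def)

lemma dset_fixed_points: "dmap h \<Longrightarrow> dset {x. h x = x}"
  using dset_vimage[OF dmap_diff[of h "\<lambda>x. x", OF _ dmap_id], of "{0}"] dpt_0
  by (simp add: dpt_def vimage_def)

text \<open>
  Membership in \<open>X\<close> is evaluated at constant assignments, so all variables that do not stand for
  parameters can be merged into a single one.
\<close>

lemma dset_formula:
  assumes "dset X"
  obtains \<phi> where "\<phi> \<in> formulas L (Suc (length ps))"
    "\<And>x. sat K (with_params ps (\<lambda>_. x)) \<phi> \<longleftrightarrow> x \<in> X"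
proof -
  from assms obtain \<phi> where \<phi>: "wf_fm L \<phi>" "\<forall>e. sat K (with_params ps e) \<phi> \<longleftrightarrow> e 0 \<in> X"
    unfolding dset_def defin_def by blast
  let ?f = "\<lambda>i. min i (length ps)"
  from rename_fm[OF \<phi>(1), of ?f K] obtain \<psi> where \<psi>: "wf_fm L \<psi>"
    "free_vars \<psi> \<subseteq> ?f ` free_vars \<phi>" "\<forall>e. sat K e \<psi> \<longleftrightarrow> sat K (\<lambda>i. e (?f i)) \<phi>" by blast
  have "(\<lambda>i. with_params ps (\<lambda>_. x) (?f i)) = with_params ps (\<lambda>_. x)" for x
    by (auto simp: with_params_def fun_eq_iff)
  with \<phi> \<psi> have "sat K (with_params ps (\<lambda>_. x)) \<psi> \<longleftrightarrow> x \<in> X" for x by simp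
  moreover have "\<psi> \<in> formulas L (Suc (length ps))"
    using \<psi>(1,2) by (force simp: formulas_def)
  ultimately show ?thesis by (rule that[rotated])
qed

end

text \<open>
  The list \<open>qs\<close> leaves room for adding further parameters later, which is how arbitrary points are
  made definable.
\<close>

lemma definable_over_params:
  assumes "expands_field L K" "definable_fun L K \<sigma>"
  shows "\<exists>ps. \<forall>qs. parametrised_field.dmap L K (ps @ qs) \<sigma>"
proof -
  from assms(2) obtain \<phi> c where \<phi>: "wf_fm L \<phi>"
    "{[x, \<sigma> x] | x. True} =
      {xs. length xs = 2 \<and> sat K (\<lambda>i. if i < 2 then xs ! i else c (i - 2)) \<phi>}"
    unfolding definable_fun_def definable_set_def by blast
  have graph: "sat K (\<lambda>i. if i < 2 then [x, y] ! i else c (i - 2)) \<phi> \<longleftrightarrow> y = \<sigma> x" for x y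
  proof -
    have "[x, y] \<in> {[x, \<sigma> x] | x. True} \<longleftrightarrow> y = \<sigma> x" by auto
    then show ?thesis unfolding \<phi>(2) by simp
  qed
  obtain N where N: "free_vars \<phi> \<subseteq> {..<N}"
    using finite_free_vars[of \<phi>] finite_nat_bounded by blast
  define ps where "ps = map c [0..<N]"
  have "parametrised_field.dmap L K (ps @ qs) \<sigma>" for qs
  proof -
    interpret parametrised_field L K "ps @ qs" by unfold_locales fact
    let ?m = "length (ps @ qs)"
    let ?f = "\<lambda>i. if i < 2 then ?m + i else i - 2"
    from rename_fm[OF \<phi>(1), of ?f K] obtain \<psi> where
      \<psi>: "wf_fm L \<psi>" "\<forall>e. sat K e \<psi> \<longleftrightarrow> sat K (\<lambda>i. e (?f i)) \<phi>" by blast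
    have "sat K (with_params (ps @ qs) e) \<psi> \<longleftrightarrow> e (Suc 0) = \<sigma> (e 0)" for e
    proof -
      have "sat K (\<lambda>i. with_params (ps @ qs) e (?f i)) \<phi> \<longleftrightarrow>
          sat K (\<lambda>i. if i < 2 then [e 0, e 1] ! i else c (i - 2)) \<phi>"
        using N by (intro sat_cong)
          (auto simp: with_params_def ps_def nth_append less_2_cases_iff)
      then show ?thesis using graph \<psi>(2) by simp
    qed
    with \<psi>(1) show ?thesis unfolding dmap_def defin_def by blast
  qed
  then show ?thesis by blast
qed

section \<open>Consequences of smallness\<close>

context parametrised_field
begin

text \<open>
  Enumerate the complete types \<open>p\<^sub>0, p\<^sub>1, \<dots>\<close> and descend in \<open>Q\<close>: of two disjoint members below the
  current one, at most one belongs to \<open>p\<^sub>k\<close>, so the next member can be chosen outside \<open>p\<^sub>k\<close>. The formulas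
  of the resulting chain are finitely satisfiable, and a complete type containing them is none of
  the \<open>p\<^sub>k\<close>.
\<close>

theorem small_no_perfect_tree:
  assumes small: "small L K"
    and X0: "X0 \<in> Q"
    and Q: "\<And>X. X \<in> Q \<Longrightarrow> dset X \<and> X \<noteq> {}"
    and split: "\<And>X. X \<in> Q \<Longrightarrow> \<exists>Y\<in>Q. \<exists>Z\<in>Q. Y \<subseteq> X \<and> Z \<subseteq> X \<and> Y \<inter> Z = {}"
  shows False
proof -
  define n where "n = Suc (length ps)"
  define ev where "ev x = with_params ps (\<lambda>_. x)" for x
  \<comment> \<open>The complete types containing this set are the types over the parameters \<open>ps\<close>.\<close>
  define always where "always = {\<phi> \<in> formulas L n. \<forall>x. sat K (ev x) \<phi>}"
  have "\<exists>\<phi>\<in>formulas L n. \<forall>x. sat K (ev x) \<phi> \<longleftrightarrow> x \<in> X" if "X \<in> Q" for X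
    using dset_formula[of X] Q[OF that] unfolding n_def ev_def by metis
  then obtain fm where fm: "\<And>X. X \<in> Q \<Longrightarrow> fm X \<in> formulas L n"
    "\<And>X x. X \<in> Q \<Longrightarrow> sat K (ev x) (fm X) \<longleftrightarrow> x \<in> X" by metis
  let ?T = "complete_types L K n"
  have countable: "countable ?T" using small by (simp add: small_def)
  have avoid: "\<exists>Y\<in>Q. Y \<subseteq> X \<and> (always \<subseteq> p \<longrightarrow> fm Y \<notin> p)"
    if X: "X \<in> Q" and p: "p \<in> ?T" for X p
  proof (rule ccontr)
    assume neg: "\<not> ?thesis"
    from split[OF X] obtain Y Z where YZ: "Y \<in> Q" "Z \<in> Q" "Y \<subseteq> X" "Z \<subseteq> X" "Y \<inter> Z = {}"
      by blast
    have "Neg (And (fm Y) (fm Z)) \<in> always"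
      using YZ fm by (auto simp: always_def formulas_def)
    with neg YZ have "{Neg (And (fm Y) (fm Z)), fm Y, fm Z} \<subseteq> p" by auto
    moreover have "finitely_satisfiable L K n p" using p by (simp add: complete_types_def)
    ultimately have "\<exists>e. \<forall>\<phi>\<in>{Neg (And (fm Y) (fm Z)), fm Y, fm Z}. sat K e \<phi>"
      unfolding finitely_satisfiable_def by blast
    then show False by auto
  qed
  define nxt where "nxt k X = (if ?T = {} then X else
     (SOME Y. Y \<in> Q \<and> Y \<subseteq> X \<and> (always \<subseteq> from_nat_into ?T k \<longrightarrow> fm Y \<notin> from_nat_into ?T k)))" for k X
  have nxt: "nxt k X \<in> Q \<and> nxt k X \<subseteq> X \<and>
      (?T \<noteq> {} \<longrightarrow> always \<subseteq> from_nat_into ?T k \<longrightarrow> fm (nxt k X) \<notin> from_nat_into ?T k)"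
    if "X \<in> Q" for k X
  proof (cases "?T = {}")
    case False
    then have "\<exists>Y. Y \<in> Q \<and> Y \<subseteq> X \<and>
       (always \<subseteq> from_nat_into ?T k \<longrightarrow> fm Y \<notin> from_nat_into ?T k)"
      using avoid[OF that from_nat_into[OF False]] by blast
    from someI_ex[OF this] show ?thesis by (simp add: nxt_def False)
  qed (simp add: nxt_def that)
  define C where "C = rec_nat X0 nxt"
  have C0: "C 0 = X0" and CS: "C (Suc k) = nxt k (C k)" for k by (simp_all add: C_def)
  have CQ: "C k \<in> Q" for k
    by (induction k) (auto simp: C0 CS X0 nxt)
  have step: "C (Suc k) \<subseteq> C k" for k
    unfolding CS by (rule nxt[OF CQ, THEN conjunct2, THEN conjunct1])
  have anti: "C l \<subseteq> C k" if "k \<le> l" for k l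
    using step that by (rule lift_Suc_antimono_le)
  have "\<exists>e. \<forall>\<phi>\<in>\<Delta>. sat K e \<phi>"
    if D: "\<Delta> \<subseteq> always \<union> range (\<lambda>k. fm (C k))" "finite \<Delta>" for \<Delta>
  proof -
    from D have "\<exists>N. \<Delta> \<subseteq> always \<union> (\<lambda>k. fm (C k)) ` {..N}"
    proof -
      have "\<Delta> - always \<subseteq> (\<lambda>k. fm (C k)) ` UNIV" "finite (\<Delta> - always)" using D by auto
      then obtain S where S: "finite S" "\<Delta> - always = (\<lambda>k. fm (C k)) ` S"
        by (meson finite_subset_image)
      then have "S \<subseteq> {..Max S}" by auto
      with S show ?thesis by (intro exI[of _ "Max S"]) auto
    qed
    then obtain N where N: "\<Delta> \<subseteq> always \<union> (\<lambda>k. fm (C k)) ` {..N}" by blast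
    from Q[OF CQ[of N]] obtain x where "x \<in> C N" by auto
    then have "sat K (ev x) (fm (C k))" if "k \<le> N" for k
      using anti[OF that] fm(2)[OF CQ] by blast
    then have "\<forall>\<phi>\<in>\<Delta>. sat K (ev x) \<phi>" using N by (auto simp: always_def)
    then show ?thesis by blast
  qed
  moreover have "always \<union> range (\<lambda>k. fm (C k)) \<subseteq> formulas L n"
    using fm(1)[OF CQ] by (auto simp: always_def)
  ultimately have "finitely_satisfiable L K n (always \<union> range (\<lambda>k. fm (C k)))"
    unfolding finitely_satisfiable_def by blast
  then obtain p where pT: "p \<in> ?T" and p: "always \<union> range (\<lambda>k. fm (C k)) \<subseteq> p"
    using extend_to_complete_type by blast
  then obtain k where k: "from_nat_into ?T k = p"
    using from_nat_into_surj[OF countable pT] by blast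
  have "fm (C (Suc k)) \<notin> p"
    using nxt[OF CQ[of k], of k] pT p k unfolding CS by blast
  then show False using p by blast
qed

text \<open>
  Otherwise choose a definable point \<open>b\<^sub>n\<close> in \<open>H\<^sub>n\<close> outside \<open>H\<^sub>n\<^sub>+\<^sub>1\<close> for each \<open>n\<close>. Each coset \<open>d + H\<^sub>n\<close> with
  \<open>d\<close> definable contains the disjoint cosets \<open>d + H\<^sub>n\<^sub>+\<^sub>1\<close> and \<open>d + b\<^sub>n + H\<^sub>n\<^sub>+\<^sub>1\<close>, so these cosets form a
  perfect tree.
\<close>

theorem trace_descending_chain:
  assumes small: "small L K"
    and H: "\<And>n. dset (H n)" "\<And>n. 0 \<in> H n"
      "\<And>n x y. x \<in> H n \<Longrightarrow> y \<in> H n \<Longrightarrow> x - y \<in> H n"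
    and chain: "\<And>n. H (Suc n) \<subseteq> H n"
  shows "\<exists>n. H n \<inter> dpt \<subseteq> H (Suc n)"
proof (rule ccontr)
  assume "\<not> ?thesis"
  then have "\<forall>n. \<exists>b. b \<in> H n \<and> b \<in> dpt \<and> b \<notin> H (Suc n)" by blast
  then obtain b where b: "\<And>n. b n \<in> H n" "\<And>n. b n \<in> dpt" "\<And>n. b n \<notin> H (Suc n)" by metis
  define Q where "Q = {(\<lambda>x. x + d) ` H n | d n. d \<in> dpt}"
  have neg: "- x \<in> H n" if "x \<in> H n" for x n using H(3)[OF H(2) that] by simp
  have add: "x + y \<in> H n" if "x \<in> H n" "y \<in> H n" for x y n
    using H(3)[OF that(1) neg[OF that(2)]] by simp
  show False
  proof (rule small_no_perfect_tree[OF small, of "H 0" Q])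
    show "H 0 \<in> Q" unfolding Q_def using dpt_0 by (auto intro!: exI[of _ 0])
  next
    fix X assume "X \<in> Q"
    then obtain d n where X: "X = (\<lambda>x. x + d) ` H n" "d \<in> dpt" by (auto simp: Q_def)
    then show "dset X \<and> X \<noteq> {}"
      using dset_image[OF dmap_add[OF dmap_id dmap_const] H(1)] H(2) by auto
    let ?Y = "(\<lambda>x. x + d) ` H (Suc n)" and ?Z = "(\<lambda>x. x + (b n + d)) ` H (Suc n)"
    have "?Y \<in> Q" "?Z \<in> Q" using X(2) b(2) dpt_add by (auto simp: Q_def)
    moreover have "?Y \<subseteq> X" using chain X by auto
    moreover have "?Z \<subseteq> X"
    proof
      fix y assume "y \<in> ?Z"
      then obtain x where "x \<in> H (Suc n)" "y = (x + b n) + d" by (auto simp: algebra_simps)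
      then show "y \<in> X" unfolding X(1) using add[OF _ b(1)[of n], of x] chain by blast
    qed
    moreover have "?Y \<inter> ?Z = {}"
    proof (rule ccontr)
      assume "?Y \<inter> ?Z \<noteq> {}"
      then obtain x y where xy: "x \<in> H (Suc n)" "y \<in> H (Suc n)" "x + d = y + (b n + d)" by blast
      then have "x - y = b n" by (simp add: algebra_simps)
      then show False using H(3)[OF xy(1,2)] b(3)[of n] by simp
    qed
    ultimately show "\<exists>Y\<in>Q. \<exists>Z\<in>Q. Y \<subseteq> X \<and> Z \<subseteq> X \<and> Y \<inter> Z = {}" by blast
  qed
qed

end

section \<open>Generic types of a definable field\<close>

locale definable_subfield = parametrised_field L K ps
  for L :: "('f field_sym, 'r) language"
    and K :: "('a::field, 'f field_sym, 'r) struc"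
    and ps :: "'a list" +
  fixes E :: "'a set"
  assumes small: "small L K"
    and dset_E: "dset E"
    and one_E: "1 \<in> E"
    and diff_E: "x \<in> E \<Longrightarrow> y \<in> E \<Longrightarrow> x - y \<in> E"
    and mult_E: "x \<in> E \<Longrightarrow> y \<in> E \<Longrightarrow> x * y \<in> E"
    and inverse_E: "x \<in> E \<Longrightarrow> inverse x \<in> E"
    and infinite_points: "infinite (E \<inter> dpt)"
begin

lemma zero_E: "0 \<in> E"
  using diff_E[OF one_E one_E] by simp

lemma uminus_E: "x \<in> E \<Longrightarrow> - x \<in> E"
  using diff_E[OF zero_E] by simp

lemma add_E: "x \<in> E \<Longrightarrow> y \<in> E \<Longrightarrow> x + y \<in> E"
  using diff_E[OF _ uminus_E] by simp

lemma power_E: "x \<in> E \<Longrightarrow> x ^ n \<in> E"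
  by (induction n) (auto intro: one_E mult_E)

definition dsub :: "'a set set" where
  "dsub = {Y. dset Y \<and> Y \<subseteq> E}"

text \<open>
  The bound on the fibres is uniform; this is what makes preimages of finite unions of atoms finite
  unions of atoms in \<open>atomic_part_vimage\<close>.
\<close>

definition finite_to_one :: "('a \<Rightarrow> 'a) \<Rightarrow> bool" where
  "finite_to_one h \<longleftrightarrow> dmap h \<and> h ` E \<subseteq> E \<and>
     (\<exists>N. \<forall>y. finite {x \<in> E. h x = y} \<and> card {x \<in> E. h x = y} \<le> N)"

text \<open>
  Closure under preimages makes finite-to-one images of large sets large. It replaces the
  invariance of Cantor-Bendixson rank under finite-to-one maps.
\<close>

definition invariant_ideal :: "'a set set \<Rightarrow> bool" where
  "invariant_ideal I \<longleftrightarrow> I \<subseteq> dsub \<and> {} \<in> I \<and> E \<notin> I \<and>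
     (\<forall>Y\<in>I. \<forall>Z\<in>dsub. Z \<subseteq> Y \<longrightarrow> Z \<in> I) \<and> (\<forall>Y\<in>I. \<forall>Z\<in>I. Y \<union> Z \<in> I) \<and>
     (\<forall>h. finite_to_one h \<longrightarrow> (\<forall>Y\<in>I. {x \<in> E. h x \<in> Y} \<in> I))"

definition atom :: "'a set set \<Rightarrow> 'a set \<Rightarrow> bool" where
  "atom I \<alpha> \<longleftrightarrow> \<alpha> \<in> dsub \<and> \<alpha> \<notin> I \<and> (\<forall>\<beta>\<in>dsub. \<beta> \<subseteq> \<alpha> \<longrightarrow> \<beta> \<in> I \<or> \<alpha> - \<beta> \<in> I)"

lemma dsub_Int: "Y \<in> dsub \<Longrightarrow> Z \<in> dsub \<Longrightarrow> Y \<inter> Z \<in> dsub"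
  and dsub_Un: "Y \<in> dsub \<Longrightarrow> Z \<in> dsub \<Longrightarrow> Y \<union> Z \<in> dsub"
  and dsub_Diff: "Y \<in> dsub \<Longrightarrow> Z \<in> dsub \<Longrightarrow> Y - Z \<in> dsub"
  and dsub_empty: "{} \<in> dsub"
  and dsub_E: "E \<in> dsub"
  and dsub_subset: "Y \<in> dsub \<Longrightarrow> Y \<subseteq> E"
  by (auto simp: dsub_def intro: dset_Int dset_Un dset_Diff dset_empty dset_E)

lemma dsub_image: "dmap h \<Longrightarrow> h ` E \<subseteq> E \<Longrightarrow> Y \<in> dsub \<Longrightarrow> h ` Y \<in> dsub"
  by (auto simp: dsub_def intro: dset_image)

lemma dsub_vimage:
  assumes "dmap h" "Y \<in> dsub"
  shows "{x \<in> E. h x \<in> Y} \<in> dsub"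
proof -
  have "{x \<in> E. h x \<in> Y} = E \<inter> h -` Y" by auto
  then show ?thesis using assms dset_Int[OF dset_E dset_vimage] unfolding dsub_def by auto
qed

lemma dsub_Union: "finite A \<Longrightarrow> A \<subseteq> dsub \<Longrightarrow> \<Union>A \<in> dsub"
  by (induction A rule: finite_induct) (auto intro: dsub_empty dsub_Un)

context
  fixes I assumes I: "invariant_ideal I"
begin

lemma ideal_dsub: "Y \<in> I \<Longrightarrow> Y \<in> dsub"
  by (rule subsetD[OF I[unfolded invariant_ideal_def, THEN conjunct1]])

lemma ideal_empty: "{} \<in> I"
  using I unfolding invariant_ideal_def by blast

lemma ideal_proper: "E \<notin> I"
  using I unfolding invariant_ideal_def by blast

lemma ideal_mono: "Y \<in> I \<Longrightarrow> Z \<in> dsub \<Longrightarrow> Z \<subseteq> Y \<Longrightarrow> Z \<in> I"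
  using I unfolding invariant_ideal_def by blast

lemma ideal_Un: "Y \<in> I \<Longrightarrow> Z \<in> I \<Longrightarrow> Y \<union> Z \<in> I"
  using I unfolding invariant_ideal_def by blast

lemma ideal_vimage: "finite_to_one h \<Longrightarrow> Y \<in> I \<Longrightarrow> {x \<in> E. h x \<in> Y} \<in> I"
  using I unfolding invariant_ideal_def by blast

lemma ideal_Union: "finite A \<Longrightarrow> A \<subseteq> I \<Longrightarrow> \<Union>A \<in> I"
  by (induction A rule: finite_induct) (auto intro: ideal_empty ideal_Un)

lemma atom_dsub: "atom I \<alpha> \<Longrightarrow> \<alpha> \<in> dsub"
  by (simp add: atom_def)

lemma atom_Int:
  assumes "atom I \<alpha>" "\<beta> \<in> dsub" "\<alpha> \<inter> \<beta> \<notin> I"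
  shows "\<alpha> - \<beta> \<in> I" "atom I (\<alpha> \<inter> \<beta>)"
proof -
  have \<alpha>: "\<alpha> \<in> dsub" "\<alpha> \<notin> I" and split: "\<And>\<gamma>. \<gamma> \<in> dsub \<Longrightarrow> \<gamma> \<subseteq> \<alpha> \<Longrightarrow> \<gamma> \<in> I \<or> \<alpha> - \<gamma> \<in> I"
    using assms(1) unfolding atom_def by blast+
  have "\<alpha> - \<alpha> \<inter> \<beta> \<in> I"
    using split[OF dsub_Int[OF \<alpha>(1) assms(2)]] assms(3) by blast
  then show "\<alpha> - \<beta> \<in> I" by (simp add: Diff_Int)
  show "atom I (\<alpha> \<inter> \<beta>)"
    unfolding atom_def
  proof (intro conjI ballI impI)
    fix \<gamma> assume \<gamma>: "\<gamma> \<in> dsub" "\<gamma> \<subseteq> \<alpha> \<inter> \<beta>"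
    then have "\<gamma> \<in> I \<or> \<alpha> - \<gamma> \<in> I" using split by blast
    moreover have "\<alpha> \<inter> \<beta> - \<gamma> \<in> dsub" by (intro dsub_Diff dsub_Int \<alpha> assms \<gamma>)
    ultimately show "\<gamma> \<in> I \<or> \<alpha> \<inter> \<beta> - \<gamma> \<in> I"
      using ideal_mono[of "\<alpha> - \<gamma>" "\<alpha> \<inter> \<beta> - \<gamma>"] by blast
  qed (use assms \<alpha> dsub_Int in auto)
qed

lemma atom_meet:
  assumes "atom I \<alpha>" "\<beta> \<in> dsub" "\<gamma> \<in> dsub" "\<alpha> \<inter> \<beta> \<notin> I" "\<alpha> \<inter> \<gamma> \<notin> I"
  shows "\<alpha> \<inter> \<beta> \<inter> \<gamma> \<notin> I"
proof
  assume "\<alpha> \<inter> \<beta> \<inter> \<gamma> \<in> I"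
  then have "\<alpha> \<inter> \<beta> \<inter> \<gamma> \<union> (\<alpha> - \<beta>) \<in> I"
    using atom_Int(1)[OF assms(1,2,4)] by (rule ideal_Un)
  moreover have "\<alpha> \<inter> \<gamma> \<subseteq> \<alpha> \<inter> \<beta> \<inter> \<gamma> \<union> (\<alpha> - \<beta>)" by blast
  ultimately have "\<alpha> \<inter> \<gamma> \<in> I"
    using ideal_mono dsub_Int[OF atom_dsub[OF assms(1)] assms(3)] by blast
  then show False using assms(5) by contradiction
qed

lemma atom_finite_meet:
  assumes "atom I \<alpha>" "finite T" "\<And>\<beta>. \<beta> \<in> T \<Longrightarrow> \<beta> \<in> dsub \<and> \<alpha> \<inter> \<beta> \<notin> I"
  shows "\<exists>y\<in>\<alpha>. \<forall>\<beta>\<in>T. y \<in> \<beta>"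
proof (rule ccontr)
  assume "\<not> ?thesis"
  then have sub: "\<alpha> \<subseteq> \<Union>((\<lambda>\<beta>. \<alpha> - \<beta>) ` T)" by blast
  have "\<Union>((\<lambda>\<beta>. \<alpha> - \<beta>) ` T) \<in> I"
    using assms atom_Int(1) by (intro ideal_Union) auto
  then have "\<alpha> \<in> I" using ideal_mono[OF _ atom_dsub[OF assms(1)] sub] by blast
  then show False using assms(1) by (simp add: atom_def)
qed

text \<open>
  Up to \<open>I\<close>, these are the finite unions of atoms. They form an invariant ideal containing \<open>I\<close> and,
  since atoms exist, strictly containing \<open>I\<close>, unless \<open>E\<close> is among them. So \<open>E\<close> is among them if \<open>I\<close> is
  maximal.
\<close>

definition atomic_part :: "'a set set" where
  "atomic_part = {Y \<in> dsub. \<exists>A. finite A \<and> (\<forall>\<alpha>\<in>A. atom I \<alpha>) \<and> Y - \<Union>A \<in> I}"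

text \<open>
  In a disjoint family of large subsets of maximal size no member can be split further and nothing
  large remains outside the family.
\<close>

lemma atomic_part_if_bounded:
  assumes "P \<in> dsub"
    and "\<And>S. finite S \<Longrightarrow> S \<subseteq> dsub - I \<Longrightarrow> \<Union>S \<subseteq> P \<Longrightarrow> pairwise disjnt S \<Longrightarrow> card S \<le> M"
  shows "P \<in> atomic_part"
proof -
  define family where "family S \<longleftrightarrow>
    finite S \<and> S \<subseteq> dsub - I \<and> \<Union>S \<subseteq> P \<and> pairwise disjnt S" for S
  have "family {}" by (simp add: family_def)
  moreover have "\<forall>S. family S \<longrightarrow> card S < Suc M"
    using assms(2) by (simp add: less_Suc_eq_le family_def)
  ultimately obtain S where "family S" and max: "\<And>T. family T \<Longrightarrow> card T \<le> card S"
    using ex_has_greatest_nat[of family "{}" card "Suc M"] by metis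
  then have S: "finite S" "S \<subseteq> dsub - I" "\<Union>S \<subseteq> P" "pairwise disjnt S"
    by (simp_all add: family_def)
  have "atom I \<alpha>" if \<alpha>: "\<alpha> \<in> S" for \<alpha>
    unfolding atom_def
  proof (intro conjI ballI impI)
    show "\<alpha> \<in> dsub" "\<alpha> \<notin> I" using S \<alpha> by auto
    fix \<beta> assume \<beta>: "\<beta> \<in> dsub" "\<beta> \<subseteq> \<alpha>"
    show "\<beta> \<in> I \<or> \<alpha> - \<beta> \<in> I"
    proof (rule ccontr)
      assume neg: "\<not> ?thesis"
      let ?T = "insert \<beta> (insert (\<alpha> - \<beta>) (S - {\<alpha>}))"
      have dis: "disjnt \<gamma> \<alpha>" if "\<gamma> \<in> S - {\<alpha>}" for \<gamma>
        using S \<alpha> that unfolding pairwise_def by blast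
      have ne: "\<beta> \<noteq> {}" "\<alpha> - \<beta> \<noteq> {}" using neg ideal_empty by metis+
      have notin: "\<beta> \<notin> insert (\<alpha> - \<beta>) (S - {\<alpha>})" "\<alpha> - \<beta> \<notin> S - {\<alpha>}"
        using dis ne \<beta>(2) unfolding disjnt_def by blast+
      have "?T \<subseteq> dsub - I" using S neg \<beta>(1) \<open>\<alpha> \<in> dsub\<close> dsub_Diff by auto
      moreover have "\<Union>?T \<subseteq> P" using S \<alpha> \<beta>(2) by blast
      moreover have "pairwise disjnt (S - {\<alpha>})" using S by (auto intro: pairwise_subset)
      then have "pairwise disjnt ?T"
        using dis \<beta>(2) unfolding pairwise_insert by (auto simp: disjnt_def)
      ultimately have "card ?T \<le> card S" using S(1) by (intro max) (simp add: family_def)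
      moreover have "card ?T = Suc (card S)"
        using notin S card.remove[of S \<alpha>] \<alpha> by simp
      ultimately show False by simp
    qed
  qed
  moreover have "P - \<Union>S \<in> I"
  proof (rule ccontr)
    assume neg: "P - \<Union>S \<notin> I"
    have "P - \<Union>S \<in> dsub" using S assms(1) by (intro dsub_Diff dsub_Union) auto
    moreover have "pairwise disjnt (insert (P - \<Union>S) S)"
      using S unfolding pairwise_insert by (auto simp: disjnt_def)
    ultimately have "card (insert (P - \<Union>S) S) \<le> card S" using S neg by (intro max) (auto simp: family_def)
    moreover have "P - \<Union>S \<notin> S"
    proof
      assume "P - \<Union>S \<in> S"
      then have "P - \<Union>S = {}" by blast
      then show False using neg ideal_empty by metis
    qed
    ultimately show False using S by simp
  qed
  ultimately show ?thesis using S assms(1) unfolding atomic_part_def by blast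
qed

text \<open>
  Let \<open>Y\<close> be covered by the atoms \<open>A\<close> and let the fibres of \<open>h\<close> have at most \<open>N\<close> elements. The image of a
  large subset of the preimage is large, hence contains almost all of some atom. If more than \<open>N\<close>
  disjoint subsets have images containing almost all of the same atom, these images have a common
  point, whose fibre is too large. So there are at most \<open>N\<close> times \<open>card A\<close> disjoint large subsets.
\<close>

lemma atomic_part_vimage:
  assumes h: "finite_to_one h" and Y: "Y \<in> atomic_part"
  shows "{x \<in> E. h x \<in> Y} \<in> atomic_part"
proof -
  from h obtain N where dh: "dmap h" "h ` E \<subseteq> E"
    and N: "\<And>y. finite {x \<in> E. h x = y}" "\<And>y. card {x \<in> E. h x = y} \<le> N"
    unfolding finite_to_one_def by blast
  from Y obtain A where Yd: "Y \<in> dsub" and A: "finite A" "\<And>\<alpha>. \<alpha> \<in> A \<Longrightarrow> atom I \<alpha>" "Y - \<Union>A \<in> I"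
    unfolding atomic_part_def by blast
  show ?thesis
  proof (rule atomic_part_if_bounded)
    show "{x \<in> E. h x \<in> Y} \<in> dsub" by (rule dsub_vimage[OF dh(1) Yd])
    fix S assume S: "finite S" "S \<subseteq> dsub - I" "\<Union>S \<subseteq> {x \<in> E. h x \<in> Y}" "pairwise disjnt S"
    have hd: "h ` \<beta> \<in> dsub" if "\<beta> \<in> S" for \<beta>
      using that S(2) dsub_image[OF dh] by blast
    have "\<exists>\<alpha>. \<alpha> \<in> A \<and> \<alpha> \<inter> h ` \<beta> \<notin> I" if \<beta>: "\<beta> \<in> S" for \<beta>
    proof (rule ccontr)
      assume "\<not> ?thesis"
      then have "\<Union>((\<lambda>\<alpha>. \<alpha> \<inter> h ` \<beta>) ` A) \<in> I" using A(1) by (intro ideal_Union) auto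
      then have "\<Union>((\<lambda>\<alpha>. \<alpha> \<inter> h ` \<beta>) ` A) \<union> (Y - \<Union>A) \<in> I" using A(3) by (rule ideal_Un)
      moreover have "h ` \<beta> \<subseteq> \<Union>((\<lambda>\<alpha>. \<alpha> \<inter> h ` \<beta>) ` A) \<union> (Y - \<Union>A)" using S(3) \<beta> by blast
      ultimately have "h ` \<beta> \<in> I" using ideal_mono hd[OF \<beta>] by blast
      then have "{x \<in> E. h x \<in> h ` \<beta>} \<in> I" by (rule ideal_vimage[OF h])
      moreover have "\<beta> \<in> dsub" "\<beta> \<subseteq> {x \<in> E. h x \<in> h ` \<beta>}" using S(2) \<beta> dsub_subset by blast+
      ultimately have "\<beta> \<in> I" using ideal_mono by blast
      then show False using S(2) \<beta> by blast
    qed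
    then obtain f where f: "\<And>\<beta>. \<beta> \<in> S \<Longrightarrow> f \<beta> \<in> A" "\<And>\<beta>. \<beta> \<in> S \<Longrightarrow> f \<beta> \<inter> h ` \<beta> \<notin> I" by metis
    have fibre: "card {\<beta> \<in> S. f \<beta> = \<alpha>} \<le> N" if \<alpha>: "\<alpha> \<in> A" for \<alpha>
    proof -
      let ?T = "{\<beta> \<in> S. f \<beta> = \<alpha>}"
      have "\<exists>y\<in>\<alpha>. \<forall>\<gamma>\<in>(\<lambda>\<beta>. h ` \<beta>) ` ?T. y \<in> \<gamma>"
        by (rule atom_finite_meet[OF A(2)[OF \<alpha>]]) (use S(1) hd f(2) in auto)
      then obtain y where "\<forall>\<beta>\<in>?T. y \<in> h ` \<beta>" by blast
      then have "\<forall>\<beta>\<in>?T. \<exists>x. x \<in> \<beta> \<and> h x = y" by blast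
      then obtain g where g: "\<And>\<beta>. \<beta> \<in> ?T \<Longrightarrow> g \<beta> \<in> \<beta> \<and> h (g \<beta>) = y" by metis
      have "inj_on g ?T"
        proof (rule inj_onI)
        fix \<beta> \<gamma> assume *: "\<beta> \<in> ?T" "\<gamma> \<in> ?T" "g \<beta> = g \<gamma>"
        then have "g \<beta> \<in> \<beta> \<inter> \<gamma>" using g by (metis IntI)
        then show "\<beta> = \<gamma>" using * S(4) unfolding pairwise_def disjnt_def by blast
      qed
      moreover have "g ` ?T \<subseteq> {x \<in> E. h x = y}" using g S(3) by blast
      ultimately have "card ?T \<le> card {x \<in> E. h x = y}" using N(1) by (rule card_inj_on_le)
      then show ?thesis using N(2)[of y] by simp
    qed
    have "S = (\<Union>\<alpha>\<in>A. {\<beta> \<in> S. f \<beta> = \<alpha>})" using f(1) by blast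
    then have "card S \<le> (\<Sum>\<alpha>\<in>A. card {\<beta> \<in> S. f \<beta> = \<alpha>})" using card_UN_le[OF A(1)] by metis
    also have "\<dots> \<le> (\<Sum>\<alpha>\<in>A. N)" by (rule sum_mono[OF fibre])
    finally show "card S \<le> card A * N" by simp
  qed
qed

lemma ideal_subset_atomic_part: "I \<subseteq> atomic_part"
proof
  fix Y assume Y: "Y \<in> I"
  then have "finite {} \<and> (\<forall>\<alpha>\<in>{}. atom I \<alpha>) \<and> Y - \<Union>{} \<in> I" by simp
  then show "Y \<in> atomic_part" unfolding atomic_part_def using ideal_dsub[OF Y] by blast
qed

lemma atomic_part_ideal:
  assumes "E \<notin> atomic_part"
  shows "invariant_ideal atomic_part"
  unfolding invariant_ideal_def
proof (intro conjI ballI allI impI)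
  show "atomic_part \<subseteq> dsub" by (auto simp: atomic_part_def)
  show "{} \<in> atomic_part" using ideal_subset_atomic_part ideal_empty by blast
next
  fix Y Z assume "Y \<in> atomic_part" and Z: "Z \<in> dsub" "Z \<subseteq> Y"
  then obtain A where A: "finite A" "\<forall>\<alpha>\<in>A. atom I \<alpha>" "Y - \<Union>A \<in> I"
    unfolding atomic_part_def by blast
  then have "Z - \<Union>A \<in> dsub" using Z atom_dsub by (intro dsub_Diff dsub_Union) auto
  then have "Z - \<Union>A \<in> I" using ideal_mono[OF A(3)] Z(2) by blast
  then show "Z \<in> atomic_part" using A Z(1) unfolding atomic_part_def by blast
next
  fix Y Z assume "Y \<in> atomic_part" "Z \<in> atomic_part"
  then obtain A B where A: "finite A" "\<forall>\<alpha>\<in>A. atom I \<alpha>" "Y - \<Union>A \<in> I"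
    and B: "finite B" "\<forall>\<alpha>\<in>B. atom I \<alpha>" "Z - \<Union>B \<in> I" and d: "Y \<union> Z \<in> dsub"
    unfolding atomic_part_def using dsub_Un by blast
  then have "Y \<union> Z - \<Union>(A \<union> B) \<in> dsub" using atom_dsub by (intro dsub_Diff dsub_Union) auto
  then have "Y \<union> Z - \<Union>(A \<union> B) \<in> I"
    using ideal_mono[OF ideal_Un[OF A(3) B(3)]] by blast
  then show "Y \<union> Z \<in> atomic_part" using A B d unfolding atomic_part_def
    by (intro CollectI conjI exI[of _ "A \<union> B"]) auto
next
  fix h Y assume "finite_to_one h" "Y \<in> atomic_part"
  then show "{x \<in> E. h x \<in> Y} \<in> atomic_part" by (rule atomic_part_vimage)
qed (rule assms)

text \<open>
  Without atoms, the sets outside \<open>I\<close> would form a perfect tree.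
\<close>

lemma atom_exists: "\<exists>\<alpha>. atom I \<alpha>"
proof (rule ccontr)
  assume none: "\<not> ?thesis"
  show False
  proof (rule small_no_perfect_tree[OF small, of E "dsub - I"])
    show "E \<in> dsub - I" using dsub_E ideal_proper by simp
    fix X assume X: "X \<in> dsub - I"
    then show "dset X \<and> X \<noteq> {}" using ideal_empty by (auto simp: dsub_def)
    have "\<not> atom I X" using none by blast
    with X obtain \<beta> where \<beta>: "\<beta> \<in> dsub" "\<beta> \<subseteq> X" "\<beta> \<notin> I" "X - \<beta> \<notin> I"
      unfolding atom_def by blast
    moreover have "X - \<beta> \<in> dsub" using X \<beta>(1) by (intro dsub_Diff) auto
    ultimately have "\<beta> \<in> dsub - I" "X - \<beta> \<in> dsub - I" "\<beta> \<subseteq> X" "X - \<beta> \<subseteq> X"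
      "\<beta> \<inter> (X - \<beta>) = {}" by auto
    then show "\<exists>Y\<in>dsub - I. \<exists>Z\<in>dsub - I. Y \<subseteq> X \<and> Z \<subseteq> X \<and> Y \<inter> Z = {}"
      by metis
  qed
qed

end

theorem invariant_ideal_with_finitely_many_atoms:
  obtains I A where "invariant_ideal I" "finite A" "\<And>\<alpha>. \<alpha> \<in> A \<Longrightarrow> atom I \<alpha>" "E - \<Union>A \<in> I"
proof -
  have "\<exists>M\<in>Collect invariant_ideal. \<forall>Y\<in>Collect invariant_ideal. M \<subseteq> Y \<longrightarrow> Y = M"
  proof (rule subset_Zorn)
    fix C assume C: "subset.chain (Collect invariant_ideal) C"
    then have sub: "\<And>J. J \<in> C \<Longrightarrow> invariant_ideal J"
      and tot: "\<And>J J'. J \<in> C \<Longrightarrow> J' \<in> C \<Longrightarrow> J \<subseteq> J' \<or> J' \<subseteq> J"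
      unfolding subset_chain_def by blast+
    show "\<exists>U\<in>Collect invariant_ideal. \<forall>J\<in>C. J \<subseteq> U"
    proof (cases "C = {}")
      case True
      have "invariant_ideal {{}}"
        unfolding invariant_ideal_def using dsub_empty one_E by auto
      then show ?thesis using True by blast
    next
      case False
      have "invariant_ideal (\<Union>C)"
        unfolding invariant_ideal_def
      proof (intro conjI ballI allI impI)
        show "\<Union>C \<subseteq> dsub" using ideal_dsub[OF sub] by blast
        show "{} \<in> \<Union>C" using ideal_empty[OF sub] False by blast
        show "E \<notin> \<Union>C" using ideal_proper[OF sub] by blast
      next
        fix Y Z assume "Y \<in> \<Union>C" "Z \<in> dsub" "Z \<subseteq> Y"
        then show "Z \<in> \<Union>C" using ideal_mono[OF sub] by blast
      next
        fix Y Z assume "Y \<in> \<Union>C" "Z \<in> \<Union>C"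
        then obtain J J' where J: "J \<in> C" "Y \<in> J" "J' \<in> C" "Z \<in> J'" by blast
        then have "(Y \<in> J' \<and> Z \<in> J') \<or> (Y \<in> J \<and> Z \<in> J)" using tot[of J J'] by blast
        then show "Y \<union> Z \<in> \<Union>C" using ideal_Un[OF sub] J by blast
      next
        fix h Y assume "finite_to_one h" "Y \<in> \<Union>C"
        then show "{x \<in> E. h x \<in> Y} \<in> \<Union>C" using ideal_vimage[OF sub] by blast
      qed
      then have "\<Union>C \<in> Collect invariant_ideal" by simp
      then show ?thesis by (rule rev_bexI) blast
    qed
  qed
  then obtain I where I: "invariant_ideal I"
    and max: "\<And>J. invariant_ideal J \<Longrightarrow> I \<subseteq> J \<Longrightarrow> J = I" by (metis mem_Collect_eq)
  have "E \<in> atomic_part I"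
  proof (rule ccontr)
    assume "E \<notin> atomic_part I"
    then have eq: "atomic_part I = I"
      using max[OF atomic_part_ideal[OF I]] ideal_subset_atomic_part[OF I] by blast
    obtain \<alpha> where \<alpha>: "atom I \<alpha>" using atom_exists[OF I] by blast
    then have "\<alpha> \<in> atomic_part I"
      unfolding atomic_part_def[OF I] using ideal_empty[OF I]
      by (auto simp: atom_def intro!: exI[of _ "{\<alpha>}"])
    then show False using \<alpha> eq by (simp add: atom_def)
  qed
  then show ?thesis using that I unfolding atomic_part_def[OF I] by blast
qed

end

section \<open>Definable automorphisms act on the generic types\<close>

context definable_subfield
begin

text \<open>
  A definable permutation of \<open>E\<close> together with its inverse; such permutations map ideal to ideal and
  atoms to atoms.
\<close>

definition aut_pair :: "('a \<Rightarrow> 'a) \<Rightarrow> ('a \<Rightarrow> 'a) \<Rightarrow> bool" where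
  "aut_pair h g \<longleftrightarrow> dmap h \<and> dmap g \<and> (\<forall>x\<in>E. h x \<in> E \<and> g x \<in> E \<and> g (h x) = x \<and> h (g x) = x)"

lemma aut_pair_sym: "aut_pair h g \<Longrightarrow> aut_pair g h"
  by (auto simp: aut_pair_def)

lemma aut_pair_translation: "b \<in> E \<inter> dpt \<Longrightarrow> aut_pair (\<lambda>x. x + b) (\<lambda>x. x - b)"
  unfolding aut_pair_def
  by (auto intro: dmap_add dmap_diff dmap_id dmap_const add_E diff_E)

lemma aut_pair_scaling:
  assumes "c \<in> E \<inter> dpt" "c \<noteq> 0"
  shows "aut_pair (\<lambda>x. c * x) (\<lambda>x. inverse c * x)"
proof -
  have "dmap (\<lambda>x. a * x)" if "a \<in> dpt" for a
    by (rule dmap_mult[OF dmap_const[OF that] dmap_id])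
  then show ?thesis
    unfolding aut_pair_def using assms by (auto intro: dpt_inverse mult_E inverse_E)
qed

lemma aut_pair_inverse: "aut_pair inverse inverse"
  unfolding aut_pair_def by (auto intro: dmap_inverse inverse_E)

lemma aut_pair_finite_to_one:
  assumes "aut_pair h g"
  shows "finite_to_one h"
proof -
  have "{x \<in> E. h x = y} \<subseteq> {g y}" for y using assms unfolding aut_pair_def by auto
  then have "finite {x \<in> E. h x = y} \<and> card {x \<in> E. h x = y} \<le> 1" for y
    using finite_subset[of _ "{g y}"] card_mono[of "{g y}"] by fastforce
  moreover have "dmap h" "h ` E \<subseteq> E" using assms unfolding aut_pair_def by blast+
  ultimately show ?thesis unfolding finite_to_one_def by blast
qed

lemma aut_pair_dsub: "aut_pair h g \<Longrightarrow> Y \<in> dsub \<Longrightarrow> h ` Y \<in> dsub"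
  unfolding aut_pair_def by (rule dsub_image) auto

lemma aut_pair_image_image: "aut_pair h g \<Longrightarrow> Y \<subseteq> E \<Longrightarrow> g ` h ` Y = Y"
  unfolding aut_pair_def image_image by (force simp: subset_iff)

context
  fixes I assumes I: "invariant_ideal I"
begin

lemma aut_pair_ideal:
  assumes "aut_pair h g" "Y \<in> I"
  shows "h ` Y \<in> I"
proof -
  have "{x \<in> E. g x \<in> Y} \<in> I"
    by (rule ideal_vimage[OF I aut_pair_finite_to_one[OF aut_pair_sym[OF assms(1)]] assms(2)])
  moreover have "h ` Y = {x \<in> E. g x \<in> Y}"
    using assms(1) dsub_subset[OF ideal_dsub[OF I assms(2)]] unfolding aut_pair_def
    by (force simp: subset_iff image_iff)
  ultimately show ?thesis by simp
qed

lemma aut_pair_ideal_iff: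
  assumes "aut_pair h g" "Y \<in> dsub"
  shows "h ` Y \<in> I \<longleftrightarrow> Y \<in> I"
  using aut_pair_ideal[OF assms(1), of Y] aut_pair_ideal[OF aut_pair_sym[OF assms(1)], of "h ` Y"]
    aut_pair_image_image[OF assms(1) dsub_subset[OF assms(2)]] by auto

lemma aut_pair_Int:
  assumes "aut_pair h g" "Y \<subseteq> E" "Z \<subseteq> E"
  shows "h ` (Y \<inter> Z) = h ` Y \<inter> h ` Z"
proof (rule inj_on_image_Int[of h E])
  show "inj_on h E" using assms(1) unfolding aut_pair_def by (intro inj_on_inverseI[of _ g]) auto
qed (use assms in auto)

lemma aut_pair_meet_iff:
  assumes "aut_pair h g" "Y \<in> dsub" "Z \<in> dsub"
  shows "h ` Y \<inter> h ` Z \<in> I \<longleftrightarrow> Y \<inter> Z \<in> I"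
  using aut_pair_ideal_iff[OF assms(1) dsub_Int[OF assms(2,3)]]
    aut_pair_Int[OF assms(1) dsub_subset[OF assms(2)] dsub_subset[OF assms(3)]] by simp

lemma aut_pair_atom:
  assumes "aut_pair h g" "atom I \<alpha>"
  shows "atom I (h ` \<alpha>)"
proof -
  have \<alpha>: "\<alpha> \<in> dsub" "\<alpha> \<notin> I" and split: "\<And>\<gamma>. \<gamma> \<in> dsub \<Longrightarrow> \<gamma> \<subseteq> \<alpha> \<Longrightarrow> \<gamma> \<in> I \<or> \<alpha> - \<gamma> \<in> I"
    using assms(2) unfolding atom_def by blast+
  note g = aut_pair_sym[OF assms(1)]
  show ?thesis unfolding atom_def
  proof (intro conjI ballI impI)
    show "h ` \<alpha> \<in> dsub" by (rule aut_pair_dsub[OF assms(1) \<alpha>(1)])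
    show "h ` \<alpha> \<notin> I" using aut_pair_ideal_iff[OF assms(1) \<alpha>(1)] \<alpha>(2) by simp
    fix \<beta> assume \<beta>: "\<beta> \<in> dsub" "\<beta> \<subseteq> h ` \<alpha>"
    have "g ` \<beta> \<subseteq> \<alpha>"
      using aut_pair_image_image[OF assms(1) dsub_subset[OF \<alpha>(1)]] \<beta>(2) by blast
    then consider "g ` \<beta> \<in> I" | "\<alpha> - g ` \<beta> \<in> I"
      using split[OF aut_pair_dsub[OF g \<beta>(1)]] by blast
    then show "\<beta> \<in> I \<or> h ` \<alpha> - \<beta> \<in> I"
    proof cases
      case 1
      then show ?thesis using aut_pair_ideal_iff[OF g \<beta>(1)] by simp
    next
      case 2
      then have "h ` (\<alpha> - g ` \<beta>) \<in> I" by (rule aut_pair_ideal[OF assms(1)])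
      moreover have "h ` \<alpha> - \<beta> \<subseteq> h ` (\<alpha> - g ` \<beta>)"
        using assms(1) dsub_subset[OF \<alpha>(1)] dsub_subset[OF \<beta>(1)] unfolding aut_pair_def
        by (force simp: subset_iff image_iff)
      moreover have "h ` \<alpha> - \<beta> \<in> dsub"
        by (intro dsub_Diff aut_pair_dsub[OF assms(1)] \<alpha> \<beta>)
      ultimately show ?thesis using ideal_mono[OF I] by blast
    qed
  qed
qed

text \<open>
  Between atoms this means equality modulo \<open>I\<close>.
\<close>

definition similar :: "'a set \<Rightarrow> 'a set \<Rightarrow> bool" where
  "similar \<alpha> \<beta> \<longleftrightarrow> \<alpha> \<inter> \<beta> \<notin> I"

lemma similar_sym: "similar \<alpha> \<beta> \<Longrightarrow> similar \<beta> \<alpha>"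
  by (simp add: similar_def Int_commute)

lemma similar_trans:
  assumes "atom I \<alpha>" "atom I \<beta>" "atom I \<gamma>" "similar \<alpha> \<beta>" "similar \<beta> \<gamma>"
  shows "similar \<alpha> \<gamma>"
proof -
  note d = assms(1-3)[THEN atom_dsub[OF I]]
  have "\<beta> \<inter> \<alpha> \<inter> \<gamma> \<notin> I"
    using assms(4,5) by (intro atom_meet[OF I assms(2) d(1,3)]) (auto simp: similar_def Int_commute)
  moreover have "\<beta> \<inter> \<alpha> \<inter> \<gamma> \<in> dsub" by (intro dsub_Int d)
  moreover have "\<beta> \<inter> \<alpha> \<inter> \<gamma> \<subseteq> \<alpha> \<inter> \<gamma>" by blast
  ultimately have "\<alpha> \<inter> \<gamma> \<notin> I" by (metis ideal_mono[OF I])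
  then show ?thesis by (simp add: similar_def)
qed

lemma aut_pair_similar:
  "aut_pair h g \<Longrightarrow> atom I \<alpha> \<Longrightarrow> atom I \<beta> \<Longrightarrow> similar (h ` \<alpha>) (h ` \<beta>) \<longleftrightarrow> similar \<alpha> \<beta>"
  by (simp add: similar_def aut_pair_meet_iff[OF _ atom_dsub[OF I] atom_dsub[OF I]])

context
  fixes A assumes A: "finite A" "\<And>\<alpha>. \<alpha> \<in> A \<Longrightarrow> atom I \<alpha>" "E - \<Union>A \<in> I"
begin

lemma large_meets_atom:
  assumes "Y \<in> dsub" "Y \<notin> I"
  obtains \<alpha> where "\<alpha> \<in> A" "similar \<alpha> Y"
proof -
  have "\<exists>\<alpha>\<in>A. \<alpha> \<inter> Y \<notin> I"
  proof (rule ccontr)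
    assume "\<not> ?thesis"
    then have "\<Union>((\<lambda>\<alpha>. \<alpha> \<inter> Y) ` A) \<in> I" using A(1) by (intro ideal_Union[OF I]) auto
    then have "\<Union>((\<lambda>\<alpha>. \<alpha> \<inter> Y) ` A) \<union> (E - \<Union>A) \<in> I" using A(3) by (rule ideal_Un[OF I])
    moreover have "Y \<subseteq> \<Union>((\<lambda>\<alpha>. \<alpha> \<inter> Y) ` A) \<union> (E - \<Union>A)" using dsub_subset[OF assms(1)] by blast
    ultimately show False using ideal_mono[OF I _ assms(1)] assms(2) by blast
  qed
  then show ?thesis using that unfolding similar_def by blast
qed

text \<open>
  Each definable point of \<open>E\<close> permutes the classes of the finitely many atoms by translation. As
  there are infinitely many such points, two of them, \<open>b\<close> and \<open>b'\<close>, induce the same permutation, and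
  \<open>b - b'\<close> fixes all classes.
\<close>

lemma nonzero_translation_fixes_atoms:
  "\<exists>s\<in>E \<inter> dpt. s \<noteq> 0 \<and> (\<forall>\<beta>. atom I \<beta> \<longrightarrow> similar ((\<lambda>x. x + s) ` \<beta>) \<beta>)"
proof -
  define \<rho> where "\<rho> \<beta> = (SOME \<alpha>. \<alpha> \<in> A \<and> similar \<alpha> \<beta>)" for \<beta>
  have \<rho>: "\<rho> \<beta> \<in> A \<and> similar (\<rho> \<beta>) \<beta>" if "atom I \<beta>" for \<beta>
  proof -
    have "\<beta> \<notin> I" using that by (simp add: atom_def)
    from large_meets_atom[OF atom_dsub[OF I that] this]
    have "\<exists>\<alpha>. \<alpha> \<in> A \<and> similar \<alpha> \<beta>" by metis
    then show ?thesis unfolding \<rho>_def by (rule someI_ex)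
  qed
  let ?t = "\<lambda>b. (`) (\<lambda>x. x + b)"
  define f where "f b = restrict (\<lambda>\<alpha>. \<rho> (?t b \<alpha>)) A" for b
  have tr: "atom I (?t b \<alpha>)" if "b \<in> E \<inter> dpt" "atom I \<alpha>" for b \<alpha>
    using aut_pair_atom[OF aut_pair_translation[OF that(1)] that(2)] .
  have "f ` (E \<inter> dpt) \<subseteq> (\<Pi>\<^sub>E \<alpha>\<in>A. A)"
    using \<rho> tr A(2) by (auto simp: f_def)
  then have "finite (f ` (E \<inter> dpt))"
    using finite_PiE[of A "\<lambda>_. A"] A(1) finite_subset by blast
  then have "\<not> inj_on f (E \<inter> dpt)"
    using infinite_points finite_imageD by blast
  then obtain b b' where b: "b \<in> E \<inter> dpt" "b' \<in> E \<inter> dpt" "b \<noteq> b'" "f b = f b'"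
    unfolding inj_on_def by blast
  have s: "b - b' \<in> E \<inter> dpt" using b diff_E dpt_diff by blast
  have onA: "similar (?t (b - b') \<alpha>) \<alpha>" if "\<alpha> \<in> A" for \<alpha>
  proof -
    note at = A(2)[OF that]
    have "\<rho> (?t b \<alpha>) = \<rho> (?t b' \<alpha>)" using fun_cong[OF b(4), of \<alpha>] that by (simp add: f_def)
    then have "similar (?t b \<alpha>) (?t b' \<alpha>)"
      using \<rho>[OF tr[OF b(1) at]] \<rho>[OF tr[OF b(2) at]] tr[OF b(1) at] tr[OF b(2) at] A(2)
        similar_trans similar_sym by metis
    moreover have "?t b \<alpha> = ?t b' (?t (b - b') \<alpha>)"
      by (simp add: image_image algebra_simps)
    ultimately show ?thesis
      using aut_pair_similar[OF aut_pair_translation[OF b(2)] tr[OF s at] at] by simp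
  qed
  have "similar (?t (b - b') \<beta>) \<beta>" if \<beta>: "atom I \<beta>" for \<beta>
  proof -
    have \<rho>\<beta>: "atom I (\<rho> \<beta>)" "similar (\<rho> \<beta>) \<beta>" "similar (?t (b - b') (\<rho> \<beta>)) (\<rho> \<beta>)"
      using \<rho>[OF \<beta>] A(2) onA by auto
    have "similar (?t (b - b') \<beta>) (?t (b - b') (\<rho> \<beta>))"
      using aut_pair_similar[OF aut_pair_translation[OF s] \<beta> \<rho>\<beta>(1)] similar_sym[OF \<rho>\<beta>(2)] by simp
    then have "similar (?t (b - b') \<beta>) (\<rho> \<beta>)"
      using similar_trans[OF tr[OF s \<beta>] tr[OF s \<rho>\<beta>(1)] \<rho>\<beta>(1)] \<rho>\<beta>(3) by blast
    then show ?thesis using similar_trans[OF tr[OF s \<beta>] \<rho>\<beta>(1) \<beta>] \<rho>\<beta>(2) by blast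
  qed
  then show ?thesis using s b(3) by (intro bexI[of _ "b - b'"]) auto
qed

text \<open>
  Scaling by a definable point permutes the atoms, so the translations that fix all classes of atoms
  form an ideal of the field of definable points of \<open>E\<close>, and this ideal is not zero.
\<close>

lemma translation_fixes_atoms:
  assumes b: "b \<in> E \<inter> dpt" and \<beta>: "atom I \<beta>"
  shows "similar ((\<lambda>x. x + b) ` \<beta>) \<beta>"
proof -
  from nonzero_translation_fixes_atoms obtain s where s: "s \<in> E \<inter> dpt" "s \<noteq> 0"
    and s_fix: "\<And>\<beta>. atom I \<beta> \<Longrightarrow> similar ((\<lambda>x. x + s) ` \<beta>) \<beta>" by blast
  show ?thesis
  proof (cases "b = 0")
    case True
    then show ?thesis using \<beta> by (simp add: similar_def atom_def)
  next
    case False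
    define c where "c = b * inverse s"
    have c: "c \<in> E \<inter> dpt" "c \<noteq> 0" "c * s = b"
      using b s False by (auto simp: c_def mult_E inverse_E dpt_mult dpt_inverse)
    let ?\<gamma> = "(\<lambda>x. inverse c * x) ` \<beta>"
    note sc = aut_pair_scaling[OF c(1,2)]
    have \<gamma>: "atom I ?\<gamma>" by (rule aut_pair_atom[OF aut_pair_sym[OF sc] \<beta>])
    have "similar ((\<lambda>x. c * x) ` (\<lambda>x. x + s) ` ?\<gamma>) ((\<lambda>x. c * x) ` ?\<gamma>)"
      using aut_pair_similar[OF sc aut_pair_atom[OF aut_pair_translation[OF s(1)] \<gamma>] \<gamma>] s_fix[OF \<gamma>]
      by simp
    moreover have "c * (inverse c * x + s) = x + b" "c * (inverse c * x) = x" for x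
      using c(2,3) by (simp_all add: algebra_simps)
    ultimately show ?thesis by (simp add: image_image)
  qed
qed

lemma large_additive_subgroup:
  assumes H: "H \<in> dsub" "H \<notin> I" "\<And>x y. x \<in> H \<Longrightarrow> y \<in> H \<Longrightarrow> x - y \<in> H"
  shows "E \<inter> dpt \<subseteq> H"
proof
  fix b assume b: "b \<in> E \<inter> dpt"
  obtain \<alpha> where \<alpha>: "\<alpha> \<in> A" "similar \<alpha> H" using large_meets_atom[OF H(1,2)] .
  then have "atom I (\<alpha> \<inter> H)" using atom_Int(2)[OF I A(2) H(1)] by (simp add: similar_def)
  from translation_fixes_atoms[OF b this]
  have "(\<lambda>x. x + b) ` (\<alpha> \<inter> H) \<inter> (\<alpha> \<inter> H) \<noteq> {}"
    using ideal_empty[OF I] unfolding similar_def by auto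
  then obtain x where "x \<in> H" "x + b \<in> H" by blast
  then show "b \<in> H" using H(3)[of "x + b" x] by simp
qed

text \<open>
  For a point \<open>c\<close>, take an atom \<open>\<beta>\<close> inside \<open>c X\<close>. Almost all \<open>z\<close> in \<open>\<beta>\<close> satisfy \<open>z + 1 \<in> \<beta>\<close>, and almost all
  satisfy \<open>1/z + 1 \<in> \<gamma>\<close>, where \<open>\<gamma>\<close> is the atom of inverses of \<open>\<beta>\<close>. Writing \<open>z = c x\<close>, \<open>z + 1 = c y\<close> and
  \<open>1/z + 1 = 1/(c w)\<close> with \<open>x\<close>, \<open>y\<close>, \<open>w\<close> in \<open>X\<close> gives \<open>c = x/(y w)\<close>.
\<close>

lemma large_multiplicative_subgroup:
  assumes X: "X \<in> dsub" "X \<notin> I" "0 \<notin> X" "\<And>x y. x \<in> X \<Longrightarrow> y \<in> X \<Longrightarrow> x * y \<in> X"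
    "\<And>x. x \<in> X \<Longrightarrow> inverse x \<in> X"
  shows "E \<inter> dpt - {0} \<subseteq> X"
proof
  fix c assume "c \<in> E \<inter> dpt - {0}"
  then have c: "c \<in> E \<inter> dpt" "c \<noteq> 0" by auto
  have one: "1 \<in> E \<inter> dpt" using one_E dpt_1 by simp
  have m1: "- 1 \<in> E \<inter> dpt" using uminus_E[OF one_E] dpt_uminus[OF dpt_1] by simp
  obtain \<alpha> where \<alpha>: "\<alpha> \<in> A" "similar \<alpha> X" using large_meets_atom[OF X(1,2)] .
  then have at: "atom I (\<alpha> \<inter> X)" using atom_Int(2)[OF I A(2) X(1)] by (simp add: similar_def)
  define \<beta> where "\<beta> = (\<lambda>x. c * x) ` (\<alpha> \<inter> X)"
  define \<gamma> where "\<gamma> = inverse ` \<beta>"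
  have \<beta>: "atom I \<beta>" unfolding \<beta>_def by (rule aut_pair_atom[OF aut_pair_scaling[OF c] at])
  have \<gamma>: "atom I \<gamma>" unfolding \<gamma>_def by (rule aut_pair_atom[OF aut_pair_inverse \<beta>])
  let ?m = "(`) (\<lambda>x. x + - 1)"
  have \<beta>1: "\<beta> \<inter> ?m \<beta> \<notin> I" and \<gamma>1: "\<gamma> \<inter> ?m \<gamma> \<notin> I"
    using translation_fixes_atoms[OF m1 \<beta>] translation_fixes_atoms[OF m1 \<gamma>]
    by (simp_all add: similar_def Int_commute)
  have md: "?m Y \<in> dsub" if "Y \<in> dsub" for Y
    by (rule aut_pair_dsub[OF aut_pair_translation[OF m1] that])
  note \<beta>d = atom_dsub[OF I \<beta>] and \<gamma>d = atom_dsub[OF I \<gamma>]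
  let ?V = "inverse ` (\<gamma> \<inter> ?m \<gamma>)"
  have Vd: "?V \<in> dsub" by (intro aut_pair_dsub[OF aut_pair_inverse] dsub_Int \<gamma>d md)
  have VI: "?V \<notin> I"
    using aut_pair_ideal_iff[OF aut_pair_inverse dsub_Int[OF \<gamma>d md[OF \<gamma>d]]] \<gamma>1 by simp
  have "inverse ` \<gamma> = \<beta>" unfolding \<gamma>_def by (simp add: image_image)
  then have "?V \<subseteq> \<beta>" by blast
  then have "\<beta> \<inter> ?V = ?V" by blast
  then have "\<beta> \<inter> ?m \<beta> \<inter> ?V \<notin> I"
    using atom_meet[OF I \<beta> md[OF \<beta>d] Vd \<beta>1] VI by simp
  then have "\<beta> \<inter> ?m \<beta> \<inter> ?V \<noteq> {}" using ideal_empty[OF I] by metis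
  then obtain z where z: "z \<in> \<beta>" "z \<in> ?m \<beta>" "z \<in> ?V" by blast
  from z(1) obtain x where x: "x \<in> X" "z = c * x" unfolding \<beta>_def by blast
  from z(2) obtain y where y: "y \<in> X" "z + 1 = c * y" unfolding \<beta>_def by auto
  from z(3) obtain w where w: "w \<in> X" "inverse z + 1 = inverse (c * w)"
    unfolding \<gamma>_def \<beta>_def by auto
  have nz: "x \<noteq> 0" "y \<noteq> 0" "w \<noteq> 0" using x y w X(3) by auto
  have "z \<noteq> 0" using x nz c by simp
  then have "(z + 1) * inverse z = inverse (c * w)" using w(2) by (simp add: distrib_right add.commute)
  then have "(c * y) * inverse (c * x) = inverse (c * w)"
    by (simp only: x(2)[symmetric] y(2)[symmetric])
  then have "c = x * inverse (y * w)" using nz c(2) by (simp add: field_simps)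
  then show "c \<in> X" using X(4)[OF x(1) X(5)[OF X(4)[OF y(1) w(1)]]] by simp
qed

text \<open>
  Otherwise \<open>{0}\<close> would be an atom, which translation by \<open>1\<close> would have to fix.
\<close>

lemma singleton_zero_small: "{0} \<in> I"
proof (rule ccontr)
  assume large: "{0} \<notin> I"
  have "{0} \<in> dsub" using dpt_0 zero_E by (simp add: dsub_def dpt_def)
  then have "atom I {0}"
    unfolding atom_def using large ideal_empty[OF I] by (auto simp: subset_singleton_iff)
  then have "similar ((\<lambda>x. x + 1) ` {0}) {0}"
    by (intro translation_fixes_atoms) (use one_E dpt_1 in auto)
  then show False using ideal_empty[OF I] by (simp add: similar_def)
qed

lemma finite_to_one_image_large:
  assumes h: "finite_to_one h" and Y: "Y \<in> dsub" "Y \<notin> I"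
  shows "h ` Y \<in> dsub" "h ` Y \<notin> I"
proof -
  show "h ` Y \<in> dsub" using h Y(1) dsub_image unfolding finite_to_one_def by blast
  show "h ` Y \<notin> I"
  proof
    assume "h ` Y \<in> I"
    then have "{x \<in> E. h x \<in> h ` Y} \<in> I" by (rule ideal_vimage[OF I h])
    moreover have "Y \<subseteq> {x \<in> E. h x \<in> h ` Y}" using dsub_subset[OF Y(1)] by blast
    ultimately show False using ideal_mono[OF I _ Y(1)] Y(2) by blast
  qed
qed

end

end

end

section \<open>Additive polynomials and power maps are surjective\<close>

lemma poly_fibre:
  fixes q :: "'a::idom poly"
  assumes "degree q > 0"
  shows "finite {x \<in> E. poly q x = y}" "card {x \<in> E. poly q x = y} \<le> degree q"
proof -
  have ne: "q - [:y:] \<noteq> 0" using assms by auto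
  have sub: "{x \<in> E. poly q x = y} \<subseteq> {x. poly (q - [:y:]) x = 0}" by auto
  show "finite {x \<in> E. poly q x = y}"
    using finite_subset[OF sub poly_roots_finite[OF ne]] .
  have "card {x \<in> E. poly q x = y} \<le> card {x. poly (q - [:y:]) x = 0}"
    by (rule card_mono[OF poly_roots_finite[OF ne] sub])
  also have "\<dots> \<le> degree (q - [:y:])" by (rule card_poly_roots_bound[OF ne])
  also have "\<dots> \<le> degree q" by (rule degree_diff_le) auto
  finally show "card {x \<in> E. poly q x = y} \<le> degree q" .
qed


context definable_subfield
begin

lemma finite_to_one_poly:
  assumes "dmap (poly q)" "poly q ` E \<subseteq> E" "degree q > 0"
  shows "finite_to_one (poly q)"
  unfolding finite_to_one_def using assms poly_fibre[OF assms(3)] by blast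

text \<open>
  Fibres of a polynomial are bounded by its degree, so the image of \<open>E\<close> is a large additive
  subgroup.
\<close>

theorem additive_polynomial_surjective:
  assumes "dmap (poly q)" "poly q ` E \<subseteq> E" "degree q > 0"
    and add: "\<And>x y. poly q (x - y) = poly q x - poly q y"
    and c: "c \<in> E \<inter> dpt"
  obtains x where "x \<in> E" "poly q x = c"
proof -
  obtain I A where I: "invariant_ideal I" and A: "finite A" "\<And>\<alpha>. \<alpha> \<in> A \<Longrightarrow> atom I \<alpha>" "E - \<Union>A \<in> I"
    using invariant_ideal_with_finitely_many_atoms by metis
  note img = finite_to_one_image_large[OF I A finite_to_one_poly[OF assms(1-3)] dsub_E ideal_proper[OF I]]
  have "E \<inter> dpt \<subseteq> poly q ` E"
  proof (rule large_additive_subgroup[OF I A img])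
    fix x y assume "x \<in> poly q ` E" "y \<in> poly q ` E"
    then obtain u v where "u \<in> E" "v \<in> E" "x = poly q u" "y = poly q v" by blast
    then show "x - y \<in> poly q ` E" using add[of u v] diff_E by (intro image_eqI[of _ _ "u - v"]) auto
  qed
  then show ?thesis using c that by blast
qed

theorem power_map_surjective:
  assumes n: "n > 0" and c: "c \<in> E \<inter> dpt"
  obtains x where "x \<in> E" "x ^ n = c"
proof (cases "c = 0")
  case True
  then show ?thesis using that[OF zero_E] n by simp
next
  case False
  obtain I A where I: "invariant_ideal I" and A: "finite A" "\<And>\<alpha>. \<alpha> \<in> A \<Longrightarrow> atom I \<alpha>" "E - \<Union>A \<in> I"
    using invariant_ideal_with_finitely_many_atoms by metis
  have eq: "(\<lambda>x::'a. x ^ n) = poly (Polynomial.monom 1 n)" by (simp add: fun_eq_iff poly_monom)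
  have h: "finite_to_one (\<lambda>x. x ^ n)"
    unfolding eq by (rule finite_to_one_poly)
      (use n power_E dmap_power in \<open>auto simp: eq[symmetric] degree_monom_eq\<close>)
  have zd: "{0} \<in> dsub" using dpt_0 zero_E by (simp add: dsub_def dpt_def)
  have "E - {0} \<notin> I"
  proof
    assume "E - {0} \<in> I"
    then have "(E - {0}) \<union> {0} \<in> I" using singleton_zero_small[OF I A] by (rule ideal_Un[OF I])
    then show False using ideal_proper[OF I] zero_E by (simp add: insert_absorb)
  qed
  note img = finite_to_one_image_large[OF I A h dsub_Diff[OF dsub_E zd] this]
  have "E \<inter> dpt - {0} \<subseteq> (\<lambda>x. x ^ n) ` (E - {0})"
  proof (rule large_multiplicative_subgroup[OF I A img])
    show "0 \<notin> (\<lambda>x. x ^ n) ` (E - {0})" by auto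
    fix x assume "x \<in> (\<lambda>x. x ^ n) ` (E - {0})"
    then obtain u where u: "u \<in> E" "u \<noteq> 0" "x = u ^ n" by blast
    then show "inverse x \<in> (\<lambda>x. x ^ n) ` (E - {0})"
      using inverse_E by (intro image_eqI[of _ _ "inverse u"]) (auto simp: power_inverse)
    fix y assume "y \<in> (\<lambda>x. x ^ n) ` (E - {0})"
    then obtain v where v: "v \<in> E" "v \<noteq> 0" "y = v ^ n" by blast
    then show "x * y \<in> (\<lambda>x. x ^ n) ` (E - {0})"
      using u mult_E by (intro image_eqI[of _ _ "u * v"]) (auto simp: power_mult_distrib)
  qed
  then show ?thesis using c False that by blast
qed

end

section \<open>Roots of unity in fields closed under radicals and Artin-Schreier roots\<close>

lemma inverse_mod_CHAR:
  assumes "prime CHAR('a::field)" "0 < i" "i < CHAR('a)"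
  obtains k where "of_nat (k * i) = (1::'a)"
proof -
  have "coprime i CHAR('a)"
    using assms by (metis coprime_commute nat_dvd_not_less prime_imp_coprime)
  then obtain k where "[i * k = 1] (mod CHAR('a))" using cong_solve_coprime_nat[of i "CHAR('a)"] by auto
  then have "of_nat (i * k) = (of_nat 1 :: 'a)" by (simp only: of_nat_eq_iff_cong_CHAR)
  then show ?thesis using that[of k] by (simp add: mult.commute)
qed

text \<open>
  A subgroup of \<open>V\<close> of largest possible order among those of order a power of the characteristic is
  all of \<open>V\<close>: adjoining the multiples of a further element multiplies the order by the
  characteristic.
\<close>

lemma card_additive_subgroup:
  fixes V :: "'a::field set"
  assumes p: "prime CHAR('a)" and V: "finite V" "0 \<in> V" "\<And>x y. x \<in> V \<Longrightarrow> y \<in> V \<Longrightarrow> x - y \<in> V"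
  shows "\<exists>d. card V = CHAR('a) ^ d"
proof -
  define sg where "sg W \<longleftrightarrow> W \<subseteq> V \<and> 0 \<in> W \<and> (\<forall>x\<in>W. \<forall>y\<in>W. x - y \<in> W) \<and>
    (\<exists>d. card W = CHAR('a) ^ d)" for W
  have "sg {0}" using V(2) by (auto simp: sg_def intro: exI[of _ 0])
  moreover have "\<forall>W. sg W \<longrightarrow> card W < Suc (card V)"
    using card_mono[OF V(1)] by (auto simp: sg_def less_Suc_eq_le)
  ultimately obtain W where W: "sg W" and max: "\<And>U. sg U \<Longrightarrow> card U \<le> card W"
    using ex_has_greatest_nat[of sg "{0}" card "Suc (card V)"] by metis
  from W obtain d where WV: "W \<subseteq> V" and W0: "0 \<in> W" and Wd: "\<And>x y. x \<in> W \<Longrightarrow> y \<in> W \<Longrightarrow> x - y \<in> W"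
    and d: "card W = CHAR('a) ^ d" unfolding sg_def by blast
  have fW: "finite W" using WV V(1) finite_subset by blast
  have neg: "- x \<in> W" if "x \<in> W" for x using Wd[OF W0 that] by simp
  have add: "x + y \<in> W" if "x \<in> W" "y \<in> W" for x y using Wd[OF that(1) neg[OF that(2)]] by simp
  have mult: "of_nat n * x \<in> W" if "x \<in> W" for n x
    by (induction n) (auto simp: W0 add that distrib_right)
  have "V \<subseteq> W"
  proof (rule ccontr)
    assume "\<not> V \<subseteq> W"
    then obtain x where x: "x \<in> V" "x \<notin> W" by blast
    have Vneg: "- y \<in> V" if "y \<in> V" for y using V(3)[OF V(2) that] by simp
    have Vadd: "y + z \<in> V" if "y \<in> V" "z \<in> V" for y z using V(3)[OF that(1) Vneg[OF that(2)]] by simp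
    have Vmult: "of_nat n * x \<in> V" for n
      by (induction n) (auto simp: V(2) Vadd x(1) distrib_right)
    define f where "f = (\<lambda>(w, i). w + of_nat i * x)"
    let ?p = "CHAR('a)"
    have less: "i = j" if "w \<in> W" "w' \<in> W" "i < ?p" "j < ?p" "w + of_nat i * x = w' + of_nat j * x" "i \<le> j"
      for w w' i j
    proof (rule ccontr)
      assume "i \<noteq> j"
      then have ij: "0 < j - i" "j - i < ?p" using that by auto
      from inverse_mod_CHAR[OF p ij] obtain k where k: "of_nat (k * (j - i)) = (1::'a)" .
      have "of_nat (j - i) * x = w - w'" using that by (simp add: of_nat_diff algebra_simps)
      then have "of_nat (j - i) * x \<in> W" using Wd that by simp
      then have "of_nat k * (of_nat (j - i) * x) \<in> W" by (rule mult)
      moreover have "of_nat k * (of_nat (j - i) * x) = x" using k by (simp flip: mult.assoc of_nat_mult)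
      ultimately show False using x(2) by simp
    qed
    have inj: "inj_on f (W \<times> {..<?p})"
    proof (rule inj_onI)
      fix a b assume ab: "a \<in> W \<times> {..<?p}" "b \<in> W \<times> {..<?p}" "f a = f b"
      obtain w i w' j where eq: "a = (w, i)" "b = (w', j)" by (cases a; cases b)
      have "i = j" using less[of w w' i j] less[of w' w j i] ab unfolding eq f_def by (cases "i \<le> j") auto
      then show "a = b" using ab unfolding eq f_def by auto
    qed
    let ?U = "f ` (W \<times> {..<?p})"
    have "card ?U = ?p ^ Suc d" using card_image[OF inj] d
      by (simp add: card_cartesian_product)
    moreover have "?U \<subseteq> V" using WV Vadd Vmult by (auto simp: f_def)
    moreover have "0 \<in> ?U" using W0 prime_gt_0_nat[OF p] by (force simp: f_def)
    moreover have "u - v \<in> ?U" if "u \<in> ?U" "v \<in> ?U" for u v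
    proof -
      from that obtain w i w' j where u: "w \<in> W" "u = w + of_nat i * x" and v: "w' \<in> W" "v = w' + of_nat j * x"
        and j: "j < ?p" by (auto simp: f_def)
      have "of_nat ((i + (?p - j)) mod ?p) = (of_nat (i + (?p - j)) :: 'a)"
        by (simp only: of_nat_eq_iff_cong_CHAR cong_mod_left cong_refl)
      also have "\<dots> = of_nat i - of_nat j" using j by (simp add: of_nat_diff)
      finally have "of_nat ((i + (?p - j)) mod ?p) * x = of_nat i * x - of_nat j * x"
        by (simp add: left_diff_distrib)
      then have "u - v = (w - w') + of_nat ((i + (?p - j)) mod ?p) * x"
        using u v by simp
      moreover have "(i + (?p - j)) mod ?p < ?p" using prime_gt_0_nat[OF p] by simp
      ultimately show ?thesis using Wd[OF u(1) v(1)] by (force simp: f_def)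
    qed
    ultimately have "sg ?U" unfolding sg_def by blast
    then have "card ?U \<le> card W" by (rule max)
    then show False using \<open>card ?U = ?p ^ Suc d\<close> d prime_gt_1_nat[OF p] by simp
  qed
  then have "V = W" using WV by blast
  then show ?thesis using d by blast
qed

locale radically_closed =
  fixes E :: "'a::field set" and p :: nat
  assumes CHAR: "CHAR('a) = p"
    and prime_p: "prime p"
    and one_E: "1 \<in> E"
    and diff_E: "x \<in> E \<Longrightarrow> y \<in> E \<Longrightarrow> x - y \<in> E"
    and mult_E: "x \<in> E \<Longrightarrow> y \<in> E \<Longrightarrow> x * y \<in> E"
    and inverse_E: "x \<in> E \<Longrightarrow> inverse x \<in> E"
    and Artin_Schreier: "c \<in> E \<Longrightarrow> \<exists>x\<in>E. x ^ p - x = c"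
    and radicals: "0 < n \<Longrightarrow> c \<in> E \<Longrightarrow> \<exists>x\<in>E. x ^ n = c"
begin

text \<open>
  The elements of \<open>E\<close> in the field with \<open>p ^ s\<close> elements.
\<close>

definition fld :: "nat \<Rightarrow> 'a set" where
  "fld s = {x \<in> E. x ^ (p ^ s) = x}"

text \<open>
  \<open>E\<close> contains the field with \<open>p ^ d\<close> elements.
\<close>

definition realised_degree :: "nat \<Rightarrow> bool" where
  "realised_degree d \<longleftrightarrow> d > 0 \<and> card (fld d) = p ^ d"

lemma p_gt_1: "p > 1"
  by (rule prime_gt_1_nat[OF prime_p])

lemma power_add_frobenius: "(x + y) ^ (p ^ s) = x ^ (p ^ s) + (y::'a) ^ (p ^ s)"
  using freshmans_dream'[of "p ^ s" s x y] prime_p CHAR by simp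

lemma power_diff_frobenius: "(x - y) ^ (p ^ s) = x ^ (p ^ s) - (y::'a) ^ (p ^ s)"
  using power_add_frobenius[of "x - y" y s] by (simp add: algebra_simps)

lemma power_E: "x \<in> E \<Longrightarrow> x ^ n \<in> E"
  by (induction n) (auto intro: one_E mult_E)

lemma finite_fld: "s > 0 \<Longrightarrow> finite (fld s)"
  and card_fld_le: "s > 0 \<Longrightarrow> card (fld s) \<le> p ^ s"
proof -
  assume s: "s > 0"
  have ps: "p ^ s > 1" by (rule one_less_power[OF p_gt_1 s])
  let ?q = "Polynomial.monom 1 (p ^ s) + [:0, - 1:] :: 'a poly"
  have deg: "degree ?q = p ^ s"
    using ps by (subst degree_add_eq_left) (auto simp: degree_monom_eq)
  have eq: "fld s = {x \<in> E. poly ?q x = 0}" by (simp add: fld_def poly_monom)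
  have deg0: "degree ?q > 0" using ps unfolding deg by linarith
  show "finite (fld s)" unfolding eq by (rule poly_fibre(1)[OF deg0])
  show "card (fld s) \<le> p ^ s" unfolding eq using poly_fibre(2)[OF deg0, of E 0] unfolding deg .
qed

lemma diff_fld: "x \<in> fld s \<Longrightarrow> y \<in> fld s \<Longrightarrow> x - y \<in> fld s"
  using diff_E by (auto simp: fld_def power_diff_frobenius)

lemma mult_fld: "x \<in> fld s \<Longrightarrow> y \<in> fld s \<Longrightarrow> x * y \<in> fld s"
  using mult_E by (auto simp: fld_def power_mult_distrib)

lemma inverse_fld: "x \<in> fld s \<Longrightarrow> inverse x \<in> fld s"
  using inverse_E by (auto simp: fld_def power_inverse)

lemma zero_fld: "0 \<in> fld s"
  using diff_E[OF one_E one_E] p_gt_1 by (auto simp: fld_def)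

lemma one_fld: "1 \<in> fld s"
  using one_E by (auto simp: fld_def)

lemma fld_iterate: "x \<in> fld s \<Longrightarrow> x \<in> fld (s * k)"
  by (induction k) (auto simp: fld_def power_add power_mult)

lemma fld_power_card:
  assumes s: "s > 0" and x: "x \<in> fld s"
  shows "x ^ card (fld s) = x"
proof (cases "x = 0")
  case True
  then show ?thesis using finite_fld[OF s] x by (simp add: card_gt_0_iff) (metis card_eq_0_iff empty_iff power_0_left)
next
  case False
  let ?U = "fld s - {0}"
  have fU: "finite ?U" using finite_fld[OF s] by simp
  have bij: "bij_betw (\<lambda>y. x * y) ?U ?U"
  proof (rule bij_betw_byWitness[of _ "\<lambda>y. inverse x * y"])
    show "(\<lambda>y. x * y) ` ?U \<subseteq> ?U" "(\<lambda>y. inverse x * y) ` ?U \<subseteq> ?U"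
      using False x mult_fld inverse_fld by auto
  qed (use False in \<open>simp_all flip: mult.assoc\<close>)
  have "prod (\<lambda>y. x * y) ?U = prod (\<lambda>y. y) ?U" by (rule prod.reindex_bij_betw[OF bij])
  then have "x ^ card ?U * prod (\<lambda>y. y) ?U = prod (\<lambda>y. y) ?U" by (simp add: prod.distrib)
  moreover have "prod (\<lambda>y. y) ?U \<noteq> 0" using fU by simp
  ultimately have "x ^ card ?U = 1" by simp
  moreover have "card (fld s) = Suc (card ?U)"
    using card.remove[OF finite_fld[OF s] zero_fld] .
  ultimately show ?thesis by simp
qed

text \<open>
  If \<open>r\<close> is the remainder of \<open>d\<close> modulo \<open>a\<close>, then the elements of \<open>fld a\<close> are fixed by the \<open>r\<close>-th power
  of the Frobenius map, and there are too many of them unless \<open>r = 0\<close>.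
\<close>

lemma realised_degree_dvd:
  assumes "realised_degree a" "d > 0" "fld a \<subseteq> fld d"
  shows "a dvd d"
proof (rule ccontr)
  assume "\<not> a dvd d"
  then have r: "d mod a > 0" "d mod a < a" using assms(1) by (auto simp: realised_degree_def mod_greater_zero_iff_not_dvd)
  have "fld a \<subseteq> fld (d mod a)"
  proof
    fix x assume x: "x \<in> fld a"
    have "x ^ (p ^ d) = (x ^ (p ^ (a * (d div a)))) ^ (p ^ (d mod a))"
      by (simp flip: power_mult power_add)
    also have "x ^ (p ^ (a * (d div a))) = x" using fld_iterate[OF x] by (simp add: fld_def)
    finally show "x \<in> fld (d mod a)" using x assms(3) by (auto simp: fld_def)
  qed
  then have "card (fld a) \<le> card (fld (d mod a))" by (rule card_mono[OF finite_fld[OF r(1)]])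
  also have "\<dots> \<le> p ^ (d mod a)" by (rule card_fld_le[OF r(1)])
  also have "\<dots> < p ^ a" by (rule power_strict_increasing[OF r(2) p_gt_1])
  finally show False using assms(1) by (simp add: realised_degree_def)
qed

text \<open>
  The finite field \<open>fld s\<close> has \<open>p ^ d\<close> elements for some \<open>d\<close>, and all of them are roots of
  \<open>x ^ (p ^ d) - x\<close>.
\<close>

lemma fld_eq_realised:
  assumes s: "s > 0"
  obtains d where "realised_degree d" "d dvd s" "fld s = fld d"
proof -
  obtain d where d: "card (fld s) = p ^ d"
    using card_additive_subgroup[OF prime_p[folded CHAR], unfolded CHAR, OF finite_fld[OF s] zero_fld diff_fld] by blast
  have "{0, 1} \<subseteq> fld s" using zero_fld one_fld by simp
  then have "card {0, 1::'a} \<le> card (fld s)" by (rule card_mono[OF finite_fld[OF s]])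
  then have d0: "d > 0" using d by (cases d) auto
  have sub: "fld s \<subseteq> fld d"
    using fld_power_card[OF s] d by (auto simp: fld_def)
  have "card (fld d) \<le> card (fld s)" using card_fld_le[OF d0] d by simp
  then have eq: "fld s = fld d" using card_seteq[OF finite_fld[OF d0] sub] by simp
  then have "realised_degree d" using d d0 by (simp add: realised_degree_def)
  moreover from this have "d dvd s" by (rule realised_degree_dvd) (use s eq in auto)
  ultimately show ?thesis using that eq by blast
qed

definition covered :: "nat \<Rightarrow> bool" where
  "covered m \<longleftrightarrow> (\<exists>d. realised_degree d \<and> m dvd d)"

lemma covered_common_multiple:
  assumes "finite P" "\<And>m. m \<in> P \<Longrightarrow> covered m"
  shows "\<exists>d. realised_degree d \<and> (\<forall>m\<in>P. m dvd d)"
  using assms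
proof (induction P rule: finite_induct)
  case empty
  from fld_eq_realised[of 1] show ?case by auto
next
  case (insert m P)
  then obtain a b where a: "realised_degree a" "\<forall>m\<in>P. m dvd a" and b: "realised_degree b" "m dvd b"
    unfolding covered_def by blast
  have ab: "a * b > 0" using a b by (simp add: realised_degree_def)
  from fld_eq_realised[OF ab] obtain d where d: "realised_degree d" "fld (a * b) = fld d" by metis
  have "a dvd d"
    using a(1) d fld_iterate[of _ a b] by (intro realised_degree_dvd) (auto simp: realised_degree_def)
  moreover have "b dvd d"
    using b(1) d fld_iterate[of _ b a] by (intro realised_degree_dvd) (auto simp: realised_degree_def mult.commute)
  ultimately show ?case using a b d(1) by (intro exI[of _ d]) (auto intro: dvd_trans)
qed

lemma covered_if_prime_powers:
  assumes "n > 0" "\<And>q e. prime q \<Longrightarrow> q dvd n \<Longrightarrow> covered (q ^ e)"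
  shows "covered n"
proof -
  let ?P = "(\<lambda>q. q ^ multiplicity q n) ` prime_factors n"
  have "\<exists>d. realised_degree d \<and> (\<forall>m\<in>?P. m dvd d)"
    by (rule covered_common_multiple) (use assms in \<open>auto simp: in_prime_factors_iff\<close>)
  then obtain d where d: "realised_degree d" "\<And>q. q \<in> prime_factors n \<Longrightarrow> q ^ multiplicity q n dvd d"
    by blast
  have "n dvd d"
  proof (rule multiplicity_le_imp_dvd)
    show "n \<noteq> 0" using assms by simp
    fix q :: nat assume q: "prime q"
    show "multiplicity q n \<le> multiplicity q d"
    proof (cases "q dvd n")
      case True
      then have "q ^ multiplicity q n dvd d" using q assms by (intro d(2)) (simp add: in_prime_factors_iff)
      then show ?thesis using d(1) q
        by (intro multiplicity_geI) (auto simp: realised_degree_def)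
    qed (simp add: not_dvd_imp_multiplicity_0)
  qed
  then show ?thesis using d(1) by (auto simp: covered_def)
qed

text \<open>
  Let \<open>s\<close> be a realised degree. On the finite set \<open>fld s\<close> the map \<open>x \<mapsto> x ^ p - x\<close> is not injective,
  hence misses some \<open>c\<close>. A root \<open>x\<close> in \<open>E\<close> of \<open>x ^ p - x = c\<close> satisfies \<open>x ^ (p ^ s) = x + T\<close>, where \<open>T\<close> is
  the absolute trace of \<open>c\<close>. Hence \<open>x ^ (p ^ (s * p)) = x + p T = x\<close>, and the degree \<open>s * p\<close> is
  realised.
\<close>

lemma covered_power_CHAR: "covered (p ^ e)"
proof (induction e)
  case 0
  from fld_eq_realised[of 1] show ?case by (auto simp: covered_def)
next
  case (Suc e)
  then obtain s where s: "realised_degree s" "p ^ e dvd s" unfolding covered_def by blast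
  then have s0: "s > 0" by (simp add: realised_degree_def)
  let ?w = "\<lambda>x::'a. x ^ p - x"
  have pow: "x ^ p \<in> fld s" if "x \<in> fld s" for x
    using that power_commuting_commutes[of x] by (auto simp: fld_def power_E power_mult[symmetric])
      (simp add: mult.commute[of p] power_mult)
  have "?w ` fld s \<subseteq> fld s" using pow diff_fld by blast
  moreover have "\<not> inj_on ?w (fld s)"
  proof
    assume "inj_on ?w (fld s)"
    moreover have "?w 0 = ?w 1" using p_gt_1 by simp
    ultimately have "0 = (1::'a)" using zero_fld one_fld by (rule inj_onD)
    then show False by simp
  qed
  ultimately have "?w ` fld s \<noteq> fld s" "?w ` fld s \<subseteq> fld s"
    using finite_surj_inj[OF finite_fld[OF s0], of ?w] by auto
  then obtain c where c: "c \<in> fld s" "c \<notin> ?w ` fld s" by blast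
  from Artin_Schreier[of c] c(1) obtain x where x: "x \<in> E" "?w x = c" by (auto simp: fld_def)
  define T where "T i = (\<Sum>j<i. c ^ (p ^ j))" for i
  note step = power_add_frobenius
  have xp: "x ^ (p ^ i) = x + T i" for i
  proof (induction i)
    case (Suc i)
    have "x ^ (p ^ Suc i) = (x + c) ^ (p ^ i)"
      using x(2) by (simp add: power_mult algebra_simps)
    also have "\<dots> = x + T (Suc i)" using Suc step by (simp add: T_def)
    finally show ?case .
  qed (simp add: T_def)
  have Tp: "T s ^ p = T s"
  proof -
    have "T i ^ p = T i - c + c ^ (p ^ i)" for i
    proof (induction i)
      case (Suc i)
      then show ?case using step[of "T i" "c ^ (p ^ i)" 1]
        by (simp add: T_def mult.commute flip: power_mult)
    qed (use p_gt_1 in \<open>simp add: T_def\<close>)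
    then show ?thesis using c(1) by (simp add: fld_def)
  qed
  have Tq: "T s ^ (p ^ i) = T s" for i
    by (induction i) (simp_all add: power_mult Tp)
  have nat_q: "of_nat k ^ (p ^ i) = (of_nat k :: 'a)" for k i
    using p_gt_1 by (induction k) (simp_all add: step)
  have xs: "x ^ (p ^ (s * k)) = x + of_nat k * T s" for k
  proof (induction k)
    case (Suc k)
    have "x ^ (p ^ (s * Suc k)) = (x + of_nat k * T s) ^ (p ^ s)"
      by (simp add: power_add mult.commute flip: Suc power_mult)
    also have "\<dots> = x + of_nat (Suc k) * T s"
      by (simp add: step power_mult_distrib nat_q Tq xp algebra_simps)
    finally show ?case .
  qed simp
  have "of_nat p = (0::'a)" using of_nat_CHAR[where 'a = 'a] CHAR by simp
  then have xin: "x \<in> fld (s * p)" using x(1) xs[of p] by (simp add: fld_def)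
  have xnot: "x \<notin> fld s" using c(2) x(2) by blast
  have sp: "s * p > 0" using s0 p_gt_1 by simp
  from fld_eq_realised[OF sp] obtain d where d: "realised_degree d" "d dvd s * p" "fld (s * p) = fld d" .
  have "s dvd d"
    using s(1) d fld_iterate[of _ s p] by (intro realised_degree_dvd) (auto simp: realised_degree_def)
  then obtain k where k: "d = s * k" by blast
  then have "k dvd p" using d(2) s0 by simp
  moreover have "k \<noteq> 1" using k xin xnot d(3) by auto
  ultimately have "k = p" using prime_p by (auto simp: prime_nat_iff)
  then have "p ^ Suc e dvd d" using k s(2) by (simp add: mult.commute mult_dvd_mono)
  then show ?case using d(1) by (auto simp: covered_def)
qed

text \<open>
  Since roots can be extracted, \<open>E\<close> contains roots of unity of order \<open>r ^ (k + 1)\<close> for every \<open>k\<close>. The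
  degree \<open>d\<close> of the field generated by one of them divides \<open>r ^ k * (r - 1)\<close> and satisfies
  \<open>r ^ (k + 1) < p ^ d\<close>. If the power of \<open>r\<close> dividing \<open>d\<close> were less than \<open>r ^ e\<close>, then \<open>d\<close> would be at most
  \<open>r ^ e\<close>, which is impossible for large \<open>k\<close>.
\<close>

lemma covered_power_of_root_order:
  assumes r: "prime r" "r \<noteq> p" and \<zeta>: "\<zeta> \<in> E" "\<zeta> ^ r = 1" "\<zeta> \<noteq> 1"
  shows "covered (r ^ e)"
proof -
  \<comment> \<open>Any \<open>k\<close> with \<open>p ^ (r ^ e) \<le> r ^ (k + 1)\<close> would do.\<close>
  define k where "k = p ^ (r ^ e)"
  have r1: "r > 1" by (rule prime_gt_1_nat[OF r(1)])
  obtain \<xi> where \<xi>: "\<xi> \<in> E" "\<xi> ^ (r ^ k) = \<zeta>" using radicals[of "r ^ k" \<zeta>] \<zeta>(1) r1 by auto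
  have "r ^ Suc k = r ^ k * r" by simp
  then have \<xi>r: "\<xi> ^ (r ^ Suc k) = 1" using \<xi>(2) \<zeta>(2) by (simp only: power_mult)
  have cop: "coprime p (r ^ Suc k)"
    using primes_coprime[OF prime_p r(1)] r(2) by simp
  define s where "s = totient (r ^ Suc k)"
  have s: "s = r ^ k * (r - 1)" using totient_prime_power_Suc[OF r(1)] by (simp add: s_def)
  have s0: "s > 0" using s r1 by simp
  have "[p ^ s = 1] (mod r ^ Suc k)" unfolding s_def by (rule euler_theorem[OF cop])
  then have "r ^ Suc k dvd p ^ s - 1"
    using p_gt_1 by (simp add: cong_altdef_nat cong_sym)
  then have "\<xi> ^ (p ^ s - 1) = 1" using \<xi>r by (auto simp: power_mult elim!: dvdE)
  then have "\<xi> * \<xi> ^ (p ^ s - 1) = \<xi>" by simp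
  then have "\<xi> \<in> fld s" using \<xi>(1) p_gt_1 by (simp add: fld_def flip: power_Suc)
  moreover from fld_eq_realised[OF s0] obtain d where
    d: "realised_degree d" "d dvd s" "fld s = fld d" .
  ultimately have "\<xi> \<in> fld d" by simp
  then have "\<xi> ^ (p ^ d) = \<xi>" by (simp add: fld_def)
  moreover have \<xi>0: "\<xi> \<noteq> 0" using \<xi>r r1 by (auto simp: power_0_left)
  moreover have "p ^ d = Suc (p ^ d - 1)" using p_gt_1 by simp
  ultimately have \<xi>d: "\<xi> ^ (p ^ d - 1) = 1" by (metis mult_cancel_left2 power_Suc)
  have pd: "p ^ d - 1 > 0"
    using one_less_power[OF p_gt_1, of d] d(1) by (simp add: realised_degree_def)
  obtain u v where uv: "r ^ Suc k * u = (p ^ d - 1) * v + gcd (r ^ Suc k) (p ^ d - 1)"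
    using bezout_nat[of "r ^ Suc k" "p ^ d - 1"] r1 by auto
  have "\<xi> ^ (r ^ Suc k * u) = 1" "\<xi> ^ ((p ^ d - 1) * v) = 1"
    using \<xi>r \<xi>d by (simp_all only: power_mult power_one)
  then have \<xi>g: "\<xi> ^ gcd (r ^ Suc k) (p ^ d - 1) = 1" unfolding uv by (simp add: power_add)
  have "gcd (r ^ Suc k) (p ^ d - 1) dvd r ^ Suc k" by simp
  then obtain j where j: "j \<le> Suc k" "gcd (r ^ Suc k) (p ^ d - 1) = r ^ j"
    using divides_primepow_nat[OF r(1)] by blast
  have "j = Suc k"
  proof (rule ccontr)
    assume "j \<noteq> Suc k"
    then have "r ^ j dvd r ^ k" using j(1) by (intro le_imp_power_dvd) simp
    then have "\<xi> ^ (r ^ k) = 1" using \<xi>g j(2) by (auto simp: power_mult elim!: dvdE)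
    then show False using \<xi>(2) \<zeta>(3) by simp
  qed
  then have "r ^ Suc k dvd p ^ d - 1" using j(2) by (metis gcd_dvd2)
  then have big: "r ^ Suc k \<le> p ^ d - 1" using pd by (rule dvd_imp_le)
  have "r ^ e dvd d"
  proof (rule ccontr)
    assume nd: "\<not> r ^ e dvd d"
    have d0: "d \<noteq> 0" using d(1) by (simp add: realised_degree_def)
    obtain w where w: "d = r ^ multiplicity r d * w" "\<not> r dvd w"
      using multiplicity_decompose'[of d r] d0 r1 by auto
    have me: "multiplicity r d < e"
      using nd d0 r1 by (metis leI multiplicity_dvd' )
    have "coprime w (r ^ k)" using w(2) r(1) by (simp add: prime_imp_coprime coprime_commute)
    moreover have "w dvd r ^ k * (r - 1)" using d(2) w(1) s by (metis dvd_mult_right)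
    ultimately have "w dvd r - 1" by (simp add: coprime_dvd_mult_right_iff)
    then have "w \<le> r" using r1 by (auto dest!: dvd_imp_le)
    moreover have "r ^ multiplicity r d \<le> r ^ (e - 1)" using me r1 by (intro power_increasing) auto
    ultimately have "d \<le> r ^ (e - 1) * r" using w(1) mult_le_mono by metis
    also have "\<dots> = r ^ e" using me by (metis Suc_pred' mult.commute not_less0 not_gr_zero power_Suc)
    finally have "p ^ d \<le> p ^ (r ^ e)" using p_gt_1 by (intro power_increasing) auto
    then have "r ^ Suc k \<le> k" using big by (simp add: k_def)
    moreover have "Suc k < r ^ Suc k" using power_gt_expt[of r "Suc k"] r1 by simp
    ultimately show False by simp
  qed
  then show ?thesis using d(1) by (auto simp: covered_def)
qed

text \<open>
  Induction on \<open>r\<close>. The prime factors of \<open>r - 1\<close> are smaller than \<open>r\<close>, so by the two preceding lemmas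
  all their powers divide degrees of finite subfields of \<open>E\<close>. Hence some such degree \<open>d\<close> is a
  multiple of \<open>r - 1\<close>, and \<open>r\<close> divides \<open>p ^ d - 1\<close> by Fermat's theorem.
\<close>

theorem primitive_root_of_unity:
  assumes "prime r" "r \<noteq> p"
  shows "\<exists>\<zeta>\<in>E. \<zeta> ^ r = 1 \<and> \<zeta> \<noteq> 1"
  using assms
proof (induction r rule: less_induct)
  case (less r)
  have r1: "r > 1" by (rule prime_gt_1_nat[OF less.prems(1)])
  have "covered (r - 1)"
  proof (rule covered_if_prime_powers)
    show "r - 1 > 0" using r1 by simp
    fix q e :: nat assume q: "prime q" "q dvd r - 1"
    then have qr: "q < r" using r1 by (auto dest!: dvd_imp_le)
    show "covered (q ^ e)"
    proof (cases "q = p")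
      case True
      then show ?thesis by (simp add: covered_power_CHAR)
    next
      case False
      with less.IH[OF qr q(1)] obtain \<zeta> where "\<zeta> \<in> E" "\<zeta> ^ q = 1" "\<zeta> \<noteq> 1" by blast
      then show ?thesis by (rule covered_power_of_root_order[OF q(1) False])
    qed
  qed
  then obtain d where d: "realised_degree d" "r - 1 dvd d" unfolding covered_def by blast
  then have d0: "d > 0" and card: "card (fld d) = p ^ d" by (simp_all add: realised_degree_def)
  have "\<not> r dvd p" using primes_dvd_imp_eq[OF less.prems(1) prime_p] less.prems(2) by blast
  then have "[p ^ (r - 1) = 1] (mod r)" by (rule fermat_theorem[OF less.prems(1)])
  then have "[p ^ d = 1] (mod r)"
    using d(2) cong_pow[of "p ^ (r - 1)" 1 r] by (auto simp: power_mult elim!: dvdE)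
  then have "r dvd p ^ d - 1" using p_gt_1 by (simp add: cong_altdef_nat cong_sym)
  then obtain m where m: "p ^ d - 1 = m * r" by (metis dvdE mult.commute)
  have pd: "p ^ d > 1" by (rule one_less_power[OF p_gt_1 d0])
  have m0: "m > 0" using m pd by (cases m) auto
  let ?U = "fld d - {0}"
  have fU: "finite ?U" and cU: "card ?U = m * r"
    using finite_fld[OF d0] card zero_fld m by simp_all
  have "\<exists>x\<in>?U. x ^ m \<noteq> 1"
  proof (rule ccontr)
    assume "\<not> ?thesis"
    then have sub: "?U \<subseteq> {x \<in> E. poly (Polynomial.monom 1 m) x = 1}" by (auto simp: fld_def poly_monom)
    have "card ?U \<le> card {x \<in> E. poly (Polynomial.monom 1 m) x = 1}"
      by (rule card_mono[OF _ sub], rule poly_fibre) (use m0 in \<open>simp add: degree_monom_eq\<close>)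
    also have "\<dots> \<le> degree (Polynomial.monom (1::'a) m)" by (rule poly_fibre) (use m0 in \<open>simp add: degree_monom_eq\<close>)
    also have "\<dots> = m" by (simp add: degree_monom_eq)
    finally show False using cU m0 r1 by simp
  qed
  then obtain x where x: "x \<in> fld d" "x \<noteq> 0" "x ^ m \<noteq> 1" by blast
  have "p ^ d = Suc (m * r)" using m pd by linarith
  then have "x * x ^ (m * r) = x" using x(1) by (simp add: fld_def)
  then have "(x ^ m) ^ r = 1" using x(2) by (simp add: power_mult)
  then show ?case using x power_E[of x m] by (auto simp: fld_def)
qed

end

section \<open>Field morphisms, roots of unity and linear functionals\<close>

context
  fixes \<tau> :: "'a::field \<Rightarrow> 'a"
  assumes \<tau>: "field_morphism \<tau>"
begin

lemma morphism_0: "\<tau> 0 = 0"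
  and morphism_1: "\<tau> 1 = 1"
  and morphism_add: "\<tau> (x + y) = \<tau> x + \<tau> y"
  and morphism_mult: "\<tau> (x * y) = \<tau> x * \<tau> y"
  using \<tau> by (auto simp: field_morphism_def)

lemma morphism_uminus: "\<tau> (- x) = - \<tau> x"
  using morphism_add[of x "- x"] by (simp add: morphism_0 eq_neg_iff_add_eq_0 add.commute)

lemma morphism_diff: "\<tau> (x - y) = \<tau> x - \<tau> y"
  using morphism_add[of x "- y"] by (simp add: morphism_uminus)

lemma morphism_eq_0: "\<tau> x = 0 \<longleftrightarrow> x = 0"
  using morphism_mult[of x "inverse x"] by (cases "x = 0") (auto simp: morphism_0 morphism_1)

lemma morphism_inject: "\<tau> x = \<tau> y \<longleftrightarrow> x = y"
  using morphism_eq_0[of "x - y"] by (simp add: morphism_diff)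

lemma morphism_inverse: "\<tau> (inverse x) = inverse (\<tau> x)"
proof (cases "x = 0")
  case False
  then have "\<tau> x * \<tau> (inverse x) = 1" using morphism_mult[of x "inverse x"] by (simp add: morphism_1)
  then show ?thesis by (rule inverse_unique[symmetric])
qed (simp add: morphism_0)

lemma morphism_power: "\<tau> (x ^ n) = \<tau> x ^ n"
  by (induction n) (simp_all add: morphism_1 morphism_mult)

lemma morphism_sum: "\<tau> (sum f A) = (\<Sum>x\<in>A. \<tau> (f x))"
  by (induction A rule: infinite_finite_induct) (simp_all add: morphism_0 morphism_add)

lemma morphism_of_nat: "\<tau> (of_nat n) = of_nat n"
  by (induction n) (simp_all add: morphism_0 morphism_1 morphism_add)

lemma morphism_funpow: "field_morphism (\<tau> ^^ n)"
  by (induction n) (auto simp: field_morphism_def morphism_0 morphism_1 morphism_add morphism_mult)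

end

lemma frobenius_add:
  assumes "CHAR('a::field) = p" "prime p"
  shows "(x + y :: 'a) ^ p = x ^ p + y ^ p"
  by (rule freshmans_dream) (simp_all only: assms)

lemma frobenius_diff:
  assumes "CHAR('a::field) = p" "prime p"
  shows "(x - y :: 'a) ^ p = x ^ p - y ^ p"
proof -
  have "(x - y + y) ^ p = (x - y) ^ p + y ^ p" by (rule frobenius_add[OF assms])
  then have "x ^ p - y ^ p = (x - y) ^ p + y ^ p - y ^ p" unfolding diff_add_cancel by (rule arg_cong)
  then show ?thesis unfolding add_diff_cancel_right' by (rule sym)
qed

lemma root_of_unity_trivial:
  fixes \<zeta> :: "'a::field"
  assumes "\<zeta> ^ m = 1" "\<zeta> ^ n = 1" "coprime m n" "m > 0"
  shows "\<zeta> = 1"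
proof -
  obtain u v where "m * u = n * v + gcd m n" using bezout_nat[of m n] assms(4) by auto
  then have "m * u = n * v + 1" using coprime_imp_gcd_eq_1[OF assms(3)] by simp
  then have "\<zeta> ^ (m * u) = \<zeta> ^ (n * v) * \<zeta>" by simp
  then show ?thesis using assms(1,2) by (simp add: power_mult)
qed

lemma roots_of_unity_powers:
  fixes \<zeta> \<omega> :: "'a::field"
  assumes r: "prime r" and \<zeta>: "\<zeta> ^ r = 1" "\<zeta> \<noteq> 1" and \<omega>: "\<omega> ^ r = 1"
  obtains k where "\<omega> = \<zeta> ^ k"
proof -
  have r0: "r > 0" by (rule prime_gt_0_nat[OF r])
  have \<zeta>0: "\<zeta> \<noteq> 0" using \<zeta>(1) r0 by (auto simp: power_0_left)
  have less: "k = l" if "k < r" "l < r" "\<zeta> ^ k = \<zeta> ^ l" "k \<le> l" for k l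
  proof (rule ccontr)
    assume "k \<noteq> l"
    then have kl: "0 < l - k" "l - k < r" using that by auto
    have "\<zeta> ^ k * \<zeta> ^ (l - k) = \<zeta> ^ l" using that(4) by (simp flip: power_add)
    then have "\<zeta> ^ k * \<zeta> ^ (l - k) = \<zeta> ^ k * 1" using that(3) by simp
    then have "\<zeta> ^ (l - k) = 1" using \<zeta>0 by simp
    moreover have "coprime (l - k) r"
      using r kl by (metis coprime_commute nat_dvd_not_less prime_imp_coprime)
    ultimately show False using root_of_unity_trivial[of \<zeta> "l - k" r] \<zeta> kl by blast
  qed
  have "inj_on (\<lambda>k. \<zeta> ^ k) {..<r}"
  proof (rule inj_onI)
    fix k l assume "k \<in> {..<r}" "l \<in> {..<r}" "\<zeta> ^ k = \<zeta> ^ l"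
    then show "k = l" using less[of k l] less[of l k] by (cases "k \<le> l") auto
  qed
  then have card: "card ((\<lambda>k. \<zeta> ^ k) ` {..<r}) = r" by (simp add: card_image)
  let ?R = "{z \<in> UNIV. poly (Polynomial.monom 1 r) z = (1::'a)}"
  have R: "finite ?R" "card ?R \<le> r"
    using poly_fibre[of "Polynomial.monom (1::'a) r" UNIV 1] r0 by (simp_all add: degree_monom_eq)
  have "(\<zeta> ^ k) ^ r = 1" for k using \<zeta>(1) by (metis mult.commute power_mult power_one)
  then have "(\<lambda>k. \<zeta> ^ k) ` {..<r} \<subseteq> ?R" by (auto simp: poly_monom)
  then have "(\<lambda>k. \<zeta> ^ k) ` {..<r} = ?R" using R card by (intro card_seteq) auto
  moreover have "\<omega> \<in> ?R" using \<omega> by (simp add: poly_monom)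
  ultimately have "\<omega> \<in> (\<lambda>k. \<zeta> ^ k) ` {..<r}" by simp
  then show ?thesis using that by blast
qed

lemma fixed_by_frobenius:
  fixes w :: "'a::field"
  assumes p: "prime p" "CHAR('a) = p" and w: "w ^ p = w"
  obtains n where "w = of_nat n"
proof -
  have p1: "p > 1" by (rule prime_gt_1_nat[OF p(1)])
  let ?q = "Polynomial.monom 1 p + [:0, - 1:] :: 'a poly"
  have deg: "degree ?q = p" using p1 by (subst degree_add_eq_left) (auto simp: degree_monom_eq)
  let ?R = "{z \<in> UNIV. poly ?q z = 0}"
  have R: "finite ?R" "card ?R \<le> p"
    using poly_fibre[of ?q UNIV 0] p1 by (simp_all only: deg)
  have "inj_on (of_nat :: nat \<Rightarrow> 'a) {..<p}"
    by (rule inj_onI) (auto simp: of_nat_eq_iff_cong_CHAR p cong_less_modulus_unique_nat)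
  then have card: "card ((of_nat :: nat \<Rightarrow> 'a) ` {..<p}) = p" by (simp add: card_image)
  have "of_nat n ^ p = (of_nat n :: 'a)" for n
  proof (induction n)
    case (Suc n)
    then show ?case using frobenius_add[OF p(2,1), of 1 "of_nat n"] by simp
  qed (use p1 in simp)
  then have "(of_nat :: nat \<Rightarrow> 'a) ` {..<p} \<subseteq> ?R" by (auto simp: poly_monom)
  then have "(of_nat :: nat \<Rightarrow> 'a) ` {..<p} = ?R" using R card by (intro card_seteq) auto
  moreover have "w \<in> ?R" using w by (simp add: poly_monom)
  ultimately have "w \<in> (of_nat :: nat \<Rightarrow> 'a) ` {..<p}" by simp
  then show ?thesis using that by blast
qed

text \<open>
  The statement that a functional vanishing on the common kernel of \<open>g\<^sub>0, \<dots>, g\<^sub>n\<^sub>-\<^sub>1\<close> is a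
  combination of them, for a subfield \<open>F\<close> and a space \<open>V\<close> given as subsets of a larger field.
\<close>

lemma functional_in_span:
  fixes V F :: "'a::field set" and g :: "nat \<Rightarrow> 'a \<Rightarrow> 'a"
  assumes F: "0 \<in> F" "\<And>c d. c \<in> F \<Longrightarrow> d \<in> F \<Longrightarrow> c - d \<in> F" "\<And>c d. c \<in> F \<Longrightarrow> d \<in> F \<Longrightarrow> c * d \<in> F"
      "\<And>c. c \<in> F \<Longrightarrow> inverse c \<in> F"
    and V: "\<And>x y. x \<in> V \<Longrightarrow> y \<in> V \<Longrightarrow> x - y \<in> V" "\<And>c x. c \<in> F \<Longrightarrow> x \<in> V \<Longrightarrow> c * x \<in> V"
    and lin: "\<And>g. lin g \<longleftrightarrow> (\<forall>x\<in>V. g x \<in> F) \<and> (\<forall>x\<in>V. \<forall>y\<in>V. g (x - y) = g x - g y) \<and>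
        (\<forall>c\<in>F. \<forall>x\<in>V. g (c * x) = c * g x)"
    and g: "\<And>j. j < n \<Longrightarrow> lin (g j)" and h: "lin h"
    and ker: "\<And>x. x \<in> V \<Longrightarrow> (\<And>j. j < n \<Longrightarrow> g j x = 0) \<Longrightarrow> h x = 0"
  shows "\<exists>c. (\<forall>j<n. c j \<in> F) \<and> (\<forall>x\<in>V. h x = (\<Sum>j<n. c j * g j x))"
  using g h ker
proof (induction n arbitrary: h)
  case 0
  then show ?case by simp
next
  case (Suc n)
  show ?case
  proof (cases "\<forall>x\<in>V. (\<forall>j<n. g j x = 0) \<longrightarrow> g n x = 0")
    case True
    have "\<exists>c. (\<forall>j<n. c j \<in> F) \<and> (\<forall>x\<in>V. h x = (\<Sum>j<n. c j * g j x))"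
    proof (rule Suc.IH)
      show "lin (g j)" if "j < n" for j using Suc.prems(1) that by simp
      show "lin h" by (rule Suc.prems(2))
      show "h x = 0" if "x \<in> V" "\<And>j. j < n \<Longrightarrow> g j x = 0" for x
        using that True by (intro Suc.prems(3)) (auto simp: less_Suc_eq)
    qed
    then obtain c where c: "\<forall>j<n. c j \<in> F" "\<forall>x\<in>V. h x = (\<Sum>j<n. c j * g j x)" by blast
    then show ?thesis using F(1) by (intro exI[of _ "c(n := 0)"]) (auto simp: less_Suc_eq)
  next
    case False
    then obtain u where u: "u \<in> V" "\<forall>j<n. g j u = 0" "g n u \<noteq> 0" by blast
    have lg: "\<And>j x. j \<le> n \<Longrightarrow> x \<in> V \<Longrightarrow> g j x \<in> F"
      "\<And>j x y. j \<le> n \<Longrightarrow> x \<in> V \<Longrightarrow> y \<in> V \<Longrightarrow> g j (x - y) = g j x - g j y"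
      "\<And>j c x. j \<le> n \<Longrightarrow> c \<in> F \<Longrightarrow> x \<in> V \<Longrightarrow> g j (c * x) = c * g j x"
      using Suc.prems(1) unfolding lin by (auto simp: less_Suc_eq_le)
    have lh: "\<And>x. x \<in> V \<Longrightarrow> h x \<in> F" "\<And>x y. x \<in> V \<Longrightarrow> y \<in> V \<Longrightarrow> h (x - y) = h x - h y"
      "\<And>c x. c \<in> F \<Longrightarrow> x \<in> V \<Longrightarrow> h (c * x) = c * h x"
      using Suc.prems(2) unfolding lin by auto
    define v where "v = inverse (g n u) * u"
    have i: "inverse (g n u) \<in> F" using F(4) lg(1) u(1) by blast
    have v: "v \<in> V" "\<forall>j<n. g j v = 0" "g n v = 1"
      using u i V(2) lg(3) by (auto simp: v_def)
    define h' where "h' x = h x - h v * g n x" for x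
    have "\<exists>c. (\<forall>j<n. c j \<in> F) \<and> (\<forall>x\<in>V. h' x = (\<Sum>j<n. c j * g j x))"
    proof (rule Suc.IH)
      show "lin (g j)" if "j < n" for j using Suc.prems(1) that by simp
      show "lin h'"
        unfolding lin
      proof (intro conjI ballI)
        show "h' x \<in> F" if "x \<in> V" for x
          unfolding h'_def using that lh(1) lg(1) v(1) by (intro F(2) F(3)) auto
        show "h' (x - y) = h' x - h' y" if "x \<in> V" "y \<in> V" for x y
          using that by (simp add: h'_def lh(2) lg(2) right_diff_distrib)
        show "h' (c * x) = c * h' x" if "c \<in> F" "x \<in> V" for c x
          using that by (simp add: h'_def lh(3) lg(3) right_diff_distrib mult.left_commute)
      qed
      fix x assume x: "x \<in> V" "\<And>j. j < n \<Longrightarrow> g j x = 0"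
      have gx: "g n x \<in> F" using lg(1) x(1) by simp
      then have gv: "g n x * v \<in> V" using V(2) v(1) by blast
      have "h (x - g n x * v) = 0"
      proof (rule Suc.prems(3))
        show "x - g n x * v \<in> V" using V(1) x(1) gv by blast
        show "g j (x - g n x * v) = 0" if "j < Suc n" for j
          using that x gx gv v lg(2)[of j x "g n x * v"] lg(3)[of j "g n x" v]
          by (cases "j = n") auto
      qed
      then show "h' x = 0"
        using lh(2)[OF x(1) gv] lh(3)[OF gx v(1)] by (simp add: h'_def mult.commute)
    qed
    then obtain c where c: "\<forall>j<n. c j \<in> F" "\<forall>x\<in>V. h' x = (\<Sum>j<n. c j * g j x)" by blast
    have "h x = (\<Sum>j<Suc n. (c(n := h v)) j * g j x)" if "x \<in> V" for x
      using c(2) that by (simp add: h'_def diff_eq_eq)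
    then show ?thesis using c(1) lh(1)[OF v(1)]
      by (intro exI[of _ "c(n := h v)"]) (auto simp: less_Suc_eq)
  qed
qed

section \<open>Definable morphisms that fix an element of infinite order\<close>

text \<open>
  In positive characteristic an element whose powers are pairwise distinct is the same as an element
  transcendental over the prime field. Once it is a parameter, every definable field containing it
  has infinitely many definable points.
\<close>

locale small_field_with_transcendental =
  fixes L :: "('f field_sym, 'r) language"
    and K :: "('a::field, 'f field_sym, 'r) struc"
    and p :: nat and t :: 'a
  assumes expands: "expands_field L K"
    and small: "small L K"
    and CHAR: "CHAR('a) = p"
    and prime_p: "prime p"
    and powers_t: "inj (\<lambda>n. t ^ n)"
begin

definition definable_morphism :: "('a \<Rightarrow> 'a) \<Rightarrow> bool" where
  "definable_morphism \<tau> \<longleftrightarrow> field_morphism \<tau> \<and> \<tau> t = t \<and>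
     (\<exists>ps. \<forall>qs. parametrised_field.dmap L K (ps @ qs) \<tau>)"

lemma parametrised: "parametrised_field L K"
  by unfold_locales (rule expands)

lemma definable_morphism_funpow:
  assumes "definable_morphism \<tau>"
  shows "definable_morphism (\<tau> ^^ n)"
proof -
  from assms obtain ps where ps: "\<And>qs. parametrised_field.dmap L K (ps @ qs) \<tau>"
    and \<tau>: "field_morphism \<tau>" "\<tau> t = t" unfolding definable_morphism_def by blast
  have "(\<tau> ^^ n) t = t" by (induction n) (simp_all add: \<tau>(2))
  moreover have "parametrised_field.dmap L K (ps @ qs) (\<tau> ^^ n)" for qs
    using parametrised_field.dmap_funpow[OF parametrised ps] .
  ultimately show ?thesis
    using morphism_funpow[OF \<tau>(1)] unfolding definable_morphism_def by blast
qed

context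
  fixes \<tau> assumes def: "definable_morphism \<tau>"
begin

lemma \<tau>: "field_morphism \<tau>"
  using def by (simp add: definable_morphism_def)

abbreviation F :: "'a set" where "F \<equiv> {x. \<tau> x = x}"

lemma \<tau>_with_parameters: "\<exists>ps. \<forall>qs. parametrised_field.dmap L K (ps @ qs) \<tau>"
  using def unfolding definable_morphism_def by blast

lemma fixed_field_definable: "\<exists>ps. definable_subfield L K (ps @ [t, c]) F"
proof -
  obtain ps where ps: "\<And>qs. parametrised_field.dmap L K (ps @ qs) \<tau>"
    using \<tau>_with_parameters by blast
  have t: "\<tau> t = t" using def by (simp add: definable_morphism_def)
  interpret parametrised_field L K "ps @ [t, c]" by (rule parametrised)
  have "definable_subfield L K (ps @ [t, c]) F"
  proof
    show "small L K" by (rule small)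
    show "dset F" using dset_fixed_points[OF ps[of "[t, c]"]] .
    have "range (\<lambda>n. t ^ n) \<subseteq> F \<inter> dpt"
      using t dpt_power[OF dpt_param[of t]] by (auto simp: morphism_power[OF \<tau>])
    then show "infinite (F \<inter> dpt)"
      using range_inj_infinite[OF powers_t] finite_subset by blast
  qed (simp_all add: morphism_1[OF \<tau>] morphism_diff[OF \<tau>] morphism_mult[OF \<tau>]
      morphism_inverse[OF \<tau>])
  then show ?thesis by (rule exI)
qed

lemma fixed_field_radically_closed: "radically_closed F p"
proof
  show "CHAR('a) = p" by (rule CHAR)
  show "prime p" by (rule prime_p)
next
  fix c assume c: "c \<in> F"
  obtain ps where "definable_subfield L K (ps @ [t, c]) F" using fixed_field_definable by blast
  then interpret definable_subfield L K "ps @ [t, c]" F .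
  have c': "c \<in> F \<inter> dpt" using c dpt_param[of c] by simp
  let ?q = "Polynomial.monom 1 p + [:0, - 1:] :: 'a poly"
  have p1: "p > 1" by (rule prime_gt_1_nat[OF prime_p])
  have deg: "degree ?q = p" using p1 by (subst degree_add_eq_left) (auto simp: degree_monom_eq)
  have eq: "poly ?q = (\<lambda>x. x ^ p - x)" by (simp add: fun_eq_iff poly_monom)
  have "poly ?q (x - y) = poly ?q x - poly ?q y" for x y
    unfolding eq frobenius_diff[OF CHAR prime_p] by simp
  moreover have "dmap (poly ?q)" unfolding eq by (intro dmap_diff dmap_power dmap_id)
  moreover have "poly ?q ` F \<subseteq> F"
    unfolding eq by (auto simp: morphism_diff[OF \<tau>] morphism_power[OF \<tau>])
  ultimately obtain x where "x \<in> F" "poly ?q x = c"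
    using additive_polynomial_surjective[of ?q c] c' p1 deg by (metis less_trans zero_less_one)
  then show "\<exists>x\<in>F. x ^ p - x = c" unfolding eq by blast
next
  fix n :: nat and c assume n: "0 < n" and c: "c \<in> F"
  obtain ps where "definable_subfield L K (ps @ [t, c]) F" using fixed_field_definable by blast
  then interpret definable_subfield L K "ps @ [t, c]" F .
  have "c \<in> F \<inter> dpt" using c dpt_param[of c] by simp
  then show "\<exists>x\<in>F. x ^ n = c" using power_map_surjective[OF n] by blast
qed (simp_all add: morphism_1[OF \<tau>] morphism_diff[OF \<tau>] morphism_mult[OF \<tau>]
      morphism_inverse[OF \<tau>])

text \<open>
  From \<open>\<tau> x = x + 1\<close> it follows that \<open>x ^ p - x\<close> is fixed, so it equals \<open>b ^ p - b\<close> with \<open>b\<close> fixed. Then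
  \<open>x - b\<close> lies in the prime field and is fixed, too.
\<close>

lemma no_unit_shift: "\<tau> x \<noteq> x + 1"
proof
  assume x: "\<tau> x = x + 1"
  interpret radically_closed F p by (rule fixed_field_radically_closed)
  have "\<tau> (x ^ p - x) = x ^ p - x"
    by (simp add: morphism_diff[OF \<tau>] morphism_power[OF \<tau>] x frobenius_add[OF CHAR prime_p])
  then obtain b where b: "\<tau> b = b" "b ^ p - b = x ^ p - x" using Artin_Schreier by force
  have "(x - b) ^ p = x - b"
    unfolding frobenius_diff[OF CHAR prime_p] using b(2) by (simp add: algebra_simps)
  then obtain n where "x - b = of_nat n" using fixed_by_frobenius[OF prime_p CHAR] by metis
  then have "\<tau> (x - b) = x - b" using morphism_of_nat[OF \<tau>] by simp
  then show False using x b(1) by (simp add: morphism_diff[OF \<tau>])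
qed

text \<open>
  A linear map over the fixed field, with the fixed field as its kernel.
\<close>

definition \<delta> :: "'a \<Rightarrow> 'a" where "\<delta> x = \<tau> x - x"

lemma \<delta>_diff: "\<delta> (x - y) = \<delta> x - \<delta> y"
  by (simp add: \<delta>_def morphism_diff[OF \<tau>])

lemma \<delta>_0: "\<delta> 0 = 0"
  using \<delta>_diff[of 0 0] by simp

lemma \<delta>_add: "\<delta> (x + y) = \<delta> x + \<delta> y"
  by (simp add: \<delta>_def morphism_add[OF \<tau>])

lemma \<delta>_scale: "c \<in> F \<Longrightarrow> \<delta> (c * x) = c * \<delta> x"
  by (simp add: \<delta>_def morphism_mult[OF \<tau>] algebra_simps)

lemma \<delta>_eq_0: "\<delta> x = 0 \<longleftrightarrow> x \<in> F"
  by (simp add: \<delta>_def)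

text \<open>
  Otherwise \<open>\<tau>\<close> would shift \<open>y\<close> divided by \<open>\<delta> y\<close> by one.
\<close>

lemma fixed_image: "\<delta> y \<in> F \<Longrightarrow> \<delta> y = 0"
proof (rule ccontr)
  assume F: "\<delta> y \<in> F" and nz: "\<delta> y \<noteq> 0"
  have "\<tau> (y * inverse (\<delta> y)) = (y + \<delta> y) * inverse (\<delta> y)"
    using F by (simp add: morphism_mult[OF \<tau>] morphism_inverse[OF \<tau>]) (simp add: \<delta>_def)
  also have "\<dots> = y * inverse (\<delta> y) + 1" using nz by (simp add: distrib_right)
  finally show False using no_unit_shift by blast
qed

lemma \<delta>_funpow_eq_0: "(\<delta> ^^ Suc n) z = 0 \<Longrightarrow> \<delta> z = 0"
proof (induction n)
  case (Suc n)
  have "\<delta> ((\<delta> ^^ n) z) \<in> F"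
    by (rule \<delta>_eq_0[THEN iffD1]) (use Suc.prems in simp)
  then have "(\<delta> ^^ Suc n) z = 0" using fixed_image by simp
  then show ?case by (rule Suc.IH)
qed simp

lemma \<delta>_funpow_diff: "(\<delta> ^^ n) (x - y) = (\<delta> ^^ n) x - (\<delta> ^^ n) y"
  by (induction n) (simp_all add: \<delta>_diff)

text \<open>
  Kernel and image of \<open>\<delta>\<close> intersect trivially, so all positive powers of \<open>\<delta>\<close> have the same kernel. By
  the chain condition for their images, \<open>\<delta> ^^ (n + 1)\<close> maps \<open>x\<close> and some \<open>\<delta> y\<close> to the same point.
\<close>

lemma fixed_plus_image: "\<exists>y. x - \<delta> y \<in> F"
proof -
  obtain ps where ps: "\<And>qs. parametrised_field.dmap L K (ps @ qs) \<tau>"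
    using \<tau>_with_parameters by blast
  interpret parametrised_field L K "ps @ [x]" by (rule parametrised)
  have d: "dmap (\<delta> ^^ n)" for n
  proof (rule dmap_funpow)
    have "\<delta> = (\<lambda>x. \<tau> x - x)" by (simp add: fun_eq_iff \<delta>_def)
    then show "dmap \<delta>" using dmap_diff[OF ps dmap_id] by simp
  qed
  define H where "H n = range (\<delta> ^^ Suc n)" for n
  have "\<exists>n. H n \<inter> dpt \<subseteq> H (Suc n)"
  proof (rule trace_descending_chain[OF small])
    show "dset (H n)" for n unfolding H_def by (rule dset_image[OF d dset_UNIV])
    show "0 \<in> H n" for n
      unfolding H_def using \<delta>_funpow_diff[of "Suc n" 0 0] by (intro range_eqI[of _ _ 0]) simp
    show "u - v \<in> H n" if "u \<in> H n" "v \<in> H n" for n u v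
    proof -
      from that obtain y z where "u = (\<delta> ^^ Suc n) y" "v = (\<delta> ^^ Suc n) z"
        unfolding H_def by blast
      then have "u - v = (\<delta> ^^ Suc n) (y - z)" by (simp only: \<delta>_funpow_diff)
      then show ?thesis unfolding H_def by (rule range_eqI)
    qed
    show "H (Suc n) \<subseteq> H n" for n
    proof
      fix u assume "u \<in> H (Suc n)"
      then obtain y where "u = (\<delta> ^^ Suc (Suc n)) y" unfolding H_def by blast
      then have "u = (\<delta> ^^ Suc n) (\<delta> y)" by (simp only: funpow_Suc_right o_apply)
      then show "u \<in> H n" unfolding H_def by (rule range_eqI)
    qed
  qed
  then obtain n where n: "H n \<inter> dpt \<subseteq> H (Suc n)" ..
  have "(\<delta> ^^ Suc n) x \<in> H n" by (simp add: H_def)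
  moreover have "(\<delta> ^^ Suc n) x \<in> dpt" by (rule dpt_image[OF d dpt_param]) simp
  ultimately have "(\<delta> ^^ Suc n) x \<in> H (Suc n)" using n by blast
  then obtain y where "(\<delta> ^^ Suc n) x = (\<delta> ^^ Suc (Suc n)) y" unfolding H_def by blast
  then have "(\<delta> ^^ Suc n) (x - \<delta> y) = 0"
    by (simp only: \<delta>_funpow_diff) (simp only: funpow_Suc_right o_apply diff_self)
  then show ?thesis using \<delta>_funpow_eq_0 \<delta>_eq_0 by blast
qed

text \<open>
  By the decomposition of the whole field into \<open>F\<close> and the image \<open>W\<close> of \<open>\<delta>\<close>, there is a definable
  projection \<open>\<pi>\<close> onto \<open>F\<close>. The chain condition for the groups of all \<open>x\<close> with
  \<open>\<pi> x = \<pi> (a x) = \<dots> = \<pi> (a ^ (n - 1) x) = 0\<close> yields a linear relation between the functionals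
  \<open>x \<mapsto> \<pi> (a ^ j x)\<close> on the definable points. Since \<open>\<pi> 1 = 1\<close>, the same relation holds between the powers
  of \<open>a\<close>. So \<open>a\<close> is a root of a monic polynomial over \<open>F\<close>, and so are its finitely many
  conjugates.
\<close>

lemma \<tau>_periodic: "\<exists>m>0. (\<tau> ^^ m) a = a"
proof -
  obtain ps where ps: "\<And>qs. parametrised_field.dmap L K (ps @ qs) \<tau>"
    using \<tau>_with_parameters by blast
  interpret parametrised_field L K "ps @ [a]" by (rule parametrised)
  have d\<delta>: "dmap \<delta>"
  proof -
    have "\<delta> = (\<lambda>x. \<tau> x - x)" by (simp add: fun_eq_iff \<delta>_def)
    then show ?thesis using dmap_diff[OF ps dmap_id] by simp
  qed
  have a: "a \<in> dpt" by (rule dpt_param) simp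
  define W where "W = range \<delta>"
  have W0: "0 \<in> W" unfolding W_def by (rule range_eqI[of _ _ 0]) (simp add: \<delta>_0)
  have Wd: "u - v \<in> W" if "u \<in> W" "v \<in> W" for u v
  proof -
    from that obtain y z where "u = \<delta> y" "v = \<delta> z" unfolding W_def by blast
    then show ?thesis unfolding W_def by (intro range_eqI[of _ _ "y - z"]) (simp add: \<delta>_diff)
  qed
  have Ws: "c * u \<in> W" if c: "c \<in> F" and u: "u \<in> W" for c u
  proof -
    from u obtain y where "u = \<delta> y" unfolding W_def by blast
    then show ?thesis unfolding W_def using \<delta>_scale[OF c] by (intro range_eqI[of _ _ "c * y"]) simp
  qed
  have WF: "u = 0" if "u \<in> W" "u \<in> F" for u using that fixed_image unfolding W_def by blast
  have dW: "dset W" unfolding W_def by (rule dset_image[OF d\<delta> dset_UNIV])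
  have dF: "dset F" by (rule dset_fixed_points[OF ps])
  have Fd: "u - v \<in> F" if "u \<in> F" "v \<in> F" for u v using that by (simp add: morphism_diff[OF \<tau>])
  have Fm: "u * v \<in> F" if "u \<in> F" "v \<in> F" for u v using that by (simp add: morphism_mult[OF \<tau>])
  have F1: "1 \<in> F" and F0: "0 \<in> F" by (simp_all add: morphism_1[OF \<tau>] morphism_0[OF \<tau>])
  define \<pi> where "\<pi> x = (THE f. f \<in> F \<and> x - f \<in> W)" for x
  have uniq: "f = f'" if "f \<in> F" "x - f \<in> W" "f' \<in> F" "x - f' \<in> W" for x f f'
  proof -
    have "f' - f \<in> W" using Wd[OF that(2,4)] by simp
    then show ?thesis using WF Fd that by fastforce
  qed
  have ex: "\<exists>f. f \<in> F \<and> x - f \<in> W" for x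
  proof -
    obtain y where "x - \<delta> y \<in> F" using fixed_plus_image by blast
    then show ?thesis by (intro exI[of _ "x - \<delta> y"]) (simp add: W_def)
  qed
  have "\<pi> x \<in> F \<and> x - \<pi> x \<in> W" for x
    unfolding \<pi>_def
  proof (rule theI')
    show "\<exists>!f. f \<in> F \<and> x - f \<in> W" using ex[of x] uniq[of _ x] by blast
  qed
  then have \<pi>: "\<pi> x \<in> F" "x - \<pi> x \<in> W" for x by blast+
  have \<pi>I: "\<pi> x = f" if "f \<in> F" "x - f \<in> W" for x f
    using uniq[OF \<pi> that] .
  have \<pi>_diff: "\<pi> (x - y) = \<pi> x - \<pi> y" for x y
  proof (rule \<pi>I)
    show "\<pi> x - \<pi> y \<in> F" by (rule Fd[OF \<pi>(1) \<pi>(1)])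
    show "x - y - (\<pi> x - \<pi> y) \<in> W" using Wd[OF \<pi>(2)[of x] \<pi>(2)[of y]] by (simp add: algebra_simps)
  qed
  have \<pi>_scale: "\<pi> (c * x) = c * \<pi> x" if "c \<in> F" for c x
  proof (rule \<pi>I)
    show "c * \<pi> x \<in> F" by (rule Fm[OF that \<pi>(1)])
    show "c * x - c * \<pi> x \<in> W" using Ws[OF that \<pi>(2)[of x]] by (simp add: algebra_simps)
  qed
  have \<pi>_0: "\<pi> x = 0 \<longleftrightarrow> x \<in> W" for x using \<pi>I[OF F0, of x] \<pi>(2)[of x] by auto
  have \<pi>_1: "\<pi> 1 = 1" by (rule \<pi>I) (simp_all add: F1[simplified] W0)
  have \<pi>_dpt: "\<pi> x \<in> dpt" if "x \<in> dpt" for x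
  proof -
    have "{\<pi> x} = F \<inter> (\<lambda>f. x - f) -` W" using \<pi> \<pi>I by blast
    moreover have "dset (F \<inter> (\<lambda>f. x - f) -` W)"
      by (intro dset_Int dF dset_vimage dW dmap_diff dmap_const that dmap_id)
    ultimately show ?thesis by (simp add: dpt_def)
  qed
  define H where "H n = {x. \<forall>j<n. a ^ j * x \<in> W}" for n
  have dH: "dset (H n)" for n
  proof (induction n)
    case 0
    then show ?case using dset_UNIV by (simp add: H_def)
  next
    case (Suc n)
    have "H (Suc n) = H n \<inter> (\<lambda>x. a ^ n * x) -` W" by (auto simp: H_def less_Suc_eq)
    moreover have "dset ((\<lambda>x. a ^ n * x) -` W)"
      by (rule dset_vimage[OF dmap_mult[OF dmap_const[OF dpt_power[OF a]] dmap_id] dW])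
    ultimately show ?case using dset_Int[OF Suc] by simp
  qed
  have "\<exists>n. H n \<inter> dpt \<subseteq> H (Suc n)"
  proof (rule trace_descending_chain[OF small dH])
    show "0 \<in> H n" for n by (simp add: H_def W0)
    show "u - v \<in> H n" if "u \<in> H n" "v \<in> H n" for n u v
      using that Wd by (simp add: H_def right_diff_distrib)
    show "H (Suc n) \<subseteq> H n" for n by (auto simp: H_def)
  qed
  then obtain n where n: "H n \<inter> dpt \<subseteq> H (Suc n)" ..
  let ?F = "F \<inter> dpt"
  define lin where "lin g \<longleftrightarrow> (\<forall>x\<in>dpt. g x \<in> ?F) \<and> (\<forall>x\<in>dpt. \<forall>y\<in>dpt. g (x - y) = g x - g y) \<and>
        (\<forall>c\<in>?F. \<forall>x\<in>dpt. g (c * x) = c * g x)" for g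
  have lin: "lin (\<lambda>x. \<pi> (a ^ j * x))" for j
    unfolding lin_def
  proof (intro conjI ballI)
    fix x assume "x \<in> dpt"
    then show "\<pi> (a ^ j * x) \<in> ?F" using \<pi>(1) \<pi>_dpt[OF dpt_mult[OF dpt_power[OF a]]] by blast
  next
    fix x y show "\<pi> (a ^ j * (x - y)) = \<pi> (a ^ j * x) - \<pi> (a ^ j * y)"
      by (simp only: right_diff_distrib \<pi>_diff)
  next
    fix c x assume "c \<in> ?F"
    then have "\<pi> (c * (a ^ j * x)) = c * \<pi> (a ^ j * x)" by (intro \<pi>_scale) blast
    then show "\<pi> (a ^ j * (c * x)) = c * \<pi> (a ^ j * x)" by (simp add: mult.left_commute)
  qed
  have "\<exists>c. (\<forall>j<n. c j \<in> ?F) \<and> (\<forall>x\<in>dpt. \<pi> (a ^ n * x) = (\<Sum>j<n. c j * \<pi> (a ^ j * x)))"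
  proof (rule functional_in_span[OF _ _ _ _ _ _ lin_def])
    show "0 \<in> ?F" using F0 dpt_0 by blast
    show "u - v \<in> ?F" "u * v \<in> ?F" if "u \<in> ?F" "v \<in> ?F" for u v
      using that Fd Fm dpt_diff dpt_mult by blast+
    show "inverse u \<in> ?F" if "u \<in> ?F" for u
      using that dpt_inverse by (simp add: morphism_inverse[OF \<tau>])
    show "\<pi> (a ^ n * x) = 0" if "x \<in> dpt" "\<And>j. j < n \<Longrightarrow> \<pi> (a ^ j * x) = 0" for x
    proof -
      have "x \<in> H n" using that(2) by (simp add: H_def \<pi>_0)
      then have "x \<in> H (Suc n)" using n that(1) by blast
      then show ?thesis by (simp add: H_def \<pi>_0)
    qed
  qed (use dpt_diff dpt_mult lin in auto)
  then obtain c where c_lc: "(\<forall>j<n. c j \<in> ?F) \<and>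
      (\<forall>x\<in>dpt. \<pi> (a ^ n * x) = (\<Sum>j<n. c j * \<pi> (a ^ j * x)))" by (rule exE)
  have c: "c j \<in> ?F" if "j < n" for j
    by (rule c_lc[THEN conjunct1, rule_format, OF that])
  have lc: "\<pi> (a ^ n * x) = (\<Sum>j<n. c j * \<pi> (a ^ j * x))" if "x \<in> dpt" for x
    by (rule c_lc[THEN conjunct2, rule_format, OF that])
  \<comment> \<open>The functional \<open>x \<mapsto> \<pi> (y x)\<close> vanishes on the definable points, in particular at \<open>1/y\<close>.\<close>
  define y where "y = a ^ n - (\<Sum>j<n. c j * a ^ j)"
  have \<pi>_sum: "\<pi> (\<Sum>j<m. f j) = (\<Sum>j<m. \<pi> (f j))" for f :: "nat \<Rightarrow> 'a" and m
  proof (induction m)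
    case (Suc m)
    have "\<pi> (u + v) = \<pi> u + \<pi> v" for u v using \<pi>_diff[of "u + v" v] by simp
    then show ?case using Suc by simp
  qed (simp add: \<pi>_0 W0)
  have y0: "y = 0"
  proof (rule ccontr)
    assume "y \<noteq> 0"
    have dsum: "(\<Sum>j<m. c j * a ^ j) \<in> dpt" if "m \<le> n" for m
      using that by (induction m) (use c dpt_0 dpt_add dpt_mult dpt_power[OF a] in \<open>auto simp: Suc_le_eq\<close>)
    then have "y \<in> dpt" unfolding y_def using dpt_diff dpt_power[OF a] by blast
    then have x: "inverse y \<in> dpt" by (rule dpt_inverse)
    have "\<pi> ((\<Sum>j<n. c j * a ^ j) * inverse y) = (\<Sum>j<n. \<pi> (c j * (a ^ j * inverse y)))"
      by (simp add: sum_distrib_right \<pi>_sum mult.assoc)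
    also have "\<dots> = (\<Sum>j<n. c j * \<pi> (a ^ j * inverse y))"
      by (rule sum.cong[OF refl], rule \<pi>_scale) (use c in auto)
    also have "\<dots> = \<pi> (a ^ n * inverse y)" by (rule lc[OF x, symmetric])
    finally have "\<pi> (y * inverse y) = 0" unfolding y_def left_diff_distrib \<pi>_diff by simp
    then show False using \<open>y \<noteq> 0\<close> \<pi>_1 by simp
  qed
  define q where "q = Polynomial.monom 1 n - (\<Sum>j<n. Polynomial.monom (c j) j)"
  have pq: "poly q z = z ^ n - (\<Sum>j<n. c j * z ^ j)" for z
    by (simp add: q_def poly_monom poly_sum)
  have "Polynomial.coeff q n = 1" by (simp add: q_def coeff_sum)
  then have q0: "q \<noteq> 0" by auto
  have root: "poly q ((\<tau> ^^ i) a) = 0" for i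
  proof -
    have m: "field_morphism (\<tau> ^^ i)" by (rule morphism_funpow[OF \<tau>])
    have "(\<tau> ^^ i) (c j) = c j" if "j < n" for j
      using c[OF that] by (induction i) auto
    then have "(\<tau> ^^ i) (a ^ n - (\<Sum>j<n. c j * a ^ j)) = poly q ((\<tau> ^^ i) a)"
      by (simp add: pq morphism_diff[OF m] morphism_power[OF m] morphism_sum[OF m] morphism_mult[OF m])
    then show ?thesis using y0 morphism_0[OF m] by (simp add: y_def)
  qed
  have "finite (range (\<lambda>i. (\<tau> ^^ i) a))"
    using root by (intro finite_subset[OF _ poly_roots_finite[OF q0]]) auto
  then have "\<not> inj (\<lambda>i. (\<tau> ^^ i) a)" using range_inj_infinite by blast
  then obtain i j where "i \<noteq> j" "(\<tau> ^^ i) a = (\<tau> ^^ j) a" unfolding inj_def by blast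
  then obtain i j where ij: "i < j" "(\<tau> ^^ i) a = (\<tau> ^^ j) a" by (metis nat_neq_iff)
  then have "(\<tau> ^^ i) ((\<tau> ^^ (j - i)) a) = (\<tau> ^^ i) a"
    by (metis add_diff_inverse_nat comp_apply funpow_add less_imp_le not_le)
  then have "(\<tau> ^^ (j - i)) a = a" using morphism_inject[OF morphism_funpow[OF \<tau>]] by blast
  then show ?thesis using ij(1) by (intro exI[of _ "j - i"]) simp
qed

lemma \<tau>_funpow_binomial: "(\<tau> ^^ n) x = (\<Sum>j\<le>n. of_nat (n choose j) * (\<delta> ^^ j) x)"
proof (induction n)
  case (Suc n)
  have step: "(\<tau> ^^ Suc n) x = (\<tau> ^^ n) x + \<delta> ((\<tau> ^^ n) x)" by (simp add: \<delta>_def)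
  have d: "\<delta> (of_nat k * u) = of_nat k * \<delta> u" for k u
    by (rule \<delta>_scale) (simp add: morphism_of_nat[OF \<tau>])
  have dsum: "\<delta> (\<Sum>j\<le>m. f j) = (\<Sum>j\<le>m. \<delta> (f j))" for f :: "nat \<Rightarrow> 'a" and m
    by (induction m) (simp_all add: \<delta>_add)
  let ?g = "\<lambda>n j. of_nat (n choose j) * (\<delta> ^^ j) x"
  note step
  also have "(\<tau> ^^ n) x + \<delta> ((\<tau> ^^ n) x) = (\<Sum>j\<le>n. ?g n j) + (\<Sum>j\<le>n. of_nat (n choose j) * (\<delta> ^^ Suc j) x)"
    by (simp only: Suc.IH dsum d funpow.simps o_apply)
  also have "(\<Sum>j\<le>n. ?g n j) = (\<Sum>j\<le>Suc n. ?g n j)" by (simp add: binomial_eq_0)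
  also have "\<dots> = x + (\<Sum>j\<le>n. ?g n (Suc j))" by (simp only: sum.atMost_Suc_shift) simp
  finally have "(\<tau> ^^ Suc n) x = x + (\<Sum>j\<le>n. of_nat (Suc n choose Suc j) * (\<delta> ^^ Suc j) x)"
    by (simp add: sum.distrib distrib_right add_ac)
  also have "\<dots> = (\<Sum>j\<le>Suc n. ?g (Suc n) j)" by (simp only: sum.atMost_Suc_shift) simp
  finally show ?case .
qed simp

text \<open>
  In characteristic \<open>p\<close>, \<open>\<tau> ^^ p\<close> is the sum of the identity and \<open>\<delta> ^^ p\<close>, and \<open>\<delta> ^^ p\<close> has the same
  kernel as \<open>\<delta>\<close>.
\<close>

lemma fixed_if_period_CHAR:
  assumes "(\<tau> ^^ p) a = a"
  shows "\<tau> a = a"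
proof -
  have p1: "p > 1" by (rule prime_gt_1_nat[OF prime_p])
  have "of_nat (p choose j) = (0::'a)" if "0 < j" "j < p" for j
    using dvd_choose_prime[of j p] that prime_p CHAR by (simp add: of_nat_eq_0_iff_char_dvd)
  then have z: "(\<Sum>j\<in>{1..<p}. of_nat (p choose j) * (\<delta> ^^ j) a) = 0"
    by (intro sum.neutral) auto
  have "{..p} = insert 0 (insert p {1..<p})" using p1 by auto
  then have "(\<tau> ^^ p) a = a + (\<delta> ^^ p) a"
    using z p1 by (simp add: \<tau>_funpow_binomial)
  then have "(\<delta> ^^ Suc (p - 1)) a = 0" using assms p1 by simp
  then have "\<delta> a = 0" by (rule \<delta>_funpow_eq_0)
  then show ?thesis by (simp add: \<delta>_def)
qed

text \<open>
  The Lagrange resolvents \<open>R i\<close> satisfy \<open>\<zeta> ^ i * \<tau> (R i) = R i\<close>, so their \<open>r\<close>-th powers are fixed.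
  Since \<open>F\<close> is closed under taking \<open>r\<close>-th roots and contains the \<open>r\<close>-th roots of unity, the resolvents
  themselves are fixed, and so is their sum \<open>r a\<close>.
\<close>

lemma fixed_if_period_prime:
  assumes r: "prime r" "r \<noteq> p" and a: "(\<tau> ^^ r) a = a"
  shows "\<tau> a = a"
proof -
  interpret radically_closed F p by (rule fixed_field_radically_closed)
  have r1: "r > 1" by (rule prime_gt_1_nat[OF r(1)])
  obtain \<zeta> where \<zeta>: "\<tau> \<zeta> = \<zeta>" "\<zeta> ^ r = 1" "\<zeta> \<noteq> 1" using primitive_root_of_unity[OF r] by auto
  define R where "R i = (\<Sum>j<r. \<zeta> ^ (i * j) * (\<tau> ^^ j) a)" for i
  have \<zeta>i: "(\<zeta> ^ i) ^ r = 1" for i using \<zeta>(2) by (metis mult.commute power_mult power_one)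
  have R: "R i \<in> F" for i
  proof -
    let ?g = "\<lambda>j. \<zeta> ^ (i * j) * (\<tau> ^^ j) a"
    have "\<zeta> ^ i * \<tau> (R i) = (\<Sum>j<r. ?g (Suc j))"
      by (simp add: R_def morphism_sum[OF \<tau>] morphism_mult[OF \<tau>] morphism_power[OF \<tau>] \<zeta>(1)
          sum_distrib_left power_add mult.assoc)
    also have "\<dots> = (\<Sum>j<Suc r. ?g j) - ?g 0" by (simp only: sum.lessThan_Suc_shift) simp
    also have "\<dots> = R i" using a \<zeta>i by (simp add: R_def power_mult)
    finally have "(\<zeta> ^ i * \<tau> (R i)) ^ r = R i ^ r" by simp
    then have "R i ^ r \<in> F" using \<zeta>i by (simp add: power_mult_distrib morphism_power[OF \<tau>])
    then obtain v where v: "v \<in> F" "v ^ r = R i ^ r" using radicals[of r "R i ^ r"] r1 by auto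
    show ?thesis
    proof (cases "v = 0")
      case True
      then have "R i = 0" using v(2) r1 by (simp add: power_0_left)
      then show ?thesis by (simp add: morphism_0[OF \<tau>])
    next
      case False
      then have "(R i * inverse v) ^ r = 1" by (simp add: power_mult_distrib power_inverse v(2)[symmetric])
      then obtain k where "R i * inverse v = \<zeta> ^ k" using roots_of_unity_powers[OF r(1) \<zeta>(2,3)] by metis
      then have "R i = \<zeta> ^ k * v" using False by (simp add: field_simps)
      then show ?thesis using v(1) \<zeta>(1) by (simp add: morphism_mult[OF \<tau>] morphism_power[OF \<tau>])
    qed
  qed
  have orth: "(\<Sum>i<r. \<zeta> ^ (i * j)) = (if j = 0 then of_nat r else 0)" if "j < r" for j
  proof (cases "j = 0")
    case False
    have "\<zeta> ^ j \<noteq> 1"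
    proof
      assume "\<zeta> ^ j = 1"
      moreover have "coprime j r"
        using r(1) False that by (metis coprime_commute nat_dvd_not_less neq0_conv prime_imp_coprime)
      ultimately show False using root_of_unity_trivial[of \<zeta> j r] \<zeta>(2,3) False by blast
    qed
    moreover have "(\<Sum>i<r. \<zeta> ^ (i * j)) = (\<Sum>i<r. (\<zeta> ^ j) ^ i)"
      by (simp add: mult.commute flip: power_mult)
    ultimately show ?thesis using geometric_sum[of "\<zeta> ^ j" r] \<zeta>i False by simp
  qed simp
  have "(\<Sum>i<r. R i) = (\<Sum>j<r. (\<Sum>i<r. \<zeta> ^ (i * j)) * (\<tau> ^^ j) a)"
    unfolding R_def sum_distrib_right by (rule sum.swap)
  also have "\<dots> = (\<Sum>j<r. (if j = 0 then of_nat r * a else 0))"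
    by (rule sum.cong) (auto simp: orth)
  also have "\<dots> = of_nat r * a" using r1 by (simp add: sum.delta)
  finally have sum_R: "(\<Sum>i<r. R i) = of_nat r * a" .
  have "(\<Sum>i<r. R i) \<in> F" using R by (simp add: morphism_sum[OF \<tau>])
  then have "of_nat r * a \<in> F" unfolding sum_R .
  then have "of_nat r * \<tau> a = of_nat r * a"
    by (simp add: morphism_mult[OF \<tau>] morphism_of_nat[OF \<tau>])
  moreover have "of_nat r \<noteq> (0::'a)"
    using primes_dvd_imp_eq[OF prime_p r(1)] r(2) CHAR by (auto simp: of_nat_eq_0_iff_char_dvd)
  ultimately show ?thesis by simp
qed

end

text \<open>
  A point moved by \<open>\<sigma>\<close> has a finite orbit; a suitable power of \<open>\<sigma>\<close> moves it with prime period.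
\<close>

theorem definable_morphism_trivial:
  assumes def: "definable_morphism \<sigma>"
  shows "\<sigma> = id"
proof (rule ccontr)
  assume "\<sigma> \<noteq> id"
  then obtain a where a: "\<sigma> a \<noteq> a" by (auto simp: fun_eq_iff)
  define m where "m = (LEAST m. m > 0 \<and> (\<sigma> ^^ m) a = a)"
  have "\<exists>m. m > 0 \<and> (\<sigma> ^^ m) a = a" using \<tau>_periodic[OF def, of a] by blast
  then have m: "m > 0" "(\<sigma> ^^ m) a = a" and min: "\<And>k. 0 < k \<Longrightarrow> k < m \<Longrightarrow> (\<sigma> ^^ k) a \<noteq> a"
    unfolding m_def using LeastI_ex[of "\<lambda>m. m > 0 \<and> (\<sigma> ^^ m) a = a"] not_less_Least by blast+
  have "m \<noteq> 1" using m a by auto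
  then obtain r where r: "prime r" "r dvd m" using prime_factor_nat by blast
  then obtain k where k: "m = k * r" by (metis dvdE mult.commute)
  have r1: "r > 1" by (rule prime_gt_1_nat[OF r(1)])
  have k0: "k > 0" "k < m" using k m(1) r1 by auto
  note dk = definable_morphism_funpow[OF def, of k]
  have "((\<sigma> ^^ k) ^^ r) a = a" using m(2) k by (simp add: funpow_mult)
  then have "(\<sigma> ^^ k) a = a"
    using fixed_if_period_CHAR[OF dk] fixed_if_period_prime[OF dk r(1)] by (cases "r = p") auto
  then show False using min[OF k0] by contradiction
qed

end

section \<open>Ultrapowers\<close>

definition free_ultrafilter :: "nat set set \<Rightarrow> bool" where
  "free_ultrafilter U \<longleftrightarrow> (\<forall>S\<in>U. infinite S) \<and> (\<forall>S\<in>U. \<forall>T\<in>U. S \<inter> T \<in> U) \<and>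
     (\<forall>S\<in>U. \<forall>T. S \<subseteq> T \<longrightarrow> T \<in> U) \<and> (\<forall>S. S \<in> U \<or> - S \<in> U)"

lemma free_ultrafilter_exists: "\<exists>U. free_ultrafilter U"
proof -
  have "\<exists>p. {} \<subseteq> p \<and> p \<subseteq> UNIV \<and> (\<forall>\<Delta>. \<Delta> \<subseteq> p \<and> finite \<Delta> \<longrightarrow> infinite (\<Inter>\<Delta> :: nat set)) \<and>
    (\<forall>q. p \<subseteq> q \<and> q \<subseteq> UNIV \<and> (\<forall>\<Delta>. \<Delta> \<subseteq> q \<and> finite \<Delta> \<longrightarrow> infinite (\<Inter>\<Delta>)) \<longrightarrow> q = p)"
    by (rule finite_character_maximal) auto
  then obtain p where p: "\<And>\<Delta>. \<Delta> \<subseteq> p \<Longrightarrow> finite \<Delta> \<Longrightarrow> infinite (\<Inter>\<Delta> :: nat set)"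
    and max: "\<And>q. p \<subseteq> q \<Longrightarrow> \<forall>\<Delta>. \<Delta> \<subseteq> q \<and> finite \<Delta> \<longrightarrow> infinite (\<Inter>\<Delta>) \<Longrightarrow> q = p"
    by (metis subset_UNIV)
  \<comment> \<open>By maximality, a set lies in \<open>p\<close> if it meets all finite intersections of \<open>p\<close> in infinite sets.\<close>
  have mem: "S \<in> p" if S: "\<And>\<Delta>. \<Delta> \<subseteq> p \<Longrightarrow> finite \<Delta> \<Longrightarrow> infinite (S \<inter> \<Inter>\<Delta>)" for S
  proof -
    have "insert S p = p"
    proof (rule max)
      show "\<forall>\<Delta>. \<Delta> \<subseteq> insert S p \<and> finite \<Delta> \<longrightarrow> infinite (\<Inter>\<Delta>)"
      proof (intro allI impI)
        fix \<Delta> assume D: "\<Delta> \<subseteq> insert S p \<and> finite \<Delta>"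
        then have "infinite (S \<inter> \<Inter>(\<Delta> - {S}))" by (intro S) auto
        moreover have "S \<inter> \<Inter>(\<Delta> - {S}) \<subseteq> \<Inter>\<Delta>" by blast
        ultimately show "infinite (\<Inter>\<Delta>)" using finite_subset by blast
      qed
    qed auto
    then show ?thesis by blast
  qed
  have "free_ultrafilter p"
    unfolding free_ultrafilter_def
  proof (intro conjI ballI allI impI)
    show "infinite S" if "S \<in> p" for S using p[of "{S}"] that by simp
    show "S \<inter> T \<in> p" if "S \<in> p" "T \<in> p" for S T
    proof (rule mem)
      fix \<Delta> assume "\<Delta> \<subseteq> p" "finite \<Delta>"
      then show "infinite (S \<inter> T \<inter> \<Inter>\<Delta>)" using p[of "insert S (insert T \<Delta>)"] that by (simp add: Int_assoc)
    qed
    show "T \<in> p" if "S \<in> p" "S \<subseteq> T" for S T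
    proof (rule mem)
      fix \<Delta> assume "\<Delta> \<subseteq> p" "finite \<Delta>"
      then have "infinite (S \<inter> \<Inter>\<Delta>)" using p[of "insert S \<Delta>"] that by simp
      moreover have "S \<inter> \<Inter>\<Delta> \<subseteq> T \<inter> \<Inter>\<Delta>" using that by blast
      ultimately show "infinite (T \<inter> \<Inter>\<Delta>)" using finite_subset by blast
    qed
    show "S \<in> p \<or> - S \<in> p" for S
    proof (rule ccontr)
      assume neg: "\<not> ?thesis"
      then obtain \<Delta> where D: "\<Delta> \<subseteq> p" "finite \<Delta>" "finite (S \<inter> \<Inter>\<Delta>)" using mem[of S] by metis
      from neg obtain \<Gamma> where G: "\<Gamma> \<subseteq> p" "finite \<Gamma>" "finite (- S \<inter> \<Inter>\<Gamma>)" using mem[of "- S"] by metis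
      have "\<Inter>(\<Delta> \<union> \<Gamma>) \<subseteq> (S \<inter> \<Inter>\<Delta>) \<union> (- S \<inter> \<Inter>\<Gamma>)" by blast
      then have "finite (\<Inter>(\<Delta> \<union> \<Gamma>))" using D(3) G(3) finite_subset by blast
      then show False using p[of "\<Delta> \<union> \<Gamma>"] D G by simp
    qed
  qed
  then show ?thesis by blast
qed

definition chosen_ultrafilter :: "nat set set" where
  "chosen_ultrafilter = (SOME U. free_ultrafilter U)"

lemma chosen_ultrafilter: "free_ultrafilter chosen_ultrafilter"
  unfolding chosen_ultrafilter_def by (rule someI_ex[OF free_ultrafilter_exists])

definition almost_all :: "(nat \<Rightarrow> bool) \<Rightarrow> bool" where
  "almost_all P \<longleftrightarrow> {n. P n} \<in> chosen_ultrafilter"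

lemma almost_all_infinite: "almost_all P \<Longrightarrow> infinite {n. P n}"
  using chosen_ultrafilter by (simp add: free_ultrafilter_def almost_all_def)

lemma almost_all_mono:
  assumes "almost_all P" "\<And>n. P n \<Longrightarrow> Q n"
  shows "almost_all Q"
proof -
  have "{n. P n} \<subseteq> {n. Q n}" using assms(2) by blast
  then show ?thesis
    using chosen_ultrafilter assms(1) unfolding free_ultrafilter_def almost_all_def by metis
qed

lemma almost_all_mono2:
  assumes "almost_all P" "almost_all Q" "\<And>n. P n \<Longrightarrow> Q n \<Longrightarrow> R n"
  shows "almost_all R"
proof -
  have "{n. P n} \<inter> {n. Q n} \<in> chosen_ultrafilter"
    using chosen_ultrafilter assms(1,2) unfolding free_ultrafilter_def almost_all_def by metis
  then have "almost_all (\<lambda>n. P n \<and> Q n)" by (simp add: almost_all_def Collect_conj_eq)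
  then show ?thesis by (rule almost_all_mono) (use assms(3) in blast)
qed

lemma almost_all_conj: "almost_all (\<lambda>n. P n \<and> Q n) \<longleftrightarrow> almost_all P \<and> almost_all Q"
proof
  assume *: "almost_all (\<lambda>n. P n \<and> Q n)"
  show "almost_all P \<and> almost_all Q" by (intro conjI; rule almost_all_mono[OF *]; blast)
next
  assume "almost_all P \<and> almost_all Q"
  then have "almost_all P" "almost_all Q" by blast+
  then show "almost_all (\<lambda>n. P n \<and> Q n)" by (rule almost_all_mono2) blast
qed

lemma almost_all_ex: "almost_all P \<Longrightarrow> \<exists>n. P n"
  using almost_all_infinite[of P] not_finite_existsD by blast

lemma almost_all_not: "almost_all (\<lambda>n. \<not> P n) \<longleftrightarrow> \<not> almost_all P"
proof
  assume *: "almost_all (\<lambda>n. \<not> P n)"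
  show "\<not> almost_all P"
  proof
    assume "almost_all P"
    then have "almost_all (\<lambda>_. False)" using * by (rule almost_all_mono2) simp
    then show False using almost_all_ex by blast
  qed
next
  assume "\<not> almost_all P"
  then have "- {n. P n} \<in> chosen_ultrafilter"
    using chosen_ultrafilter unfolding free_ultrafilter_def almost_all_def by metis
  then show "almost_all (\<lambda>n. \<not> P n)" by (simp add: almost_all_def Collect_neg_eq)
qed

lemma almost_all_const [simp]: "almost_all (\<lambda>_. P) \<longleftrightarrow> P"
proof -
  have "\<not> almost_all (\<lambda>_. False)" using almost_all_ex[of "\<lambda>_. False"] by auto
  then show ?thesis using almost_all_not[of "\<lambda>_. False"] by (cases P) simp_all
qed

lemma almost_all_iff:
  assumes "almost_all (\<lambda>n. P n \<longleftrightarrow> Q n)"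
  shows "almost_all P \<longleftrightarrow> almost_all Q"
proof
  show "almost_all Q" if "almost_all P" using that assms by (rule almost_all_mono2) simp
  show "almost_all P" if "almost_all Q" using that assms by (rule almost_all_mono2) simp
qed

lemma almost_all_ball:
  "finite S \<Longrightarrow> (\<And>i. i \<in> S \<Longrightarrow> almost_all (\<lambda>n. P i n)) \<Longrightarrow> almost_all (\<lambda>n. \<forall>i\<in>S. P i n)"
  by (induction S rule: finite_induct) (simp_all add: almost_all_conj)

quotient_type 'a ultrapower = "nat \<Rightarrow> 'a" / "\<lambda>f g. almost_all (\<lambda>n. f n = g n)"
proof (rule equivpI)
  show "reflp (\<lambda>f g. almost_all (\<lambda>n. f n = (g n :: 'a)))" by (simp add: reflp_def)
  show "symp (\<lambda>f g. almost_all (\<lambda>n. f n = (g n :: 'a)))"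
    by (rule sympI) (erule almost_all_mono, simp)
  show "transp (\<lambda>f g. almost_all (\<lambda>n. f n = (g n :: 'a)))"
  proof (rule transpI)
    fix f g h :: "nat \<Rightarrow> 'a"
    assume "almost_all (\<lambda>n. f n = g n)" "almost_all (\<lambda>n. g n = h n)"
    then show "almost_all (\<lambda>n. f n = h n)" by (rule almost_all_mono2) simp
  qed
qed

lemma abs_eq_iff: "abs_ultrapower f = abs_ultrapower g \<longleftrightarrow> almost_all (\<lambda>n. f n = g n)"
  by (rule ultrapower.abs_eq_iff)

lemma abs_rep [simp]: "abs_ultrapower (rep_ultrapower x) = x"
  by (rule Quotient_abs_rep[OF Quotient_ultrapower])

lemma rep_abs: "almost_all (\<lambda>n. rep_ultrapower (abs_ultrapower f) n = f n)"
  using abs_eq_iff[of "rep_ultrapower (abs_ultrapower f)" f] by simp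

instantiation ultrapower :: (field) field
begin

lift_definition zero_ultrapower :: "'a ultrapower" is "\<lambda>_. 0" .
lift_definition one_ultrapower :: "'a ultrapower" is "\<lambda>_. 1" .
lift_definition plus_ultrapower :: "'a ultrapower \<Rightarrow> 'a ultrapower \<Rightarrow> 'a ultrapower"
  is "\<lambda>f g n. f n + g n"
  by (erule (1) almost_all_mono2) simp
lift_definition minus_ultrapower :: "'a ultrapower \<Rightarrow> 'a ultrapower \<Rightarrow> 'a ultrapower"
  is "\<lambda>f g n. f n - g n"
  by (erule (1) almost_all_mono2) simp
lift_definition times_ultrapower :: "'a ultrapower \<Rightarrow> 'a ultrapower \<Rightarrow> 'a ultrapower"
  is "\<lambda>f g n. f n * g n"
  by (erule (1) almost_all_mono2) simp
lift_definition divide_ultrapower :: "'a ultrapower \<Rightarrow> 'a ultrapower \<Rightarrow> 'a ultrapower"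
  is "\<lambda>f g n. f n / g n"
  by (erule (1) almost_all_mono2) simp
lift_definition uminus_ultrapower :: "'a ultrapower \<Rightarrow> 'a ultrapower"
  is "\<lambda>f n. - f n" by (erule almost_all_mono) simp
lift_definition inverse_ultrapower :: "'a ultrapower \<Rightarrow> 'a ultrapower"
  is "\<lambda>f n. inverse (f n)" by (erule almost_all_mono) simp

instance
proof
  fix a b c :: "'a ultrapower"
  show "a * b * c = a * (b * c)" by transfer (simp add: mult.assoc)
  show "a * b = b * a" by transfer (simp add: mult.commute)
  show "1 * a = a" by transfer simp
  show "a + b + c = a + (b + c)" by transfer (simp add: add.assoc)
  show "a + b = b + a" by transfer (simp add: add.commute)
  show "0 + a = a" by transfer simp
  show "- a + a = 0" by transfer simp
  show "a - b = a + - b" by transfer simp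
  show "(a + b) * c = a * c + b * c" by transfer (simp add: distrib_right)
  show "(0::'a ultrapower) \<noteq> 1" by transfer simp
  show "a \<noteq> 0 \<Longrightarrow> inverse a * a = 1"
    by transfer (unfold almost_all_not[symmetric], erule almost_all_mono, simp)
  show "a div b = a * inverse b" by transfer (simp add: divide_inverse)
  show "inverse (0::'a ultrapower) = 0" by transfer simp
qed

end

lemma of_nat_ultrapower: "of_nat m = abs_ultrapower (\<lambda>_. of_nat m)"
  by (induction m) (simp_all add: zero_ultrapower_def one_ultrapower_def plus_ultrapower.abs_eq)

lemma power_ultrapower: "abs_ultrapower f ^ m = abs_ultrapower (\<lambda>n. f n ^ m)"
  by (induction m) (simp_all add: one_ultrapower_def times_ultrapower.abs_eq)

lemma CHAR_ultrapower_pos: "CHAR('a::field) > 0 \<Longrightarrow> CHAR('a ultrapower) > 0"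
  unfolding CHAR_pos_iff by (metis of_nat_ultrapower zero_ultrapower_def)

definition ultrapower_struc :: "('a, 'f, 'r) struc \<Rightarrow> ('a ultrapower, 'f, 'r) struc" where
  "ultrapower_struc M =
     \<lparr>fun_interp = (\<lambda>f xs. abs_ultrapower (\<lambda>n. fun_interp M f (map (\<lambda>x. rep_ultrapower x n) xs))),
      rel_interp = (\<lambda>r xs. almost_all (\<lambda>n. rel_interp M r (map (\<lambda>x. rep_ultrapower x n) xs)))\<rparr>"

lemma Los_trm:
  "eval_trm (ultrapower_struc M) e t = abs_ultrapower (\<lambda>n. eval_trm M (\<lambda>i. rep_ultrapower (e i) n) t)"
proof (induction t)
  case (Var i)
  show ?case by simp
next
  case (Fun f ts)
  let ?e = "\<lambda>n i. rep_ultrapower (e i) n"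
  have "almost_all (\<lambda>n. \<forall>t\<in>set ts.
      rep_ultrapower (eval_trm (ultrapower_struc M) e t) n = eval_trm M (?e n) t)"
    by (rule almost_all_ball) (simp_all only: Fun.IH rep_abs finite_set)
  then have "almost_all (\<lambda>n. fun_interp M f (map (\<lambda>x. rep_ultrapower x n)
      (map (eval_trm (ultrapower_struc M) e) ts)) = fun_interp M f (map (eval_trm M (?e n)) ts))"
    by (rule almost_all_mono) (simp add: o_def cong: map_cong)
  then show ?case by (simp add: ultrapower_struc_def abs_eq_iff)
qed

text \<open>
  The theorem of Los. In the quantifier step a witness in the ultrapower is assembled from
  witnesses in the coordinates.
\<close>

theorem Los:
  "sat (ultrapower_struc M) e \<phi> \<longleftrightarrow> almost_all (\<lambda>n. sat M (\<lambda>i. rep_ultrapower (e i) n) \<phi>)"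
proof (induction \<phi> arbitrary: e)
  case (Eq s t)
  show ?case by (simp add: Los_trm abs_eq_iff)
next
  case (Rel r ts)
  let ?e = "\<lambda>n i. rep_ultrapower (e i) n"
  have eq: "almost_all (\<lambda>n. \<forall>t\<in>set ts.
      rep_ultrapower (eval_trm (ultrapower_struc M) e t) n = eval_trm M (?e n) t)"
    by (rule almost_all_ball) (simp_all only: Los_trm rep_abs finite_set)
  have "almost_all (\<lambda>n. rel_interp M r (map (\<lambda>x. rep_ultrapower x n)
      (map (eval_trm (ultrapower_struc M) e) ts))) \<longleftrightarrow>
    almost_all (\<lambda>n. rel_interp M r (map (eval_trm M (?e n)) ts))"
    (is "almost_all ?P \<longleftrightarrow> almost_all ?Q")
  proof -
    have "almost_all (\<lambda>n. ?P n \<longleftrightarrow> ?Q n)"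
      using eq by (rule almost_all_mono) (simp add: o_def cong: map_cong)
    then show ?thesis by (rule almost_all_iff)
  qed
  then show ?case by (simp add: ultrapower_struc_def)
next
  case (Neg \<phi>)
  then show ?case by (simp add: almost_all_not)
next
  case (And \<phi> \<psi>)
  then show ?case by (simp add: almost_all_conj)
next
  case (Ex i \<phi>)
  let ?e = "\<lambda>n i. rep_ultrapower (e i) n"
  have upd: "(\<lambda>j. rep_ultrapower ((e(i := a)) j) n) = (?e n)(i := rep_ultrapower a n)" for a n
    by auto
  have "(\<exists>a. almost_all (\<lambda>n. sat M ((?e n)(i := rep_ultrapower a n)) \<phi>)) \<longleftrightarrow>
      almost_all (\<lambda>n. \<exists>b. sat M ((?e n)(i := b)) \<phi>)"
  proof
    assume "\<exists>a. almost_all (\<lambda>n. sat M ((?e n)(i := rep_ultrapower a n)) \<phi>)"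
    then show "almost_all (\<lambda>n. \<exists>b. sat M ((?e n)(i := b)) \<phi>)"
      by (elim exE almost_all_mono) (rule exI)
  next
    assume *: "almost_all (\<lambda>n. \<exists>b. sat M ((?e n)(i := b)) \<phi>)"
    define b where "b n = (SOME b. sat M ((?e n)(i := b)) \<phi>)" for n
    have "almost_all (\<lambda>n. sat M ((?e n)(i := b n)) \<phi>)"
      using * unfolding b_def by (rule almost_all_mono) (rule someI_ex)
    then have "almost_all (\<lambda>n. sat M ((?e n)(i := rep_ultrapower (abs_ultrapower b) n)) \<phi>)"
      using rep_abs[of b] by (rule almost_all_mono2) simp
    then show "\<exists>a. almost_all (\<lambda>n. sat M ((?e n)(i := rep_ultrapower a n)) \<phi>)" by (rule exI)
  qed
  then show ?case by (simp only: sat.simps Ex.IH upd)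
qed

lemma small_ultrapower:
  assumes "small L M"
  shows "small L (ultrapower_struc M)"
proof -
  have "(\<forall>e. sat (ultrapower_struc M) e \<phi>) \<longleftrightarrow> (\<forall>e. sat M e \<phi>)" if "\<phi> \<in> formulas L 0" for \<phi>
  proof -
    have indep: "sat M e \<phi> \<longleftrightarrow> sat M e' \<phi>" for e e'
      by (rule sat_cong) (use that in \<open>auto simp: formulas_def\<close>)
    show ?thesis
    proof
      assume "\<forall>e. sat (ultrapower_struc M) e \<phi>"
      then have "\<exists>e. sat M e \<phi>" unfolding Los using almost_all_ex by blast
      then show "\<forall>e. sat M e \<phi>" using indep by blast
    qed (simp add: Los)
  qed
  then have "theory_of L (ultrapower_struc M) = theory_of L M"
    unfolding theory_of_def by blast
  then show ?thesis using assms complete_types_cong unfolding small_def by metis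
qed

lemma expands_field_ultrapower:
  fixes M :: "('a::field, 'f field_sym, 'r) struc"
  assumes "expands_field L M"
  shows "expands_field L (ultrapower_struc M)"
proof -
  have "abs_ultrapower (\<lambda>n. rep_ultrapower x n + rep_ultrapower y n) = x + y"
    "abs_ultrapower (\<lambda>n. rep_ultrapower x n * rep_ultrapower y n) = x * y"
    "abs_ultrapower (\<lambda>n. - rep_ultrapower x n) = - x" for x y :: "'a ultrapower"
    by (simp_all flip: plus_ultrapower.abs_eq times_ultrapower.abs_eq uminus_ultrapower.abs_eq)
  then show ?thesis
    using assms unfolding expands_field_def
    by (simp add: ultrapower_struc_def zero_ultrapower_def one_ultrapower_def)
qed

definition ultrapower_map :: "('a \<Rightarrow> 'a) \<Rightarrow> 'a ultrapower \<Rightarrow> 'a ultrapower" where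
  "ultrapower_map g x = abs_ultrapower (\<lambda>n. g (rep_ultrapower x n))"

lemma ultrapower_map_abs: "ultrapower_map g (abs_ultrapower f) = abs_ultrapower (\<lambda>n. g (f n))"
  unfolding ultrapower_map_def abs_eq_iff using rep_abs[of f] by (rule almost_all_mono) simp

lemma field_morphism_ultrapower:
  assumes "field_morphism g"
  shows "field_morphism (ultrapower_map g)"
proof -
  have "ultrapower_map g (abs_ultrapower f + abs_ultrapower h) =
      ultrapower_map g (abs_ultrapower f) + ultrapower_map g (abs_ultrapower h)"
    "ultrapower_map g (abs_ultrapower f * abs_ultrapower h) =
      ultrapower_map g (abs_ultrapower f) * ultrapower_map g (abs_ultrapower h)" for f h
    using assms by (simp_all add: ultrapower_map_abs field_morphism_def
        plus_ultrapower.abs_eq times_ultrapower.abs_eq)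
  then have "ultrapower_map g (x + y) = ultrapower_map g x + ultrapower_map g y"
    "ultrapower_map g (x * y) = ultrapower_map g x * ultrapower_map g y" for x y
    using abs_rep by metis+
  then show ?thesis using assms
    by (simp add: field_morphism_def ultrapower_map_abs zero_ultrapower_def one_ultrapower_def)
qed

lemma definable_fun_ultrapower:
  assumes "definable_fun L M g"
  shows "definable_fun L (ultrapower_struc M) (ultrapower_map g)"
proof -
  from assms obtain \<phi> c where \<phi>: "wf_fm L \<phi>"
    "{[x, g x] | x. True} =
      {xs. length xs = 2 \<and> sat M (\<lambda>i. if i < 2 then xs ! i else c (i - 2)) \<phi>}"
    unfolding definable_fun_def definable_set_def by blast
  have graph: "sat M (\<lambda>i. if i < 2 then [x, y] ! i else c (i - 2)) \<phi> \<longleftrightarrow> y = g x" for x y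
  proof -
    have "[x, y] \<in> {[x, g x] | x. True} \<longleftrightarrow> y = g x" by auto
    then show ?thesis unfolding \<phi>(2) by simp
  qed
  define c' where "c' i = abs_ultrapower (\<lambda>_. c i)" for i
  have "sat (ultrapower_struc M) (\<lambda>i. if i < 2 then [x, y] ! i else c' (i - 2)) \<phi> \<longleftrightarrow>
      y = ultrapower_map g x" for x y
  proof -
    let ?x = "rep_ultrapower x" and ?y = "rep_ultrapower y"
    let ?e = "\<lambda>n i. rep_ultrapower (if i < 2 then [x, y] ! i else c' (i - 2)) n"
    let ?d = "\<lambda>n i. if i < 2 then [?x n, ?y n] ! i else c (i - 2)"
    have "almost_all (\<lambda>n. \<forall>i\<in>free_vars \<phi>. rep_ultrapower (c' (i - 2)) n = c (i - 2))"
      by (rule almost_all_ball[OF finite_free_vars]) (simp only: c'_def rep_abs)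
    then have "almost_all (\<lambda>n. sat M (?e n) \<phi> \<longleftrightarrow> sat M (?d n) \<phi>)"
      by (rule almost_all_mono) (rule sat_cong, auto simp: less_2_cases_iff)
    then have iff: "almost_all (\<lambda>n. sat M (?e n) \<phi> \<longleftrightarrow> ?y n = g (?x n))" unfolding graph .
    then have "almost_all (\<lambda>n. sat M (?e n) \<phi>) \<longleftrightarrow> almost_all (\<lambda>n. ?y n = g (?x n))"
      by (rule almost_all_iff)
    also have "\<dots> \<longleftrightarrow> y = ultrapower_map g x"
      unfolding ultrapower_map_def abs_eq_iff[symmetric] by simp
    finally show ?thesis unfolding Los .
  qed
  note graph' = this
  have "{[x, ultrapower_map g x] | x. True} =
      {xs. length xs = 2 \<and> sat (ultrapower_struc M) (\<lambda>i. if i < 2 then xs ! i else c' (i - 2)) \<phi>}"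
    (is "?A = ?B")
  proof (rule Set.set_eqI)
    fix xs
    show "xs \<in> ?A \<longleftrightarrow> xs \<in> ?B"
    proof (cases "length xs = 2")
      case True
      then obtain x y where xs: "xs = [x, y]"
        by (auto simp: numeral_2_eq_2 length_Suc_conv)
      then show ?thesis using graph'[of x y] by auto
    qed auto
  qed
  then show ?thesis using \<phi>(1) unfolding definable_fun_def definable_set_def by blast
qed

lemma ultrapower_map_eq_idD:
  assumes "ultrapower_map g = id"
  shows "g = id"
proof
  fix x
  have "abs_ultrapower (\<lambda>_. g x) = abs_ultrapower (\<lambda>_. x)"
    using assms ultrapower_map_abs[of g "\<lambda>_. x"] by simp
  then show "g x = id x" by (simp add: abs_eq_iff)
qed

text \<open>
  The class of an injective sequence in \<open>S\<close> works: two distinct powers of it are equal only if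
  infinitely many elements of \<open>S\<close> are roots of one nonzero polynomial.
\<close>

lemma ultrapower_transcendental:
  fixes S :: "'a::field set"
  assumes "infinite S"
  shows "\<exists>t :: 'a ultrapower. inj (\<lambda>n. t ^ n) \<and>
    (\<forall>g. (\<forall>x\<in>S. g x = x) \<longrightarrow> ultrapower_map g t = t)"
proof -
  obtain a :: "nat \<Rightarrow> 'a" where a: "inj a" "range a \<subseteq> S"
    using infinite_countable_subset[OF assms] by blast
  have less: "abs_ultrapower a ^ i \<noteq> abs_ultrapower a ^ j" if "i < j" for i j
  proof
    assume "abs_ultrapower a ^ i = abs_ultrapower a ^ j"
    then have inf: "infinite {n. a n ^ i = a n ^ j}"
      by (intro almost_all_infinite) (simp add: power_ultrapower abs_eq_iff)
    let ?q = "Polynomial.monom 1 j - Polynomial.monom 1 i :: 'a poly"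
    have "Polynomial.coeff ?q j = 1" using that by simp
    then have "?q \<noteq> 0" by (metis coeff_0 zero_neq_one)
    then have "finite {x. poly ?q x = 0}" by (rule poly_roots_finite)
    then have "finite (a -` {x. poly ?q x = 0})" using a(1) by (rule finite_vimageI)
    moreover have "{n. a n ^ i = a n ^ j} \<subseteq> a -` {x. poly ?q x = 0}" by (auto simp: poly_monom)
    ultimately show False using inf finite_subset by blast
  qed
  have "inj (\<lambda>n. abs_ultrapower a ^ n)"
  proof (rule injI)
    fix i j assume "abs_ultrapower a ^ i = abs_ultrapower a ^ j"
    then show "i = j" using less[of i j] less[of j i] by (metis nat_neq_iff)
  qed
  moreover have "ultrapower_map g (abs_ultrapower a) = abs_ultrapower a"
    if "\<forall>x\<in>S. g x = x" for g
    using a(2) that by (simp add: ultrapower_map_abs subset_iff)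
  ultimately show ?thesis by (intro exI[of _ "abs_ultrapower a"]) blast
qed

section \<open>The theorem\<close>

theorem theorem4p4:
  fixes L :: "('f field_sym, 'r) language"
    and K :: "('a::field, 'f field_sym, 'r) struc"
    and \<sigma> :: "'a \<Rightarrow> 'a"
  assumes "expands_field L K"
    and "small L K"
    and "CHAR('a) > 0"
    and "field_morphism \<sigma>"
    and "definable_fun L K \<sigma>"
    and "infinite {x. \<sigma> x = x}"
  shows "\<sigma> = id"
proof -
  obtain t :: "'a ultrapower" where t: "inj (\<lambda>n. t ^ n)"
    and fixed: "\<forall>g. (\<forall>x\<in>{x. \<sigma> x = x}. g x = x) \<longrightarrow> ultrapower_map g t = t"
    using ultrapower_transcendental[OF assms(6)] by blast
  note expands = expands_field_ultrapower[OF assms(1)]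
  interpret small_field_with_transcendental L "ultrapower_struc K" "CHAR('a ultrapower)" t
  proof
    show "expands_field L (ultrapower_struc K)" by (rule expands)
    show "small L (ultrapower_struc K)" by (rule small_ultrapower[OF assms(2)])
    show "prime CHAR('a ultrapower)"
      by (rule prime_CHAR_semidom[OF CHAR_ultrapower_pos[OF assms(3)]])
    show "inj (\<lambda>n. t ^ n)" by (rule t)
  qed (rule refl)
  have "\<exists>ps. \<forall>qs. parametrised_field.dmap L (ultrapower_struc K) (ps @ qs) (ultrapower_map \<sigma>)"
    by (rule definable_over_params[OF expands definable_fun_ultrapower[OF assms(5)]])
  moreover have "ultrapower_map \<sigma> t = t" using fixed by simp
  ultimately have "definable_morphism (ultrapower_map \<sigma>)"
    using field_morphism_ultrapower[OF assms(4)] unfolding definable_morphism_def by blast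
  then have "ultrapower_map \<sigma> = id" by (rule definable_morphism_trivial)
  then show "\<sigma> = id" by (rule ultrapower_map_eq_idD)
qed

end
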